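(* Let $\Lambda\subset V$ be finite and let $\overline{E}(\Lambda)\subset E$ be the set of edges with at least one endpoint in $\Lambda$. Let $\mu$ be a probability measure on pairs $(\mathsf{a},\omega)\in(\mathbb{R}^+)^{\Lambda}\times\{0,1\}^{\overline{E}(\Lambda)}$ that is weakly monotonic and such that for any vertex $z\in\Lambda$ and any increasing function $f:\{0,1\}^{\overline{E}(\Lambda)}\to[0,1]$ depending only on the states of edges, $$\mu[f(\omega)\mid \omega_{xz}=0\ \ \forall x\sim z]\le\mu[f(\omega)\mid \mathsf{a}_z=0].$$ Then for any increasing function $f:\{0,1\}^{\overline{E}(\Lambda)}\to[0,1]$ depending only on the states of edges and any admissible decision tree $T$ on $\Lambda$, $$\mathrm{Var}_\mu(f)\le\sum_{xy\in\overline{E}(\Lambda)}\delta_{xy}(f,T)\,\mathrm{Cov}_\mu(f,\omega_{xy}).$$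
   Context: $G=(V,E)$ is a fixed infinite, connected, locally finite, transitive graph; edges are undirected and written $xy$; $x\sim y$ means $xy\in E$; $\mathbb{R}^+=[0,\infty)$; $d_G$ is the graph distance and $\partial^{\mathrm{ext}}\Lambda=\{x\in V\setminus\Lambda: d_G(x,\Lambda)=1\}$. Functions of $(\mathsf a,\omega)$ are increasing if they are non-decreasing for the coordinatewise partial order. $\mu_1\preceq\mu_2$ means $\mu_1[h]\le\mu_2[h]$ for every bounded (measurable) increasing $h$. Conditional measures. $\mu[\,\cdot\mid \mathsf{a}|_{\Lambda'}=\eta,\omega|_{E'}=\theta]$ denotes a fixed regular conditional distribution, given for all values $(\eta,\theta)$ and chosen consistently (conditioning one of these measures on further coordinates gives the corresponding measure of the family); the same family is used in all conditions, and $\mu[\,\cdot\mid\mathsf{a}_z=0]$ is the member with $\Lambda'=\{z\}$, $E'=\emptyset$, $\eta_z=0$. Weak monotonicity. $\mu$ is weakly monotonic if for any $\Lambda'\subset\Lambda$, any $E'\subset\{xy\in\overline{E}(\Lambda'): x,y\in\Lambda'\cup\partial^{\mathrm{ext}}\Lambda\}$ (where $\overline{E}(\Lambda')$ is the set of edges with at least one endpoint in $\Lambda'$), and any $\mathsf{a}_1\le\mathsf{a}_2$ in $(\mathbb{R}^+)^{\Lambda'}$, $\omega_1\le\omega_2$ in $\{0,1\}^{E'}$ (pointwise), $$\mu[\,\cdot\mid\mathsf{a}|_{\Lambda'}=\mathsf{a}_1,\omega|_{E'}=\omega_1]\preceq\mu[\,\cdot\mid\mathsf{a}|_{\Lambda'}=\mathsf{a}_2,\omega|_{E'}=\omega_2].$$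 Decision trees. Let $n=|\Lambda\cup\overline{E}(\Lambda)|$. For an $n$-tuple $x=(x_1,\dots,x_n)$ write $x_{[t]}=(x_1,\dots,x_t)$, $\omega_{x_{[t]}}$ for the restriction of $\omega$ to the edges among $x_1,\dots,x_t$, and $(\mathsf{a},\omega)_{x_{[t]}}$ for the restriction of $(\mathsf{a},\omega)$ to the vertices and edges among $x_1,\dots,x_t$. A decision tree on $\Lambda$ is a pair $T=(x_1,(\psi_t)_{2\le t\le n})$ with $x_1\in\Lambda\cup\overline{E}(\Lambda)$, where $\psi_t$ takes as input $x_{[t-1]}$ and $(\mathsf{a},\omega)_{x_{[t-1]}}$ and returns an element $x_t\in(\Lambda\cup\overline{E}(\Lambda))\setminus\{x_1,\dots,x_{t-1}\}$. $T$ is admissible if every edge is revealed only after all of its endpoints lying in $\Lambda$ have been revealed. For $f:\{0,1\}^{\overline{E}(\Lambda)}\to[0,1]$ let $$\tau_{f,T}(\mathsf{a},\omega)=\min\{t\ge1:\forall\omega'\in\{0,1\}^{\overline{E}(\Lambda)},\ \omega'_{x_{[t]}}=\omega_{x_{[t]}}\Rightarrow f(\omega')=f(\omega)\}.$$ For $X\in\Lambda\cup\overline{E}(\Lambda)$, $R_{f,T}(X)$ is the event that $x_t=X$ for some $t\le\tau_{f,T}(\mathsf{a},\omega)$. With $C_x=\{\omega_{xy}=0\ \forall y\sim x\}$, set $$\delta_{xy}(f,T)=\mu[R_{f,T}(xy)]+\frac{\mu[R_{f,T}(x)]}{\mu[C_x]}+\frac{\mu[R_{f,T}(y)]}{\mu[C_y]},$$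 where a quotient $\mu[R_{f,T}(x)]/\mu[C_x]$ is interpreted as $0$ if $x\notin\Lambda$. It is assumed that $\mu[C_x]>0$ for every $x\in\Lambda$. *)

theory Defs
  imports "HOL-Probability.Probability"
begin

section \<open>The graph\<close>

definition adj :: "'v set set \<Rightarrow> ('v \<times> 'v) set" where
  "adj E = {(x, y). {x, y} \<in> E}"

definition graph_automorphism :: "'v set \<Rightarrow> 'v set set \<Rightarrow> ('v \<Rightarrow> 'v) \<Rightarrow> bool" where
  "graph_automorphism V E \<phi> \<longleftrightarrow>
     bij_betw \<phi> V V \<and> (\<forall>x\<in>V. \<forall>y\<in>V. {x, y} \<in> E \<longleftrightarrow> {\<phi> x, \<phi> y} \<in> E)"

text \<open>An edge is a two-element set of vertices.\<close>

locale infinite_transitive_graph =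
  fixes V :: "'v set" and E :: "'v set set"
  assumes edges: "E \<subseteq> {{x, y} | x y. x \<in> V \<and> y \<in> V \<and> x \<noteq> y}"
    and infinite: "infinite V"
    and connected: "\<And>x y. x \<in> V \<Longrightarrow> y \<in> V \<Longrightarrow> (x, y) \<in> (adj E)\<^sup>*"
    and locally_finite: "\<And>x. x \<in> V \<Longrightarrow> finite {y. {x, y} \<in> E}"
    and transitive: "\<And>x y. x \<in> V \<Longrightarrow> y \<in> V \<Longrightarrow> \<exists>\<phi>. graph_automorphism V E \<phi> \<and> \<phi> x = y"

definition graph_dist :: "'v set set \<Rightarrow> 'v \<Rightarrow> 'v \<Rightarrow> nat" where
  "graph_dist E x y = (LEAST n. (x, y) \<in> adj E ^^ n)"

definition ext_boundary :: "'v set \<Rightarrow> 'v set set \<Rightarrow> 'v set \<Rightarrow> 'v set" where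
  "ext_boundary V E A = {x \<in> V - A. (INF y\<in>A. graph_dist E x y) = 1}"

definition incident_edges :: "'v set set \<Rightarrow> 'v set \<Rightarrow> 'v set set" where
  "incident_edges E A = {e \<in> E. e \<inter> A \<noteq> {}}"


section \<open>Configurations\<close>

text \<open>The states \<open>0\<close> and \<open>1\<close> of an edge are \<open>False\<close> and \<open>True\<close>. Configurations on vertices \<open>A\<close> and
  edges \<open>F\<close> are extensional, so the library order on pairs of functions is the coordinatewise
  order on \<open>space (cfg_space A F)\<close>.\<close>

type_synonym 'v cfg = "('v \<Rightarrow> real) \<times> ('v set \<Rightarrow> bool)"

definition edge_cfgs :: "'v set set \<Rightarrow> ('v set \<Rightarrow> bool) set" where
  "edge_cfgs F = (\<Pi>\<^sub>E e\<in>F. UNIV)"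

definition cfg_space :: "'v set \<Rightarrow> 'v set set \<Rightarrow> 'v cfg measure" where
  "cfg_space A F =
     (\<Pi>\<^sub>M x\<in>A. restrict_space borel {0..}) \<Otimes>\<^sub>M (\<Pi>\<^sub>M e\<in>F. count_space UNIV)"

definition restrict_cfg :: "'v set \<Rightarrow> 'v set set \<Rightarrow> 'v cfg \<Rightarrow> 'v cfg" where
  "restrict_cfg A F c = (restrict (fst c) A, restrict (snd c) F)"

definition merge_cfg ::
  "'v set \<Rightarrow> 'v set set \<Rightarrow> 'v set \<Rightarrow> 'v set set \<Rightarrow> 'v cfg \<Rightarrow> 'v cfg \<Rightarrow> 'v cfg" where
  "merge_cfg A F B H c d = (merge A B (fst c, fst d), merge F H (snd c, snd d))"


section \<open>Conditional measures and weak monotonicity\<close>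

text \<open>\<open>K\<close> is a regular conditional distribution of \<open>M\<close> given the random variable \<open>X\<close> with values in
  \<open>N\<close>.\<close>

definition regular_cond_distr ::
  "'w measure \<Rightarrow> 'u measure \<Rightarrow> ('w \<Rightarrow> 'u) \<Rightarrow> ('u \<Rightarrow> 'w measure) \<Rightarrow> bool" where
  "regular_cond_distr M N X K \<longleftrightarrow>
     X \<in> M \<rightarrow>\<^sub>M N \<and> K \<in> N \<rightarrow>\<^sub>M prob_algebra M \<and>
     (\<forall>A\<in>sets M. \<forall>B\<in>sets N.
        emeasure M (A \<inter> X -` B) = (\<integral>\<^sup>+ w. emeasure (K (X w)) A * indicator B (X w) \<partial>M))"

text \<open>\<open>\<kappa> A F v\<close> is the conditional measure given that the configuration equals \<open>v\<close> on the vertices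
  \<open>A\<close> and the edges \<open>F\<close>; it is prescribed for every value \<open>v\<close>. The second condition says, again for
  every \<open>v\<close>, that conditioning \<open>\<kappa> A F v\<close> on further coordinates \<open>B, H\<close> gives back members of the
  family. It is not required that \<open>\<kappa> A F v\<close> be carried by the configurations extending \<open>v\<close>; for
  almost every \<open>v\<close> this is a consequence of the first condition.\<close>

definition consistent_cond_family ::
  "'v set \<Rightarrow> 'v set set \<Rightarrow> 'v cfg measure \<Rightarrow>
     ('v set \<Rightarrow> 'v set set \<Rightarrow> 'v cfg \<Rightarrow> 'v cfg measure) \<Rightarrow> bool" where
  "consistent_cond_family \<Lambda> F\<^sub>\<Lambda> \<mu> \<kappa> \<longleftrightarrow>
     (\<forall>A F. A \<subseteq> \<Lambda> \<and> F \<subseteq> F\<^sub>\<Lambda> \<longrightarrow>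
        regular_cond_distr \<mu> (cfg_space A F) (restrict_cfg A F) (\<kappa> A F)) \<and>
     (\<forall>A F B H v. A \<subseteq> \<Lambda> \<and> F \<subseteq> F\<^sub>\<Lambda> \<and> B \<subseteq> \<Lambda> - A \<and> H \<subseteq> F\<^sub>\<Lambda> - F \<and> v \<in> space (cfg_space A F) \<longrightarrow>
        regular_cond_distr (\<kappa> A F v) (cfg_space B H) (restrict_cfg B H)
          (\<lambda>w. \<kappa> (A \<union> B) (F \<union> H) (merge_cfg A F B H v w)))"

definition stoch_le :: "'w::ord measure \<Rightarrow> 'w measure \<Rightarrow> 'w measure \<Rightarrow> bool" where
  "stoch_le S M N \<longleftrightarrow>
     (\<forall>h\<in>borel_measurable S. bounded (h ` space S) \<and> mono_on (space S) h \<longrightarrow>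
        (\<integral>c. h c \<partial>M) \<le> ((\<integral>c. h c \<partial>N) :: real))"

definition weakly_monotonic ::
  "'v set \<Rightarrow> 'v set set \<Rightarrow> 'v set \<Rightarrow>
     ('v set \<Rightarrow> 'v set set \<Rightarrow> 'v cfg \<Rightarrow> 'v cfg measure) \<Rightarrow> bool" where
  "weakly_monotonic V E \<Lambda> \<kappa> \<longleftrightarrow>
     (\<forall>A F. A \<subseteq> \<Lambda> \<and> F \<subseteq> {e \<in> incident_edges E A. e \<subseteq> A \<union> ext_boundary V E \<Lambda>} \<longrightarrow>
        (\<forall>v\<in>space (cfg_space A F). \<forall>w\<in>space (cfg_space A F). v \<le> w \<longrightarrow>
           stoch_le (cfg_space \<Lambda> (incident_edges E \<Lambda>)) (\<kappa> A F v) (\<kappa> A F w)))"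

definition closed_at :: "'v set set \<Rightarrow> 'v set \<Rightarrow> 'v \<Rightarrow> 'v cfg set" where
  "closed_at E \<Lambda> z =
     {c \<in> space (cfg_space \<Lambda> (incident_edges E \<Lambda>)). \<forall>x. {z, x} \<in> E \<longrightarrow> \<not> snd c {z, x}}"

definition increasing_edge_fun :: "'v set set \<Rightarrow> (('v set \<Rightarrow> bool) \<Rightarrow> real) \<Rightarrow> bool" where
  "increasing_edge_fun F f \<longleftrightarrow> mono_on (edge_cfgs F) f \<and> f \<in> edge_cfgs F \<rightarrow> {0..1}"


section \<open>Decision trees\<close>

text \<open>Elements of \<open>\<Lambda> \<union> incident_edges E \<Lambda>\<close> are tagged: \<open>Inl x\<close> is a vertex, \<open>Inr e\<close> an edge.\<close>

type_synonym 'v elem = "'v + 'v set"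

definition elems :: "'v set set \<Rightarrow> 'v set \<Rightarrow> 'v elem set" where
  "elems E \<Lambda> = \<Lambda> <+> incident_edges E \<Lambda>"

definition verts_of :: "'v elem list \<Rightarrow> 'v set" where
  "verts_of xs = {x. Inl x \<in> set xs}"

definition edges_of :: "'v elem list \<Rightarrow> 'v set set" where
  "edges_of xs = {e. Inr e \<in> set xs}"

type_synonym 'v dtree = "'v elem \<times> (nat \<Rightarrow> 'v elem list \<Rightarrow> 'v cfg \<Rightarrow> 'v elem)"

text \<open>\<open>\<psi> t\<close> takes the tuple of the \<open>t - 1\<close> elements already revealed and the configuration restricted
  to them. Membership in the measurable function space says both that the returned element is new
  and that it depends measurably on the revealed states, so that the revealment events are indeed
  events.\<close>

definition decision_tree :: "'v set set \<Rightarrow> 'v set \<Rightarrow> 'v dtree \<Rightarrow> bool" where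
  "decision_tree E \<Lambda> T \<longleftrightarrow> (case T of (x\<^sub>1, \<psi>) \<Rightarrow>
     x\<^sub>1 \<in> elems E \<Lambda> \<and>
     (\<forall>t\<in>{2..card (elems E \<Lambda>)}. \<forall>xs. length xs = t - 1 \<and> distinct xs \<and> set xs \<subseteq> elems E \<Lambda> \<longrightarrow>
        \<psi> t xs \<in> cfg_space (verts_of xs) (edges_of xs) \<rightarrow>\<^sub>M count_space (elems E \<Lambda> - set xs)))"

text \<open>\<open>revealed T c t\<close> is the list \<open>[x\<^sub>1, \<dots>, x\<^sub>t]\<close>.\<close>

fun revealed :: "'v dtree \<Rightarrow> 'v cfg \<Rightarrow> nat \<Rightarrow> 'v elem list" where
  "revealed T c 0 = []"
| "revealed T c (Suc 0) = [fst T]"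
| "revealed T c (Suc (Suc t)) =
     (let xs = revealed T c (Suc t)
      in xs @ [snd T (Suc (Suc t)) xs (restrict_cfg (verts_of xs) (edges_of xs) c)])"

definition admissible :: "'v set set \<Rightarrow> 'v set \<Rightarrow> 'v dtree \<Rightarrow> bool" where
  "admissible E \<Lambda> T \<longleftrightarrow>
     (\<forall>c\<in>space (cfg_space \<Lambda> (incident_edges E \<Lambda>)). \<forall>t\<in>{1..card (elems E \<Lambda>)}. \<forall>e.
        last (revealed T c t) = Inr e \<longrightarrow> e \<inter> \<Lambda> \<subseteq> verts_of (revealed T c (t - 1)))"

definition stopping_time ::
  "'v set set \<Rightarrow> 'v set \<Rightarrow> (('v set \<Rightarrow> bool) \<Rightarrow> real) \<Rightarrow> 'v dtree \<Rightarrow> 'v cfg \<Rightarrow> nat" where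
  "stopping_time E \<Lambda> f T c =
     (LEAST t. 1 \<le> t \<and> (\<forall>\<omega>'\<in>edge_cfgs (incident_edges E \<Lambda>).
        restrict \<omega>' (edges_of (revealed T c t)) = restrict (snd c) (edges_of (revealed T c t)) \<longrightarrow>
        f \<omega>' = f (snd c)))"

definition reveal_event ::
  "'v set set \<Rightarrow> 'v set \<Rightarrow> (('v set \<Rightarrow> bool) \<Rightarrow> real) \<Rightarrow> 'v dtree \<Rightarrow> 'v elem \<Rightarrow> 'v cfg set" where
  "reveal_event E \<Lambda> f T X =
     {c \<in> space (cfg_space \<Lambda> (incident_edges E \<Lambda>)).
        \<exists>t\<in>{1..stopping_time E \<Lambda> f T c}. last (revealed T c t) = X}"

text \<open>The sum runs over those endpoints of the edge that lie in \<open>\<Lambda>\<close>.\<close>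

definition \<delta> ::
  "'v set set \<Rightarrow> 'v set \<Rightarrow> 'v cfg measure \<Rightarrow> (('v set \<Rightarrow> bool) \<Rightarrow> real) \<Rightarrow> 'v dtree \<Rightarrow>
     'v set \<Rightarrow> real" where
  "\<delta> E \<Lambda> \<mu> f T e =
     measure \<mu> (reveal_event E \<Lambda> f T (Inr e)) +
     (\<Sum>x\<in>e \<inter> \<Lambda>. measure \<mu> (reveal_event E \<Lambda> f T (Inl x)) / measure \<mu> (closed_at E \<Lambda> x))"

definition covariance :: "'w measure \<Rightarrow> ('w \<Rightarrow> real) \<Rightarrow> ('w \<Rightarrow> real) \<Rightarrow> real" where
  "covariance M X Y =
     (\<integral>w. (X w - (\<integral>w'. X w' \<partial>M)) * (Y w - (\<integral>w'. Y w' \<partial>M)) \<partial>M)"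

end

theory Submission
  imports Defs
begin

text \<open>The tree is run on a configuration X, and a second configuration Y is revealed in the same
  order. Let Y be independent of X on the first t revealed elements, let X and Y be drawn from
  common uniform variables through conditional quantile functions from then on until the states seen
  in X determine f, and let Y be independent of X again afterwards. For t = 0 the two copies agree
  until f(X) is known, so the mean of f(X) f(Y) is that of f(X) squared; for t the total number of
  elements X and Y are independent and the mean is the square of the mean of f. The variance of f is
  therefore the sum over t of the change in the mean of f(X) f(Y) that is caused by drawing one more
  element of Y afresh. Before that element, Y does not depend on X. The change at an element x is
  therefore at most a number that depends only on x, and it is counted only if x is revealed before
  f is determined; this is how the revelation probabilities enter
  (\<open>joint_mean_average\<close>, \<open>variance_le_sum\<close>).

  Weak monotonicity makes the quantile coupling monotone. As f(X) lies between 0 and 1, redrawing one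
  element changes the mean of f(X) f(Y) by at most the positive part of the change in the conditional
  expectation of f(Y) (\<open>joint_mean_increment\<close>). Averaged over two independent draws of the element
  this is \<open>step_gap\<close>, and it remains to bound its mean.

  For an edge e the two draws are 0 or 1, and the mean gap is the mean of f times the state of e,
  minus the mean of the product of their conditional expectations given the past of e. The second
  mean is at least the product of the two means, because the law is positively associated and stays
  so under conditional expectations along an admissible order (\<open>association_cexp\<close>). So the gap is at
  most the covariance of f and the state of e (\<open>step_gap_edge\<close>).

  For a vertex z the smaller of the two conditional expectations is at least the one with spin 0 at
  z. As conditioning on spin 0 lowers the law, the mean gap is at most the mean of f minus its mean
  given spin 0 at z (\<open>step_gap_vertex\<close>). By hypothesis the latter is at least the mean of f given
  that z is closed, and the difference to that is the covariance of f with the event that z is not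
  closed, divided by the probability that z is closed. The number of open edges at z minus the
  indicator of that event is increasing, so positive association bounds this covariance by the sum of
  the covariances of f with the edges at z (\<open>closed_vertex_covariance\<close>).

  The coupling is not built as a measure on sequences of uniform variables. Its conditional
  expectations are computed by a backward recursion that uses one uniform variable at a time
  (\<open>coupled\<close>), and the tree enters through the configuration of X alone.\<close>

section \<open>Integration against probability kernels\<close>

lemma (in prob_space) integrable_bounded:
  fixes h :: "'a \<Rightarrow> real"
  assumes "h \<in> borel_measurable M" "\<And>w. w \<in> space M \<Longrightarrow> \<bar>h w\<bar> \<le> C"
  shows "integrable M h"
  using assms by (intro integrable_const_bound[of _ C] AE_I2) auto

lemma (in prob_space) abs_integral_le:
  fixes h :: "'a \<Rightarrow> real"
  assumes "\<And>w. w \<in> space M \<Longrightarrow> \<bar>h w\<bar> \<le> C"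
  shows "\<bar>\<integral>w. h w \<partial>M\<bar> \<le> C"
proof -
  obtain w where "w \<in> space M"
    using not_empty by auto
  with assms[of w] have "0 \<le> C"
    by linarith
  show ?thesis
  proof (cases "integrable M h")
    case True
    have "\<bar>\<integral>w. h w \<partial>M\<bar> \<le> (\<integral>w. \<bar>h w\<bar> \<partial>M)"
      by (rule integral_abs_bound)
    also have "\<dots> \<le> (\<integral>w. C \<partial>M)"
      using True assms by (intro integral_mono) auto
    finally show ?thesis
      by (simp add: prob_space)
  qed (use \<open>0 \<le> C\<close> in \<open>simp add: not_integrable_integral_eq\<close>)
qed

text \<open>Integrate the comonotonicity inequality over both variables; the mixed terms produce the product
  of the means.\<close>

lemma (in prob_space) chebyshev_association:
  fixes g h :: "'a \<Rightarrow> real"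
  assumes [measurable]: "g \<in> borel_measurable M" "h \<in> borel_measurable M"
    and g: "\<And>w. w \<in> space M \<Longrightarrow> \<bar>g w\<bar> \<le> C" and h: "\<And>w. w \<in> space M \<Longrightarrow> \<bar>h w\<bar> \<le> D"
    and comon: "\<And>w w'. w \<in> space M \<Longrightarrow> w' \<in> space M \<Longrightarrow> 0 \<le> (g w - g w') * (h w - h w')"
  shows "(\<integral>w. g w \<partial>M) * (\<integral>w. h w \<partial>M) \<le> (\<integral>w. g w * h w \<partial>M)"
proof -
  have gh: "\<bar>g w * h w\<bar> \<le> C * D" if "w \<in> space M" for w
    using g[OF that] h[OF that] by (simp add: abs_mult mult_mono')
  note [simp] = integrable_bounded[OF _ g] integrable_bounded[OF _ h] integrable_bounded[OF _ gh]
  have "0 \<le> (\<integral>w. g w * h w \<partial>M) - g w' * (\<integral>w. h w \<partial>M) - h w' * (\<integral>w. g w \<partial>M) + g w' * h w'"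
    if w': "w' \<in> space M" for w'
  proof -
    have "0 \<le> (\<integral>w. (g w - g w') * (h w - h w') \<partial>M)"
      using comon[OF _ w'] by (intro integral_nonneg_AE AE_I2) auto
    also have "\<dots> = (\<integral>w. g w * h w - g w' * h w - h w' * g w + g w' * h w' \<partial>M)"
      by (simp add: algebra_simps)
    finally show ?thesis
      by (simp add: prob_space)
  qed
  then have "0 \<le> (\<integral>w'. (\<integral>w. g w * h w \<partial>M) - g w' * (\<integral>w. h w \<partial>M) - h w' * (\<integral>w. g w \<partial>M) + g w' * h w' \<partial>M)"
    by (intro integral_nonneg_AE AE_I2) auto
  then show ?thesis
    by (simp add: prob_space)
qed

lemma (in prob_space) covariance_eq:
  assumes "g \<in> borel_measurable M" "h \<in> borel_measurable M"
    and "\<And>w. w \<in> space M \<Longrightarrow> \<bar>g w\<bar> \<le> C" "\<And>w. w \<in> space M \<Longrightarrow> \<bar>h w\<bar> \<le> D"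
  shows "covariance M g h = (\<integral>w. g w * h w \<partial>M) - (\<integral>w. g w \<partial>M) * (\<integral>w. h w \<partial>M)"
proof -
  have gh: "\<bar>g w * h w\<bar> \<le> C * D" if "w \<in> space M" for w
    using assms(3,4)[OF that] by (simp add: abs_mult mult_mono')
  have "(\<lambda>w. g w * h w) \<in> borel_measurable M"
    using assms(1,2) by measurable
  note int = integrable_bounded[OF this gh] integrable_bounded[OF assms(1,3)] integrable_bounded[OF assms(2,4)]
  have "covariance M g h = (\<integral>w. g w * h w - (\<integral>w. h w \<partial>M) * g w - (\<integral>w. g w \<partial>M) * h w + (\<integral>w. g w \<partial>M) * (\<integral>w. h w \<partial>M) \<partial>M)"
    unfolding covariance_def by (intro Bochner_Integration.integral_cong) (auto simp: algebra_simps)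
  also have "\<dots> = (\<integral>w. g w * h w \<partial>M) - (\<integral>w. g w \<partial>M) * (\<integral>w. h w \<partial>M)"
    using int by (simp add: prob_space)
  finally show ?thesis .
qed

lemma measurable_integral_kernel:
  fixes f :: "'a \<Rightarrow> 'b \<Rightarrow> real"
  assumes f[measurable]: "case_prod f \<in> borel_measurable (M \<Otimes>\<^sub>M N)"
    and K: "K \<in> M \<rightarrow>\<^sub>M prob_algebra N"
  shows "(\<lambda>x. \<integral>y. f x y \<partial>K x) \<in> borel_measurable M"
proof -
  note K'[measurable] = measurable_prob_algebraD[OF K]
  note measurable_distr2[measurable]
  have "(\<lambda>x. integral\<^sup>L (distr (K x) (M \<Otimes>\<^sub>M N) (\<lambda>y. (x, y))) (case_prod f)) \<in> borel_measurable M"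
    by measurable
  then show "(\<lambda>x. \<integral>y. f x y \<partial>K x) \<in> borel_measurable M"
    by (rule measurable_cong[THEN iffD1, rotated])
       (simp add: integral_distr measurable_cong_sets[OF subprob_measurableD(2)[OF K'] refl])
qed

text \<open>The definition of a regular conditional distribution speaks about rectangles only. Rectangles
  generate the product, so the joint law of the conditioning variable and the outcome is the kernel
  integrated against the law; hence the integrand may depend on both. Bounded signed integrands are
  reduced to nonnegative ones by adding a constant.\<close>

lemma regular_cond_distr_integral:
  fixes h :: "'u \<Rightarrow> 'w \<Rightarrow> real"
  assumes M: "prob_space M" and rcd: "regular_cond_distr M N X K"
    and h[measurable]: "case_prod h \<in> borel_measurable (N \<Otimes>\<^sub>M M)"
    and bd: "\<And>x w. x \<in> space N \<Longrightarrow> w \<in> space M \<Longrightarrow> \<bar>h x w\<bar> \<le> C"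
  shows "(\<integral>w. h (X w) w \<partial>M) = (\<integral>w. (\<integral>w'. h (X w) w' \<partial>K (X w)) \<partial>M)"
proof -
  interpret prob_space M by fact
  have X[measurable]: "X \<in> M \<rightarrow>\<^sub>M N" and K: "K \<in> N \<rightarrow>\<^sub>M prob_algebra M"
    and rect: "\<And>A B. A \<in> sets M \<Longrightarrow> B \<in> sets N \<Longrightarrow>
        emeasure M (A \<inter> X -` B) = (\<integral>\<^sup>+ w. emeasure (K (X w)) A * indicator B (X w) \<partial>M)"
    using rcd by (auto simp: regular_cond_distr_def)
  note K'[measurable] = measurable_prob_algebraD[OF K]
  have KX[measurable]: "(\<lambda>w. K (X w)) \<in> M \<rightarrow>\<^sub>M subprob_algebra M"
    by measurable
  have KX_sets: "sets (K (X w)) = sets M" "space (K (X w)) = space M" if "w \<in> space M" for w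
    using subprob_measurableD[OF KX that] by auto
  let ?J = "\<lambda>w. distr (K (X w)) (N \<Otimes>\<^sub>M M) (\<lambda>w'. (X w, w'))"
  have J[measurable]: "?J \<in> M \<rightarrow>\<^sub>M subprob_algebra (N \<Otimes>\<^sub>M M)"
    by (intro measurable_distr2[where M=M]) auto
  define P where "P = distr M (N \<Otimes>\<^sub>M M) (\<lambda>w. (X w, w))"
  define P' where "P' = M \<bind> ?J"
  have sets_P': "sets P' = sets (N \<Otimes>\<^sub>M M)"
    unfolding P'_def by (intro sets_bind[OF sets_kernel[OF J]] not_empty)
  let ?G = "{a \<times> b | a b. a \<in> sets N \<and> b \<in> sets M}"
  (* Both measures agree on rectangles. *)
  have "P = P'"
  proof (rule measure_eqI_generator_eq[where E="?G" and \<Omega>="space N \<times> space M" and A="\<lambda>_. space N \<times> space M"])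
    show "Int_stable ?G" by (rule Int_stable_pair_measure_generator)
    show "?G \<subseteq> Pow (space N \<times> space M)" by (rule pair_measure_closed)
    show "sets P = sigma_sets (space N \<times> space M) ?G" "sets P' = sigma_sets (space N \<times> space M) ?G"
      unfolding P_def sets_P' by (simp_all add: sets_pair_measure)
    show "range (\<lambda>_. space N \<times> space M) \<subseteq> ?G" by auto
    show "(\<Union>i::nat. space N \<times> space M) = space N \<times> space M" by simp
    show "emeasure P (space N \<times> space M) \<noteq> \<infinity>" for i :: nat
    proof -
      have "emeasure P (space N \<times> space M) \<le> emeasure M (space M)"
        unfolding P_def by (subst emeasure_distr) (auto intro!: emeasure_mono)
      then show ?thesis by (metis emeasure_space_1 infinity_ennreal_def neq_top_trans ennreal_one_neq_top)
    qed
    fix Z assume "Z \<in> ?G"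
    then obtain B A where Z: "Z = B \<times> A" and [measurable]: "B \<in> sets N" "A \<in> sets M"
      by auto
    have "emeasure P Z = emeasure M (A \<inter> X -` B)"
      unfolding P_def Z
      using sets.sets_into_space[OF \<open>A \<in> sets M\<close>]
      by (subst emeasure_distr) (auto intro!: arg_cong[where f="emeasure M"])
    also have "\<dots> = (\<integral>\<^sup>+ w. emeasure (K (X w)) A * indicator B (X w) \<partial>M)"
      by (rule rect) auto
    also have "\<dots> = (\<integral>\<^sup>+ w. emeasure (?J w) Z \<partial>M)"
    proof (rule nn_integral_cong)
      fix w assume w: "w \<in> space M"
      have "emeasure (?J w) Z = emeasure (K (X w)) ((\<lambda>w'. (X w, w')) -` Z \<inter> space M)"
        using w measurable_space[OF X w] unfolding Z
        by (subst emeasure_distr) (auto simp: measurable_cong_sets[OF KX_sets(1)[OF w] refl] KX_sets)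
      also have "(\<lambda>w'. (X w, w')) -` Z \<inter> space M = (if X w \<in> B then A else {})"
        using sets.sets_into_space[OF \<open>A \<in> sets M\<close>] by (auto simp: Z)
      finally show "emeasure (K (X w)) A * indicator B (X w) = emeasure (?J w) Z"
        by (auto split: split_indicator)
    qed
    also have "\<dots> = emeasure P' Z"
      unfolding P'_def by (subst emeasure_bind[OF not_empty J]) (auto simp: Z)
    finally show "emeasure P Z = emeasure P' Z" .
  qed
  have nn: "(\<integral>w. g (X w) w \<partial>M) = (\<integral>w. (\<integral>w'. g (X w) w' \<partial>K (X w)) \<partial>M)"
    if g[measurable]: "case_prod g \<in> borel_measurable (N \<Otimes>\<^sub>M M)"
      and pos: "\<And>x w. x \<in> space N \<Longrightarrow> w \<in> space M \<Longrightarrow> 0 \<le> g x w"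
      and bdd: "\<And>x w. x \<in> space N \<Longrightarrow> w \<in> space M \<Longrightarrow> g x w \<le> D" for g :: "'u \<Rightarrow> 'w \<Rightarrow> real" and D
  proof -
    have Xs: "X w \<in> space N" if "w \<in> space M" for w
      using measurable_space[OF X that] .
    have inner: "(\<integral>\<^sup>+w'. ennreal (g (X w) w') \<partial>K (X w)) = ennreal (\<integral>w'. g (X w) w' \<partial>K (X w))"
      if w: "w \<in> space M" for w
    proof -
      interpret KP: prob_space "K (X w)"
        using measurable_space[OF K Xs[OF w]] by (simp add: space_prob_algebra)
      have [measurable]: "g (X w) \<in> borel_measurable (K (X w))"
        using Xs[OF w] by (simp add: measurable_cong_sets[OF KX_sets(1)[OF w] refl])
      show ?thesis
        using pos[OF Xs[OF w]] bdd[OF Xs[OF w]]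
        by (intro nn_integral_eq_integral KP.integrable_bounded[of _ D])
           (auto simp: KX_sets[OF w] intro!: AE_I2)
    qed
    have [measurable]: "(\<lambda>w. \<integral>w'. g (X w) w' \<partial>K (X w)) \<in> borel_measurable M"
      by (rule measurable_compose[OF X measurable_integral_kernel[OF g K]])
    have nonneg: "0 \<le> (\<integral>w'. g (X w) w' \<partial>K (X w))" if w: "w \<in> space M" for w
      using pos[OF Xs[OF w]] by (intro integral_nonneg_AE AE_I2) (auto simp: KX_sets[OF w])
    have upper: "(\<integral>w'. g (X w) w' \<partial>K (X w)) \<le> D" if w: "w \<in> space M" for w
    proof -
      interpret KP: prob_space "K (X w)"
        using measurable_space[OF K Xs[OF w]] by (simp add: space_prob_algebra)
      show ?thesis
        using KP.abs_integral_le[of "g (X w)" D] pos[OF Xs[OF w]] bdd[OF Xs[OF w]]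
        by (auto simp: KX_sets[OF w])
    qed
    have "ennreal (\<integral>w. g (X w) w \<partial>M) = (\<integral>\<^sup>+w. ennreal (g (X w) w) \<partial>M)"
      using pos bdd Xs
      by (intro nn_integral_eq_integral[symmetric] integrable_bounded[of _ D]) (auto intro!: AE_I2)
    also have "\<dots> = (\<integral>\<^sup>+z. ennreal (case_prod g z) \<partial>P)"
      unfolding P_def by (subst nn_integral_distr) auto
    also have "\<dots> = (\<integral>\<^sup>+w. (\<integral>\<^sup>+z. ennreal (case_prod g z) \<partial>?J w) \<partial>M)"
      unfolding \<open>P = P'\<close> P'_def by (rule nn_integral_bind[OF _ J]) auto
    also have "\<dots> = (\<integral>\<^sup>+w. (\<integral>\<^sup>+w'. ennreal (g (X w) w') \<partial>K (X w)) \<partial>M)"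
      using Xs
      by (intro nn_integral_cong, subst nn_integral_distr)
         (auto simp: measurable_cong_sets[OF KX_sets(1) refl])
    also have "\<dots> = (\<integral>\<^sup>+w. ennreal (\<integral>w'. g (X w) w' \<partial>K (X w)) \<partial>M)"
      by (intro nn_integral_cong inner)
    also have "\<dots> = ennreal (\<integral>w. (\<integral>w'. g (X w) w' \<partial>K (X w)) \<partial>M)"
    proof (intro nn_integral_eq_integral integrable_bounded[of _ D])
      show "\<bar>\<integral>w'. g (X w) w' \<partial>K (X w)\<bar> \<le> D" if "w \<in> space M" for w
        using nonneg[OF that] upper[OF that] by simp
    qed (auto intro!: AE_I2 nonneg)
    finally show ?thesis
      using pos nonneg Xs by (subst (asm) ennreal_inj) (auto intro!: integral_nonneg_AE AE_I2)
  qed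
  have bd': "- C \<le> h x w" "h x w \<le> C" if "x \<in> space N" "w \<in> space M" for x w
    using bd[OF that] by auto
  have Xs: "X w \<in> space N" if "w \<in> space M" for w
    using measurable_space[OF X that] .
  have "(\<integral>w. h (X w) w + C \<partial>M) = (\<integral>w. (\<integral>w'. h (X w) w' + C \<partial>K (X w)) \<partial>M)"
  proof (rule nn)
    show "0 \<le> h x w + C" if "x \<in> space N" "w \<in> space M" for x w
      using bd'[OF that] by simp
    show "h x w + C \<le> 2 * C" if "x \<in> space N" "w \<in> space M" for x w
      using bd'[OF that] by simp
  qed (simp add: split_beta')
  also have "\<dots> = (\<integral>w. (\<integral>w'. h (X w) w' \<partial>K (X w)) + C \<partial>M)"
  proof (intro Bochner_Integration.integral_cong refl)
    fix w assume w: "w \<in> space M"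
    interpret KP: prob_space "K (X w)"
      using measurable_space[OF K Xs[OF w]] by (simp add: space_prob_algebra)
    have [measurable]: "h (X w) \<in> borel_measurable (K (X w))"
      using Xs[OF w] by (simp add: measurable_cong_sets[OF KX_sets(1)[OF w] refl])
    have "integrable (K (X w)) (h (X w))"
      using bd[OF Xs[OF w]] by (intro KP.integrable_bounded[of _ C]) (auto simp: KX_sets[OF w])
    then show "(\<integral>w'. h (X w) w' + C \<partial>K (X w)) = (\<integral>w'. h (X w) w' \<partial>K (X w)) + C"
      by (simp add: KP.prob_space)
  qed
  also have "\<dots> = (\<integral>w. (\<integral>w'. h (X w) w' \<partial>K (X w)) \<partial>M) + C"
  proof -
    have "integrable M (\<lambda>w. \<integral>w'. h (X w) w' \<partial>K (X w))"
    proof (rule integrable_bounded[of _ C])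
      show "(\<lambda>w. \<integral>w'. h (X w) w' \<partial>K (X w)) \<in> borel_measurable M"
        by (rule measurable_compose[OF X measurable_integral_kernel[OF h K]])
      fix w assume w: "w \<in> space M"
      interpret KP: prob_space "K (X w)"
        using measurable_space[OF K Xs[OF w]] by (simp add: space_prob_algebra)
      show "\<bar>\<integral>w'. h (X w) w' \<partial>K (X w)\<bar> \<le> C"
        using bd[OF Xs[OF w]] by (intro KP.abs_integral_le) (auto simp: KX_sets[OF w])
    qed
    then show ?thesis by (simp add: prob_space)
  qed
  also have "(\<integral>w. h (X w) w + C \<partial>M) = (\<integral>w. h (X w) w \<partial>M) + C"
  proof -
    have "integrable M (\<lambda>w. h (X w) w)"
      using bd Xs by (intro integrable_bounded[of _ C]) auto
    then show ?thesis by (simp add: prob_space)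
  qed
  finally show ?thesis by simp
qed

section \<open>Quantiles\<close>

text \<open>A uniform variable put into the quantile function has the law of \<open>X\<close>. The same uniform variable
  serves all laws simultaneously, and this coupling preserves stochastic domination.\<close>

definition quantile :: "'w measure \<Rightarrow> ('w \<Rightarrow> real) \<Rightarrow> real \<Rightarrow> real" where
  "quantile M X u = Inf {r. u \<le> measure M {w \<in> space M. X w \<le> r}}"

abbreviation unit_law :: "real measure" where
  "unit_law \<equiv> restrict_space lborel {0<..<1}"

lemma prob_space_unit_law: "prob_space unit_law"
  by (auto simp: emeasure_restrict_space space_restrict_space intro!: prob_spaceI)

context prob_space
begin

context
  fixes X :: "'a \<Rightarrow> real"
  assumes X[measurable]: "X \<in> borel_measurable M"
begin

lemma cdf_distribution_distr: "cdf_distribution (distr M borel X)"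
  unfolding cdf_distribution_def by (rule real_distribution_distr) (rule X)

lemma cdf_distr_eq: "cdf (distr M borel X) r = measure M {w \<in> space M. X w \<le> r}"
  unfolding cdf_def by (subst measure_distr) (auto intro!: arg_cong[where f="measure M"])

lemma quantile_le_iff:
  "0 < u \<Longrightarrow> u < 1 \<Longrightarrow> quantile M X u \<le> r \<longleftrightarrow> u \<le> measure M {w \<in> space M. X w \<le> r}"
proof -
  interpret D: cdf_distribution "distr M borel X" by (rule cdf_distribution_distr)
  show "0 < u \<Longrightarrow> u < 1 \<Longrightarrow> ?thesis"
    using D.pseudoinverse[of u r] by (simp add: quantile_def cdf_distr_eq)
qed

lemma integral_quantile:
  fixes h :: "real \<Rightarrow> real"
  assumes [measurable]: "h \<in> borel_measurable borel"
  shows "(\<integral>u. h (quantile M X u) \<partial>unit_law) = (\<integral>w. h (X w) \<partial>M)"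
proof -
  interpret D: cdf_distribution "distr M borel X" by (rule cdf_distribution_distr)
  have I: "D.I = quantile M X"
    by (auto simp: fun_eq_iff quantile_def cdf_distr_eq)
  have m: "quantile M X \<in> borel_measurable unit_law"
    unfolding I[symmetric]
    using D.measurable_CI measurable_cong_sets[OF sets_restrict_space_cong[OF sets_lborel] refl] by blast
  have "(\<integral>w. h (X w) \<partial>M) = (\<integral>r. h r \<partial>distr M borel X)"
    by (simp add: integral_distr)
  also have "distr M borel X = distr unit_law borel (quantile M X)"
    using D.distr_I_eq_M unfolding I by simp
  also have "(\<integral>r. h r \<partial>distr unit_law borel (quantile M X)) = (\<integral>u. h (quantile M X u) \<partial>unit_law)"
    using m by (simp add: integral_distr)
  finally show ?thesis ..
qed

end
end

lemma quantile_mono: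
  assumes "prob_space M" "prob_space N" "X \<in> borel_measurable M" "X \<in> borel_measurable N"
    and "\<And>r. measure N {w \<in> space N. X w \<le> r} \<le> measure M {w \<in> space M. X w \<le> r}"
    and u: "0 < u" "u < 1"
  shows "quantile M X u \<le> quantile N X u"
  using assms(5)[of "quantile N X u"] prob_space.quantile_le_iff[OF assms(2,4) u, of "quantile N X u"]
  by (subst prob_space.quantile_le_iff[OF assms(1,3) u]) simp

text \<open>The event that the quantile is at most \<open>r\<close> compares \<open>u\<close> with the distribution function at \<open>r\<close>,
  which is measurable in the parameter; this gives joint measurability in parameter and uniform
  variable.\<close>

lemma measurable_quantile:
  assumes K: "K \<in> L \<rightarrow>\<^sub>M prob_algebra S" and X[measurable]: "X \<in> borel_measurable S"
  shows "(\<lambda>(c, u). quantile (K c) X u) \<in> borel_measurable (L \<Otimes>\<^sub>M unit_law)"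
proof (rule borel_measurable_iff_le[THEN iffD2], rule allI)
  fix r
  have K_in: "prob_space (K c)" "sets (K c) = sets S" "space (K c) = space S" if "c \<in> space L" for c
    using measurable_space[OF K that] by (auto simp: space_prob_algebra dest: sets_eq_imp_space_eq)
  have [measurable]: "(\<lambda>c. measure (K c) {w \<in> space S. X w \<le> r}) \<in> borel_measurable L"
    by (rule measurable_compose[OF K]) measurable
  have [measurable]: "(\<lambda>u. u) \<in> borel_measurable unit_law"
    by (rule measurable_restrict_space1) simp
  have "{z \<in> space (L \<Otimes>\<^sub>M unit_law). (case z of (c, u) \<Rightarrow> quantile (K c) X u) \<le> r} =
        {z \<in> space (L \<Otimes>\<^sub>M unit_law). snd z \<le> measure (K (fst z)) {w \<in> space S. X w \<le> r}}"
  proof (intro Collect_cong conj_cong refl, clarify)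
    fix c u assume "(c, u) \<in> space (L \<Otimes>\<^sub>M unit_law)"
    then have c: "c \<in> space L" and u: "0 < u" "u < 1"
      by (auto simp: space_pair_measure space_restrict_space)
    have "X \<in> borel_measurable (K c)"
      using X by (simp add: measurable_cong_sets[OF K_in(2)[OF c] refl])
    then show "quantile (K c) X u \<le> r \<longleftrightarrow>
        snd (c, u) \<le> measure (K (fst (c, u))) {w \<in> space S. X w \<le> r}"
      using prob_space.quantile_le_iff[OF K_in(1)[OF c] _ u] K_in(3)[OF c] by simp
  qed
  also have "\<dots> \<in> sets (L \<Otimes>\<^sub>M unit_law)"
    by measurable
  finally show "{z \<in> space (L \<Otimes>\<^sub>M unit_law). (case z of (c, u) \<Rightarrow> quantile (K c) X u) \<le> r} \<in> sets (L \<Otimes>\<^sub>M unit_law)" .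
qed

section \<open>Configurations and single coordinates\<close>

text \<open>Reading edge states as the reals 0 and 1 lets one quantile construction serve vertices and edges.
  Writing a real back clips it at 0 or tests it for positivity, so that \<open>set_coord\<close> is monotone and
  maps configurations to configurations for every real argument.\<close>

fun coord :: "'v elem \<Rightarrow> 'v cfg \<Rightarrow> real" where
  "coord (Inl z) c = fst c z"
| "coord (Inr e) c = of_bool (snd c e)"

fun set_coord :: "'v elem \<Rightarrow> real \<Rightarrow> 'v cfg \<Rightarrow> 'v cfg" where
  "set_coord (Inl z) r c = ((fst c)(z := max 0 r), snd c)"
| "set_coord (Inr e) r c = (fst c, (snd c)(e := 0 < r))"

definition proj :: "'v elem list \<Rightarrow> 'v cfg \<Rightarrow> 'v cfg" where
  "proj xs = restrict_cfg (verts_of xs) (edges_of xs)"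

lemma verts_of_simps [simp]:
  "verts_of [] = {}" "verts_of (xs @ [Inl z]) = insert z (verts_of xs)"
  "verts_of (xs @ [Inr e]) = verts_of xs"
  by (auto simp: verts_of_def)

lemma edges_of_simps [simp]:
  "edges_of [] = {}" "edges_of (xs @ [Inr e]) = insert e (edges_of xs)"
  "edges_of (xs @ [Inl z]) = edges_of xs"
  by (auto simp: edges_of_def)

lemma space_cfg_space:
  "c \<in> space (cfg_space A F) \<longleftrightarrow> fst c \<in> A \<rightarrow>\<^sub>E {0..} \<and> snd c \<in> edge_cfgs F"
  by (cases c) (simp add: cfg_space_def space_pair_measure space_PiM space_restrict_space edge_cfgs_def)

lemma proj_eq_iff:
  "proj xs c = proj xs c' \<longleftrightarrow>
     (\<forall>z\<in>verts_of xs. fst c z = fst c' z) \<and> (\<forall>e\<in>edges_of xs. snd c e = snd c' e)"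
  by (auto simp: proj_def restrict_cfg_def fun_eq_iff restrict_def)

lemma proj_set_coord:
  "proj xs c = proj xs c' \<Longrightarrow> proj (xs @ [x]) (set_coord x r c) = proj (xs @ [x]) (set_coord x r c')"
  by (cases x) (auto simp: proj_eq_iff)

lemma proj_set_coord_fresh: "x \<notin> set xs \<Longrightarrow> proj xs (set_coord x r c) = proj xs c"
  by (cases x) (auto simp: proj_eq_iff verts_of_def edges_of_def)

lemma proj_snocD: "proj (xs @ [x]) c = proj (xs @ [x]) c' \<Longrightarrow> proj xs c = proj xs c'"
  by (cases x) (auto simp: proj_eq_iff)

lemma set_coord_coord: "c \<in> space (cfg_space A F) \<Longrightarrow> x \<in> A <+> F \<Longrightarrow> set_coord x (coord x c) c = c"
  by (cases x; cases c) (auto simp: space_cfg_space fun_eq_iff PiE_iff max_def)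

lemma set_coord_mono: "r \<le> r' \<Longrightarrow> c \<le> c' \<Longrightarrow> set_coord x r c \<le> set_coord x r' c'"
  by (cases x) (auto simp: less_eq_prod_def le_fun_def)

lemma coord_mono: "c \<le> c' \<Longrightarrow> coord x c \<le> coord x c'"
  by (cases x) (auto simp: less_eq_prod_def le_fun_def)

lemma proj_mono: "c \<le> c' \<Longrightarrow> proj xs c \<le> proj xs c'"
  by (auto simp: proj_def restrict_cfg_def less_eq_prod_def le_fun_def)

lemma measurable_restrict_cfg:
  assumes "A \<subseteq> A'" "F \<subseteq> F'"
  shows "restrict_cfg A F \<in> cfg_space A' F' \<rightarrow>\<^sub>M cfg_space A F"
proof -
  have "(\<lambda>c. (restrict (fst c) A, restrict (snd c) F)) \<in> cfg_space A' F' \<rightarrow>\<^sub>M cfg_space A F"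
    unfolding cfg_space_def
    by (intro measurable_Pair measurable_compose[OF measurable_fst measurable_restrict_subset]
         measurable_compose[OF measurable_snd measurable_restrict_subset] assms)
  then show ?thesis
    by (simp add: restrict_cfg_def[abs_def])
qed

lemma measurable_coord:
  assumes x: "x \<in> A <+> F"
  shows "coord x \<in> borel_measurable (cfg_space A F)"
proof (cases x)
  case (Inl z)
  then have "(\<lambda>c. fst c z) \<in> cfg_space A F \<rightarrow>\<^sub>M restrict_space borel {0..}"
    using x unfolding cfg_space_def
    by (intro measurable_compose[OF measurable_fst measurable_component_singleton]) auto
  then show ?thesis
    using Inl by (simp add: measurable_restrict_space2_iff ext[of "coord (Inl z)", OF coord.simps(1)])
next
  case (Inr e)
  then have "(\<lambda>c. snd c e) \<in> cfg_space A F \<rightarrow>\<^sub>M count_space UNIV"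
    using x unfolding cfg_space_def
    by (intro measurable_compose[OF measurable_snd measurable_component_singleton]) auto
  then have "(\<lambda>c. of_bool (snd c e) :: real) \<in> borel_measurable (cfg_space A F)"
    by (rule measurable_compose) simp
  then show ?thesis
    using Inr by (simp add: ext[of "coord (Inr e)", OF coord.simps(2)])
qed

lemma measurable_set_coord:
  assumes x: "x \<in> A <+> F" and r: "r \<in> borel_measurable M" and c: "c \<in> M \<rightarrow>\<^sub>M cfg_space A F"
  shows "(\<lambda>w. set_coord x (r w) (c w)) \<in> M \<rightarrow>\<^sub>M cfg_space A F"
proof (cases x)
  case (Inl z)
  have "(\<lambda>w. max 0 (r w)) \<in> M \<rightarrow>\<^sub>M restrict_space borel {0..}"
    using r by (intro measurable_restrict_space2) auto
  then have "(\<lambda>w. ((fst (c w))(z := max 0 (r w)), snd (c w))) \<in> M \<rightarrow>\<^sub>M cfg_space A F"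
    using x Inl c unfolding cfg_space_def
    by (intro measurable_Pair measurable_fun_upd[where J=A]) auto
  then show ?thesis by (simp add: Inl)
next
  case (Inr e)
  have "(\<lambda>w. 0 < r w) \<in> M \<rightarrow>\<^sub>M count_space UNIV"
    using r by measurable
  then have "(\<lambda>w. (fst (c w), (snd (c w))(e := 0 < r w))) \<in> M \<rightarrow>\<^sub>M cfg_space A F"
    using x Inr c unfolding cfg_space_def
    by (intro measurable_Pair measurable_fun_upd[where J=F]) auto
  then show ?thesis by (simp add: Inr)
qed

lemma measurable_edge_fun:
  assumes "finite F"
  shows "(\<lambda>c. f (snd c)) \<in> borel_measurable (cfg_space A F)"
proof -
  have eq: "(\<Pi>\<^sub>M e\<in>F. count_space (UNIV :: bool set)) = count_space (edge_cfgs F)"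
    unfolding edge_cfgs_def using assms by (rule count_space_PiM_finite) auto
  have "snd \<in> cfg_space A F \<rightarrow>\<^sub>M count_space (edge_cfgs F)"
    unfolding cfg_space_def eq by (rule measurable_snd)
  then show ?thesis
    by (rule measurable_compose) simp
qed

text \<open>The orders in which an admissible tree can reveal elements. Every prefix of such an order is a set
  of coordinates to which weak monotonicity applies.\<close>

inductive admissible_order :: "'v set set \<Rightarrow> 'v set \<Rightarrow> 'v elem list \<Rightarrow> bool" for E \<Lambda> where
  Nil: "admissible_order E \<Lambda> []"
| snoc: "admissible_order E \<Lambda> xs \<Longrightarrow> x \<in> elems E \<Lambda> \<Longrightarrow> x \<notin> set xs \<Longrightarrow>
    (\<And>e. x = Inr e \<Longrightarrow> e \<inter> \<Lambda> \<subseteq> verts_of xs) \<Longrightarrow> admissible_order E \<Lambda> (xs @ [x])"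

lemma admissible_order_props:
  assumes "admissible_order E \<Lambda> xs"
  shows "set xs \<subseteq> elems E \<Lambda> \<and> distinct xs \<and> (\<forall>e\<in>edges_of xs. e \<inter> \<Lambda> \<subseteq> verts_of xs)"
  using assms
proof induction
  case (snoc xs x)
  then show ?case
    by (cases x) auto
qed simp

lemma admissible_order_snocD:
  assumes "admissible_order E \<Lambda> (xs @ [x])"
  shows "admissible_order E \<Lambda> xs" "x \<in> elems E \<Lambda>" "x \<notin> set xs"
    "\<And>e. x = Inr e \<Longrightarrow> e \<inter> \<Lambda> \<subseteq> verts_of xs"
  using assms by (auto elim: admissible_order.cases)

section \<open>Conditional expectations in a weakly monotonic model\<close>

locale monotonic_model =
  fixes V :: "'v set" and E :: "'v set set" and \<Lambda> :: "'v set"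
    and \<mu> :: "'v cfg measure"
    and \<kappa> :: "'v set \<Rightarrow> 'v set set \<Rightarrow> 'v cfg \<Rightarrow> 'v cfg measure"
  assumes graph: "infinite_transitive_graph V E"
    and \<Lambda>: "finite \<Lambda>" "\<Lambda> \<subseteq> V"
    and \<mu>: "prob_space \<mu>" "sets \<mu> = sets (cfg_space \<Lambda> (incident_edges E \<Lambda>))"
    and \<kappa>: "consistent_cond_family \<Lambda> (incident_edges E \<Lambda>) \<mu> \<kappa>"
    and weak_mono: "weakly_monotonic V E \<Lambda> \<kappa>"
begin

abbreviation "\<E> \<equiv> incident_edges E \<Lambda>"
abbreviation "\<Omega> \<equiv> cfg_space \<Lambda> \<E>"
abbreviation "\<X> \<equiv> elems E \<Lambda>"

sublocale \<mu>: prob_space \<mu> by (fact \<mu>(1))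

lemmas [measurable_cong] = \<mu>(2)

lemma space_\<mu> [simp]: "space \<mu> = space \<Omega>"
  using \<mu>(2) by (rule sets_eq_imp_space_eq)

lemma prob_space_\<Omega> [simp]: "measure \<mu> (space \<Omega>) = 1"
  using \<mu>.prob_space by simp

lemma \<X>_def: "\<X> = \<Lambda> <+> \<E>"
  by (rule elems_def)

lemma edge_doubleton:
  assumes "e \<in> E"
  obtains x y where "e = {x, y}" "x \<in> V" "y \<in> V" "x \<noteq> y"
  using infinite_transitive_graph.edges[OF graph] assms by blast

lemma finite_\<E>: "finite \<E>"
proof -
  have "\<E> \<subseteq> (\<Union>z\<in>\<Lambda>. (\<lambda>y. {z, y}) ` {y. {z, y} \<in> E})"
  proof
    fix e assume e: "e \<in> \<E>"
    then obtain x y where xy: "e = {x, y}"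
      using edge_doubleton[of e thesis] by (auto simp: incident_edges_def)
    with e have "{x, y} \<in> E" "x \<in> \<Lambda> \<or> y \<in> \<Lambda>"
      by (auto simp: incident_edges_def)
    then obtain z z' where "z \<in> \<Lambda>" "{z, z'} \<in> E" "e = {z, z'}"
      unfolding xy by (metis insert_commute)
    then show "e \<in> (\<Union>z\<in>\<Lambda>. (\<lambda>y. {z, y}) ` {y. {z, y} \<in> E})"
      by auto
  qed
  moreover have "finite (\<Union>z\<in>\<Lambda>. (\<lambda>y. {z, y}) ` {y. {z, y} \<in> E})"
    using \<Lambda> infinite_transitive_graph.locally_finite[OF graph] by auto
  ultimately show ?thesis
    by (rule finite_subset)
qed

lemma finite_\<X>: "finite \<X>"
  using \<Lambda> finite_\<E> by (simp add: \<X>_def)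

lemma verts_sub: "set xs \<subseteq> \<X> \<Longrightarrow> verts_of xs \<subseteq> \<Lambda>"
  by (auto simp: verts_of_def elems_def)

lemma edges_sub: "set xs \<subseteq> \<X> \<Longrightarrow> edges_of xs \<subseteq> \<E>"
  by (auto simp: edges_of_def elems_def)

text \<open>The conditional law given the elements of \<open>xs\<close>, as a function of a full configuration. All
  conditional laws then live over one and the same measurable space.\<close>

definition K :: "'v elem list \<Rightarrow> 'v cfg \<Rightarrow> 'v cfg measure" where
  "K xs c = \<kappa> (verts_of xs) (edges_of xs) (proj xs c)"

lemma K_cong: "proj xs c = proj xs c' \<Longrightarrow> K xs c = K xs c'"
  by (simp add: K_def)

lemma regular_\<kappa>:
  "A \<subseteq> \<Lambda> \<Longrightarrow> F \<subseteq> \<E> \<Longrightarrow> regular_cond_distr \<mu> (cfg_space A F) (restrict_cfg A F) (\<kappa> A F)"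
  using \<kappa> unfolding consistent_cond_family_def by blast

lemma consistent_\<kappa>:
  "A \<subseteq> \<Lambda> \<Longrightarrow> F \<subseteq> \<E> \<Longrightarrow> B \<subseteq> \<Lambda> - A \<Longrightarrow> H \<subseteq> \<E> - F \<Longrightarrow> v \<in> space (cfg_space A F) \<Longrightarrow>
    regular_cond_distr (\<kappa> A F v) (cfg_space B H) (restrict_cfg B H)
      (\<lambda>w. \<kappa> (A \<union> B) (F \<union> H) (merge_cfg A F B H v w))"
  using \<kappa> unfolding consistent_cond_family_def by blast

lemma prob_algebra_\<mu>: "prob_algebra \<mu> = prob_algebra \<Omega>"
  unfolding prob_algebra_def by (simp add: subprob_algebra_cong[OF \<mu>(2)])

lemma measurable_\<kappa>:
  "A \<subseteq> \<Lambda> \<Longrightarrow> F \<subseteq> \<E> \<Longrightarrow> \<kappa> A F \<in> cfg_space A F \<rightarrow>\<^sub>M prob_algebra \<Omega>"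
  using regular_\<kappa>[of A F] by (simp add: regular_cond_distr_def prob_algebra_\<mu>)

lemma measurable_proj: "set xs \<subseteq> \<X> \<Longrightarrow> proj xs \<in> \<Omega> \<rightarrow>\<^sub>M cfg_space (verts_of xs) (edges_of xs)"
  unfolding proj_def by (intro measurable_restrict_cfg verts_sub edges_sub)

lemma proj_in_space: "set xs \<subseteq> \<X> \<Longrightarrow> c \<in> space \<Omega> \<Longrightarrow> proj xs c \<in> space (cfg_space (verts_of xs) (edges_of xs))"
  by (rule measurable_space[OF measurable_proj])

lemma measurable_K: "set xs \<subseteq> \<X> \<Longrightarrow> K xs \<in> \<Omega> \<rightarrow>\<^sub>M prob_algebra \<Omega>"
  using measurable_compose[OF measurable_proj[of xs] measurable_\<kappa>[OF verts_sub[of xs] edges_sub[of xs]]]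
  by (simp add: K_def[abs_def])

lemma \<kappa>_props:
  assumes "A \<subseteq> \<Lambda>" "F \<subseteq> \<E>" "v \<in> space (cfg_space A F)"
  shows "prob_space (\<kappa> A F v)" "sets (\<kappa> A F v) = sets \<Omega>" "space (\<kappa> A F v) = space \<Omega>"
  using measurable_space[OF measurable_\<kappa>[OF assms(1,2)] assms(3)]
  by (auto simp: space_prob_algebra dest: sets_eq_imp_space_eq)

lemma K_props:
  assumes "set xs \<subseteq> \<X>" "c \<in> space \<Omega>"
  shows "prob_space (K xs c)" "sets (K xs c) = sets \<Omega>" "space (K xs c) = space \<Omega>"
  unfolding K_def by (intro \<kappa>_props verts_sub edges_sub proj_in_space assms)+

lemma measurable_K_iff:
  "set xs \<subseteq> \<X> \<Longrightarrow> c \<in> space \<Omega> \<Longrightarrow> h \<in> K xs c \<rightarrow>\<^sub>M N \<longleftrightarrow> h \<in> \<Omega> \<rightarrow>\<^sub>M N"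
  by (simp add: measurable_cong_sets[OF K_props(2) refl])

lemma measurable_coord_\<Omega>: "x \<in> \<X> \<Longrightarrow> coord x \<in> borel_measurable \<Omega>"
  unfolding \<X>_def by (rule measurable_coord)

lemma measurable_set_coord_\<Omega>:
  "x \<in> \<X> \<Longrightarrow> r \<in> borel_measurable M \<Longrightarrow> c \<in> M \<rightarrow>\<^sub>M \<Omega> \<Longrightarrow>
    (\<lambda>w. set_coord x (r w) (c w)) \<in> M \<rightarrow>\<^sub>M \<Omega>"
  unfolding \<X>_def by (rule measurable_set_coord)

lemma set_coord_in_space: "x \<in> \<X> \<Longrightarrow> c \<in> space \<Omega> \<Longrightarrow> set_coord x r c \<in> space \<Omega>"
  using measurable_space[OF measurable_set_coord_\<Omega>[of x "\<lambda>_. r" \<Omega> "\<lambda>c. c"]] by auto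

lemma set_coord_coord_\<Omega>: "x \<in> \<X> \<Longrightarrow> c \<in> space \<Omega> \<Longrightarrow> set_coord x (coord x c) c = c"
  unfolding \<X>_def by (rule set_coord_coord)

text \<open>A measurable right inverse of \<open>proj xs\<close>. It turns a function of full configurations that only
  depends on \<open>xs\<close> into a function of partial configurations.\<close>

definition zero_ext :: "'v elem list \<Rightarrow> 'v cfg \<Rightarrow> 'v cfg" where
  "zero_ext xs c = (\<lambda>z\<in>\<Lambda>. if z \<in> verts_of xs then fst c z else 0,
                    \<lambda>e\<in>\<E>. if e \<in> edges_of xs then snd c e else False)"

lemma proj_zero_ext: "set xs \<subseteq> \<X> \<Longrightarrow> proj xs (zero_ext xs (proj xs c)) = proj xs c"
  using verts_sub[of xs] edges_sub[of xs]
  by (auto simp: proj_def zero_ext_def restrict_cfg_def fun_eq_iff)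

lemma measurable_zero_ext:
  assumes xs: "set xs \<subseteq> \<X>"
  shows "zero_ext xs \<in> cfg_space (verts_of xs) (edges_of xs) \<rightarrow>\<^sub>M \<Omega>"
proof -
  have 1: "(\<lambda>c. if z \<in> verts_of xs then fst c z else 0)
      \<in> cfg_space (verts_of xs) (edges_of xs) \<rightarrow>\<^sub>M restrict_space borel {0..}" for z
    unfolding cfg_space_def
    by (cases "z \<in> verts_of xs")
       (auto intro!: measurable_compose[OF measurable_fst measurable_component_singleton]
         measurable_const simp: space_restrict_space)
  have 2: "(\<lambda>c. if e \<in> edges_of xs then snd c e else False)
      \<in> cfg_space (verts_of xs) (edges_of xs) \<rightarrow>\<^sub>M count_space UNIV" for e
    unfolding cfg_space_def
    by (cases "e \<in> edges_of xs")
       (auto intro!: measurable_compose[OF measurable_snd measurable_component_singleton]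
         measurable_const)
  have "(\<lambda>c. (\<lambda>z\<in>\<Lambda>. if z \<in> verts_of xs then fst c z else 0,
              \<lambda>e\<in>\<E>. if e \<in> edges_of xs then snd c e else False))
      \<in> cfg_space (verts_of xs) (edges_of xs) \<rightarrow>\<^sub>M \<Omega>"
    unfolding cfg_space_def[of \<Lambda>]
    by (intro measurable_Pair measurable_restrict 1 2)
  then show ?thesis
    by (simp add: zero_ext_def[abs_def])
qed

lemma integral_disintegrate:
  fixes h :: "'v cfg \<Rightarrow> 'v cfg \<Rightarrow> real"
  assumes xs: "set xs \<subseteq> \<X>"
    and h: "case_prod h \<in> borel_measurable (\<Omega> \<Otimes>\<^sub>M \<Omega>)"
    and bd: "\<And>c w. c \<in> space \<Omega> \<Longrightarrow> w \<in> space \<Omega> \<Longrightarrow> \<bar>h c w\<bar> \<le> C"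
    and dep: "\<And>c c' w. c \<in> space \<Omega> \<Longrightarrow> c' \<in> space \<Omega> \<Longrightarrow> w \<in> space \<Omega> \<Longrightarrow>
      proj xs c = proj xs c' \<Longrightarrow> h c w = h c' w"
  shows "(\<integral>c. h c c \<partial>\<mu>) = (\<integral>c. (\<integral>w. h c w \<partial>K xs c) \<partial>\<mu>)"
proof -
  let ?h = "\<lambda>n w. h (zero_ext xs n) w"
  note ext[measurable] = measurable_zero_ext[OF xs]
  have cong: "?h (proj xs c) w = h c w" if "c \<in> space \<Omega>" "w \<in> space \<Omega>" for c w
    using that xs measurable_space[OF ext proj_in_space[OF xs]]
    by (intro dep) (auto simp: proj_zero_ext)
  have "(\<integral>c. h c c \<partial>\<mu>) = (\<integral>c. ?h (proj xs c) c \<partial>\<mu>)"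
    by (intro Bochner_Integration.integral_cong) (auto simp: cong)
  also have "\<dots> = (\<integral>c. (\<integral>w. ?h (proj xs c) w \<partial>\<kappa> (verts_of xs) (edges_of xs) (proj xs c)) \<partial>\<mu>)"
  proof (rule regular_cond_distr_integral[OF \<mu>(1)])
    show "regular_cond_distr \<mu> (cfg_space (verts_of xs) (edges_of xs)) (proj xs) (\<kappa> (verts_of xs) (edges_of xs))"
      unfolding proj_def by (intro regular_\<kappa> verts_sub edges_sub xs)
    have "(\<lambda>(n, w). (zero_ext xs n, w)) \<in> cfg_space (verts_of xs) (edges_of xs) \<Otimes>\<^sub>M \<mu> \<rightarrow>\<^sub>M \<Omega> \<Otimes>\<^sub>M \<Omega>"
      by measurable
    from measurable_compose[OF this h]
    show "(\<lambda>(n, w). h (zero_ext xs n) w) \<in> borel_measurable (cfg_space (verts_of xs) (edges_of xs) \<Otimes>\<^sub>M \<mu>)"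
      by (simp add: split_beta')
    show "\<bar>h (zero_ext xs n) w\<bar> \<le> C" if "n \<in> space (cfg_space (verts_of xs) (edges_of xs))" "w \<in> space \<mu>" for n w
      using that measurable_space[OF ext] by (intro bd) auto
  qed
  also have "\<dots> = (\<integral>c. (\<integral>w. h c w \<partial>K xs c) \<partial>\<mu>)"
    unfolding K_def[symmetric]
    by (intro Bochner_Integration.integral_cong) (auto simp: cong K_props[OF xs])
  finally show ?thesis .
qed

lemma integral_K_measurable:
  assumes "set xs \<subseteq> \<X>" "(g :: _ \<Rightarrow> real) \<in> borel_measurable \<Omega>"
  shows "(\<lambda>c. \<integral>w. g w \<partial>K xs c) \<in> borel_measurable \<Omega>"
  using assms by (intro measurable_integral_kernel[OF _ measurable_K]) (auto intro: measurable_compose[OF measurable_snd])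

lemma integral_K_abs_le:
  assumes "set xs \<subseteq> \<X>" "c \<in> space \<Omega>" "\<And>w. w \<in> space \<Omega> \<Longrightarrow> \<bar>g w\<bar> \<le> (C :: real)"
  shows "\<bar>\<integral>w. g w \<partial>K xs c\<bar> \<le> C"
  using assms by (intro prob_space.abs_integral_le K_props) (auto simp: K_props)

lemma integral_K_Nil:
  assumes "c \<in> space \<Omega>" "g \<in> borel_measurable \<Omega>" "\<And>w. w \<in> space \<Omega> \<Longrightarrow> \<bar>g w\<bar> \<le> (C :: real)"
  shows "(\<integral>w. g w \<partial>K [] c) = (\<integral>w. g w \<partial>\<mu>)"
proof -
  have "(\<integral>w. g w \<partial>\<mu>) = (\<integral>c'. (\<integral>w. g w \<partial>K [] c') \<partial>\<mu>)"
    using assms by (intro integral_disintegrate[of "[]" "\<lambda>_. g" C]) (auto intro: measurable_compose[OF measurable_snd])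
  also have "\<dots> = (\<integral>c'. (\<integral>w. g w \<partial>K [] c) \<partial>\<mu>)"
    by (intro Bochner_Integration.integral_cong refl) (subst K_cong[of "[]" _ c], auto simp: proj_eq_iff)
  finally show ?thesis
    by (simp add: \<mu>.prob_space)
qed

text \<open>Consistency of the family is what makes this hold for every value \<open>v\<close> and not only almost
  everywhere; monotonicity and the conditioning on spin 0 concern individual values.\<close>

lemma integral_\<kappa>_tower:
  fixes g :: "'v cfg \<Rightarrow> real"
  assumes AF: "A \<subseteq> \<Lambda>" "F \<subseteq> \<E>" "B \<subseteq> \<Lambda> - A" "H \<subseteq> \<E> - F" and v: "v \<in> space (cfg_space A F)"
    and g: "g \<in> borel_measurable \<Omega>" "\<And>w. w \<in> space \<Omega> \<Longrightarrow> \<bar>g w\<bar> \<le> C"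
  shows "(\<integral>w. g w \<partial>\<kappa> A F v) =
    (\<integral>w. (\<integral>w'. g w' \<partial>\<kappa> (A \<union> B) (F \<union> H) (merge_cfg A F B H v (restrict_cfg B H w))) \<partial>\<kappa> A F v)"
proof (rule regular_cond_distr_integral[where h="\<lambda>_. g", OF _ consistent_\<kappa>[OF AF v]])
  show "prob_space (\<kappa> A F v)"
    by (rule \<kappa>_props[OF AF(1,2) v])
  have "g \<in> borel_measurable (\<kappa> A F v)"
    using g by (simp add: measurable_cong_sets[OF \<kappa>_props(2)[OF AF(1,2) v] refl])
  then show "(\<lambda>(n, w). g w) \<in> borel_measurable (cfg_space B H \<Otimes>\<^sub>M \<kappa> A F v)"
    by (auto intro: measurable_compose[OF measurable_snd])
  show "\<bar>g w\<bar> \<le> C" if "w \<in> space (\<kappa> A F v)" for w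
    using that g by (simp add: \<kappa>_props[OF AF(1,2) v])
qed

lemma integral_K_tower:
  fixes g :: "'v cfg \<Rightarrow> real"
  assumes xs: "set xs \<subseteq> \<X>" and x: "x \<in> \<X>" "x \<notin> set xs" and c: "c \<in> space \<Omega>"
    and g: "g \<in> borel_measurable \<Omega>" "\<And>w. w \<in> space \<Omega> \<Longrightarrow> \<bar>g w\<bar> \<le> C"
  shows "(\<integral>w. g w \<partial>K xs c) = (\<integral>w. (\<integral>w'. g w' \<partial>K (xs @ [x]) (set_coord x (coord x w) c)) \<partial>K xs c)"
proof -
  define B where "B = (case x of Inl z \<Rightarrow> {z} | Inr e \<Rightarrow> {})"
  define H where "H = (case x of Inl z \<Rightarrow> {} | Inr e \<Rightarrow> {e})"
  let ?A = "verts_of xs" and ?F = "edges_of xs"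
  have BH: "B \<subseteq> \<Lambda> - ?A" "H \<subseteq> \<E> - ?F"
    using x by (auto simp: B_def H_def \<X>_def verts_of_def edges_of_def split: sum.splits)
  have un: "?A \<union> B = verts_of (xs @ [x])" "?F \<union> H = edges_of (xs @ [x])"
    by (cases x; auto simp: B_def H_def)+
  have "merge_cfg ?A ?F B H (proj xs c) (restrict_cfg B H w) = proj (xs @ [x]) (set_coord x (coord x w) c)"
    if "w \<in> space \<Omega>" for w
    using x that
    by (cases x) (auto simp: merge_cfg_def proj_def restrict_cfg_def B_def H_def fun_eq_iff merge_def
        verts_of_def edges_of_def \<X>_def space_cfg_space max_def PiE_iff)
  then have "(\<integral>w. (\<integral>w'. g w' \<partial>\<kappa> (verts_of (xs @ [x])) (edges_of (xs @ [x]))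
        (merge_cfg ?A ?F B H (proj xs c) (restrict_cfg B H w))) \<partial>K xs c)
      = (\<integral>w. (\<integral>w'. g w' \<partial>K (xs @ [x]) (set_coord x (coord x w) c)) \<partial>K xs c)"
    by (intro Bochner_Integration.integral_cong) (auto simp: K_def[of "xs @ [x]"] K_props[OF xs c])
  then show ?thesis
    using integral_\<kappa>_tower[OF verts_sub[OF xs] edges_sub[OF xs] BH proj_in_space[OF xs c] g]
    unfolding un K_def[of xs, symmetric] by simp
qed

text \<open>Here the spin at \<open>z\<close> is fixed to 0 first and the elements of \<open>xs\<close> are revealed afterwards. This
  compares the conditional law given spin 0 at \<open>z\<close> with a step of the tree at which \<open>z\<close> comes last.\<close>

lemma integral_zero_tower:
  fixes g :: "'v cfg \<Rightarrow> real"
  assumes xs: "set xs \<subseteq> \<X>" and z: "Inl z \<in> \<X>" "Inl z \<notin> set xs" and c: "c \<in> space \<Omega>"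
    and g: "g \<in> borel_measurable \<Omega>" "\<And>w. w \<in> space \<Omega> \<Longrightarrow> \<bar>g w\<bar> \<le> C"
  shows "(\<integral>w. g w \<partial>K [Inl z] (set_coord (Inl z) 0 c)) =
    (\<integral>w. (\<integral>w'. g w' \<partial>K (xs @ [Inl z]) (set_coord (Inl z) 0 w)) \<partial>K [Inl z] (set_coord (Inl z) 0 c))"
proof -
  let ?v = "proj [Inl z] (set_coord (Inl z) 0 c)"
  have zz: "set [Inl z] \<subseteq> \<X>" using z by simp
  have sc: "set_coord (Inl z) 0 c \<in> space \<Omega>" by (rule set_coord_in_space[OF z(1) c])
  have BH: "verts_of xs \<subseteq> \<Lambda> - {z}" "edges_of xs \<subseteq> \<E> - {}"
    using z verts_sub[OF xs] edges_sub[OF xs] by (auto simp: verts_of_def)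
  have ve: "verts_of [Inl z] = {z}" "edges_of [Inl z] = {}"
    by (auto simp: verts_of_def edges_of_def)
  have v: "?v \<in> space (cfg_space {z} {})"
    using proj_in_space[OF zz sc] by (simp only: ve)
  have "merge_cfg {z} {} (verts_of xs) (edges_of xs) ?v (restrict_cfg (verts_of xs) (edges_of xs) w)
      = proj (xs @ [Inl z]) (set_coord (Inl z) 0 w)" for w
    using z by (auto simp: merge_cfg_def proj_def ve restrict_cfg_def fun_eq_iff merge_def verts_of_def)
  moreover have "{z} \<subseteq> \<Lambda>" "{} \<subseteq> \<E>" using z by (auto simp: \<X>_def)
  ultimately show ?thesis
    using integral_\<kappa>_tower[OF _ _ BH v g] by (simp add: K_def ve)
qed

lemma ext_boundaryI:
  assumes "x \<in> \<Lambda>" "y \<in> V - \<Lambda>" "{y, x} \<in> E"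
  shows "y \<in> ext_boundary V E \<Lambda>"
proof -
  have ge: "1 \<le> graph_dist E y a" if "a \<in> \<Lambda>" for a
  proof -
    have "(y, a) \<in> (adj E)\<^sup>*"
      using that assms \<Lambda> by (intro infinite_transitive_graph.connected[OF graph]) auto
    then obtain n where "(y, a) \<in> adj E ^^ n"
      by (auto simp: rtrancl_power)
    then have "(y, a) \<in> adj E ^^ graph_dist E y a"
      unfolding graph_dist_def by (rule LeastI)
    moreover have "y \<noteq> a" using that assms by auto
    ultimately show ?thesis
      by (cases "graph_dist E y a") auto
  qed
  have "(y, x) \<in> adj E ^^ 1"
    using assms by (auto simp: adj_def)
  then have "graph_dist E y x \<le> 1"
    unfolding graph_dist_def by (rule Least_le)
  then have "graph_dist E y x = 1"
    using ge[OF assms(1)] by simp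
  then have "(INF a\<in>\<Lambda>. graph_dist E y a) = 1"
    using ge assms(1) by (intro antisym cINF_greatest) (auto intro!: cINF_lower2[of _ _ x])
  then show ?thesis
    using assms by (simp add: ext_boundary_def)
qed

text \<open>An edge is revealed after its endpoints in \<open>\<Lambda>\<close>, and an endpoint outside \<open>\<Lambda>\<close> is on the
  exterior boundary. So the revealed edges are among those allowed in weak monotonicity.\<close>

lemma admissible_order_edges:
  assumes "admissible_order E \<Lambda> xs"
  shows "edges_of xs \<subseteq> {e \<in> incident_edges E (verts_of xs). e \<subseteq> verts_of xs \<union> ext_boundary V E \<Lambda>}"
proof
  fix e assume e: "e \<in> edges_of xs"
  with admissible_order_props[OF assms] have in_E: "e \<in> \<E>" and sub: "e \<inter> \<Lambda> \<subseteq> verts_of xs"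
    using edges_sub[of xs] by auto
  then have "e \<in> E" and "e \<inter> \<Lambda> \<noteq> {}" by (auto simp: incident_edges_def)
  then obtain x y where xy: "e = {x, y}" "x \<in> \<Lambda>" "x \<in> V" "y \<in> V"
    by (elim edge_doubleton) (auto simp: insert_commute)
  then have "y \<in> \<Lambda> \<or> y \<in> ext_boundary V E \<Lambda>"
    using \<open>e \<in> E\<close> ext_boundaryI[of x y] by (auto simp: insert_commute)
  then show "e \<in> {e \<in> incident_edges E (verts_of xs). e \<subseteq> verts_of xs \<union> ext_boundary V E \<Lambda>}"
    using sub xy \<open>e \<in> E\<close> by (auto simp: incident_edges_def)
qed

lemma integral_K_mono:
  fixes h :: "'v cfg \<Rightarrow> real"
  assumes xs: "admissible_order E \<Lambda> xs" and c: "c \<in> space \<Omega>" "c' \<in> space \<Omega>" "c \<le> c'"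
    and h: "h \<in> borel_measurable \<Omega>" "\<And>w. w \<in> space \<Omega> \<Longrightarrow> \<bar>h w\<bar> \<le> C" "mono_on (space \<Omega>) h"
  shows "(\<integral>w. h w \<partial>K xs c) \<le> (\<integral>w. h w \<partial>K xs c')"
proof -
  have sub: "set xs \<subseteq> \<X>" using admissible_order_props[OF xs] by simp
  have "stoch_le \<Omega> (K xs c) (K xs c')"
    unfolding K_def
    using weak_mono[unfolded weakly_monotonic_def, rule_format, of "verts_of xs" "edges_of xs" "proj xs c" "proj xs c'"]
    using verts_sub[OF sub] admissible_order_edges[OF xs] proj_in_space[OF sub] c proj_mono[OF c(3)]
    by blast
  moreover have "bounded (h ` space \<Omega>)"
    using h(2) unfolding bounded_iff by fastforce
  ultimately show ?thesis
    using h by (simp add: stoch_le_def)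
qed

section \<open>Positive association\<close>

definition cexp :: "('v cfg \<Rightarrow> real) \<Rightarrow> 'v elem list \<Rightarrow> 'v cfg \<Rightarrow> real" where
  "cexp g xs c = (\<integral>w. g w \<partial>K xs c)"

definition bdd_incr :: "real \<Rightarrow> ('v cfg \<Rightarrow> real) \<Rightarrow> bool" where
  "bdd_incr C h \<longleftrightarrow> h \<in> borel_measurable \<Omega> \<and> mono_on (space \<Omega>) h \<and> (\<forall>w\<in>space \<Omega>. \<bar>h w\<bar> \<le> C)"

text \<open>This stands for measurability with respect to the revealed elements: it can be checked pointwise,
  and it survives the resampling of a later element.\<close>

definition depends_on :: "'v elem list \<Rightarrow> ('v cfg \<Rightarrow> 'b) \<Rightarrow> bool" where
  "depends_on xs h \<longleftrightarrow> (\<forall>c\<in>space \<Omega>. \<forall>c'\<in>space \<Omega>. proj xs c = proj xs c' \<longrightarrow> h c = h c')"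

lemma bdd_incrD:
  assumes "bdd_incr C h"
  shows "h \<in> borel_measurable \<Omega>" "\<And>w. w \<in> space \<Omega> \<Longrightarrow> \<bar>h w\<bar> \<le> C"
    "\<And>c c'. c \<in> space \<Omega> \<Longrightarrow> c' \<in> space \<Omega> \<Longrightarrow> c \<le> c' \<Longrightarrow> h c \<le> h c'"
  using assms mono_onD[of "space \<Omega>" h] by (auto simp: bdd_incr_def simp del: split_paired_All)

lemma depends_onD:
  assumes "depends_on xs h" "proj xs c = proj xs c'" "c \<in> space \<Omega>" "c' \<in> space \<Omega>"
  shows "h c = h c'"
  using assms(1)[unfolded depends_on_def, rule_format, OF assms(3,4,2)] .

lemma depends_onI:
  "(\<And>c c'. c \<in> space \<Omega> \<Longrightarrow> c' \<in> space \<Omega> \<Longrightarrow> proj xs c = proj xs c' \<Longrightarrow> h c = h c') \<Longrightarrow> depends_on xs h"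
  unfolding depends_on_def by (intro ballI impI)

lemma depends_on_all: "(\<And>c. c \<in> space \<Omega> \<Longrightarrow> proj xs c = c) \<Longrightarrow> depends_on xs h"
  by (rule depends_onI) simp

lemma depends_on_const: "depends_on xs (\<lambda>_. a)"
  by (rule depends_onI) (rule refl)

lemma depends_on_mult:
  fixes g h :: "'v cfg \<Rightarrow> real"
  assumes "depends_on xs g" "depends_on xs h"
  shows "depends_on xs (\<lambda>c. g c * h c)"
proof (rule depends_onI)
  fix c c' assume "c \<in> space \<Omega>" "c' \<in> space \<Omega>" "proj xs c = proj xs c'"
  with depends_onD[OF assms(1), of c c'] depends_onD[OF assms(2), of c c'] show "g c * h c = g c' * h c'"
    by (simp only:)
qed

lemma cexp_cong: "proj xs c = proj xs c' \<Longrightarrow> cexp g xs c = cexp g xs c'"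
  unfolding cexp_def by (drule K_cong) (erule arg_cong)

lemma depends_on_cexp: "depends_on xs (cexp g xs)"
  by (rule depends_onI) (rule cexp_cong)

lemma depends_on_coord: "x \<in> set xs \<Longrightarrow> depends_on xs (coord x)"
  by (rule depends_onI, cases x) (auto simp: proj_eq_iff verts_of_def edges_of_def)

lemma bdd_incr_cexp:
  assumes "admissible_order E \<Lambda> xs" "bdd_incr C h"
  shows "bdd_incr C (cexp h xs)"
proof -
  note h = bdd_incrD[OF assms(2)]
  have sub: "set xs \<subseteq> \<X>"
    using admissible_order_props[OF assms(1)] by simp
  have "mono_on (space \<Omega>) h"
    using assms(2) by (simp add: bdd_incr_def)
  from integral_K_mono[OF assms(1) _ _ _ h(1,2) this]
  have "mono_on (space \<Omega>) (cexp h xs)"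
    unfolding cexp_def by (intro mono_onI)
  moreover have "cexp h xs \<in> borel_measurable \<Omega>"
    unfolding cexp_def[abs_def] by (rule integral_K_measurable[OF sub h(1)])
  moreover have "\<forall>w\<in>space \<Omega>. \<bar>cexp h xs w\<bar> \<le> C"
    unfolding cexp_def by (intro ballI integral_K_abs_le[OF sub _ h(2)])
  ultimately show ?thesis
    by (simp add: bdd_incr_def)
qed

lemma measurable_cexp_set_coord:
  assumes "set xs \<subseteq> \<X>" "x \<in> \<X>" "g \<in> borel_measurable \<Omega>"
    and "r \<in> borel_measurable M" "c \<in> M \<rightarrow>\<^sub>M \<Omega>"
  shows "(\<lambda>w. cexp g xs (set_coord x (r w) (c w))) \<in> borel_measurable M"
  unfolding cexp_def
  by (intro measurable_compose[OF measurable_set_coord_\<Omega> integral_K_measurable] assms)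

lemma integral_cexp:
  assumes xs: "set xs \<subseteq> \<X>" and \<phi>: "\<phi> \<in> borel_measurable \<Omega>" "depends_on xs \<phi>"
      "\<And>w. w \<in> space \<Omega> \<Longrightarrow> \<bar>\<phi> w\<bar> \<le> C"
    and g: "g \<in> borel_measurable \<Omega>" "\<And>w. w \<in> space \<Omega> \<Longrightarrow> \<bar>g w\<bar> \<le> D"
  shows "(\<integral>c. \<phi> c * cexp g xs c \<partial>\<mu>) = (\<integral>c. \<phi> c * g c \<partial>\<mu>)"
proof -
  have "(\<integral>c. \<phi> c * g c \<partial>\<mu>) = (\<integral>c. (\<integral>w. \<phi> c * g w \<partial>K xs c) \<partial>\<mu>)"
  proof (rule integral_disintegrate[OF xs])
    show "(\<lambda>(c, w). \<phi> c * g w) \<in> borel_measurable (\<Omega> \<Otimes>\<^sub>M \<Omega>)"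
      using \<phi> g by measurable
    show "\<bar>\<phi> c * g w\<bar> \<le> C * D" if "c \<in> space \<Omega>" "w \<in> space \<Omega>" for c w
      using \<phi>(3)[OF that(1)] g(2)[OF that(2)] by (simp add: abs_mult mult_mono')
    show "\<phi> c * g w = \<phi> c' * g w" if "c \<in> space \<Omega>" "c' \<in> space \<Omega>" "proj xs c = proj xs c'" for c c' w
      using depends_onD[OF \<phi>(2) that(3,1,2)] by simp
  qed
  then show ?thesis
    by (simp add: cexp_def)
qed

lemma integral_cexp_1:
  assumes xs: "set xs \<subseteq> \<X>"
    and g: "g \<in> borel_measurable \<Omega>" "\<And>w. w \<in> space \<Omega> \<Longrightarrow> \<bar>g w\<bar> \<le> D"
  shows "(\<integral>c. cexp g xs c \<partial>\<mu>) = (\<integral>c. g c \<partial>\<mu>)"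
  using integral_cexp[OF xs _ _ _ g, of "\<lambda>_. 1" 1] by (simp add: depends_on_const)

lemma cexp_tower:
  assumes "set xs \<subseteq> \<X>" "x \<in> \<X>" "x \<notin> set xs" "c \<in> space \<Omega>"
    and "g \<in> borel_measurable \<Omega>" "\<And>w. w \<in> space \<Omega> \<Longrightarrow> \<bar>g w\<bar> \<le> C"
  shows "cexp g xs c = (\<integral>w. cexp g (xs @ [x]) (set_coord x (coord x w) c) \<partial>K xs c)"
  unfolding cexp_def using assms by (rule integral_K_tower)

text \<open>The coordinate \<open>x\<close> may be drawn afresh from its conditional law given \<open>xs\<close> without changing the
  law of the elements of \<open>xs @ [x]\<close>.\<close>

lemma integral_resample:
  fixes \<phi> :: "'v cfg \<Rightarrow> real"
  assumes xs: "set xs \<subseteq> \<X>" and x: "x \<in> \<X>"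
    and \<phi>: "\<phi> \<in> borel_measurable \<Omega>" "depends_on (xs @ [x]) \<phi>" "\<And>w. w \<in> space \<Omega> \<Longrightarrow> \<bar>\<phi> w\<bar> \<le> C"
  shows "(\<integral>c. \<phi> c \<partial>\<mu>) = (\<integral>c. (\<integral>w. \<phi> (set_coord x (coord x w) c) \<partial>K xs c) \<partial>\<mu>)"
proof -
  have "(\<integral>c. \<phi> c \<partial>\<mu>) = (\<integral>c. \<phi> (set_coord x (coord x c) c) \<partial>\<mu>)"
    by (intro Bochner_Integration.integral_cong) (auto simp: set_coord_coord_\<Omega>[OF x])
  also have "\<dots> = (\<integral>c. (\<integral>w. \<phi> (set_coord x (coord x w) c) \<partial>K xs c) \<partial>\<mu>)"
  proof (rule integral_disintegrate[OF xs])
    have "(\<lambda>z. set_coord x (coord x (snd z)) (fst z)) \<in> \<Omega> \<Otimes>\<^sub>M \<Omega> \<rightarrow>\<^sub>M \<Omega>"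
      by (intro measurable_set_coord_\<Omega> x measurable_compose[OF measurable_snd measurable_coord_\<Omega>] measurable_fst)
    from measurable_compose[OF this \<phi>(1)]
    show "(\<lambda>(c, w). \<phi> (set_coord x (coord x w) c)) \<in> borel_measurable (\<Omega> \<Otimes>\<^sub>M \<Omega>)"
      by (simp add: split_beta')
    show "\<bar>\<phi> (set_coord x (coord x w) c)\<bar> \<le> C" if "c \<in> space \<Omega>" for c w
      using that by (intro \<phi>(3) set_coord_in_space x)
    show "\<phi> (set_coord x (coord x w) c) = \<phi> (set_coord x (coord x w) c')"
      if "c \<in> space \<Omega>" "c' \<in> space \<Omega>" "proj xs c = proj xs c'" for c c' w
      using that by (intro depends_onD[OF \<phi>(2)] set_coord_in_space x proj_set_coord)
  qed
  finally show ?thesis .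
qed

lemma bdd_incr_step:
  assumes xs: "admissible_order E \<Lambda> (xs @ [x])" and g: "bdd_incr C g"
    and c: "c \<in> space \<Omega>" "c' \<in> space \<Omega>" "c \<le> c'" "r \<le> r'"
  shows "cexp g (xs @ [x]) (set_coord x r c) \<le> cexp g (xs @ [x]) (set_coord x r' c')"
  using admissible_order_snocD(2)[OF xs] c
  by (intro bdd_incrD(3)[OF bdd_incr_cexp[OF xs g]] set_coord_in_space set_coord_mono)

text \<open>Given \<open>xs\<close>, both conditional expectations given \<open>xs @ [x]\<close> are increasing functions of the single
  real coordinate \<open>x\<close>, hence positively correlated by Chebyshev's inequality; their means are the
  conditional expectations given \<open>xs\<close>.\<close>

lemma association_step:
  assumes xs: "admissible_order E \<Lambda> (xs @ [x])" and g: "bdd_incr C g" and h: "bdd_incr D h"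
  shows "(\<integral>c. cexp g xs c * cexp h xs c \<partial>\<mu>) \<le> (\<integral>c. cexp g (xs @ [x]) c * cexp h (xs @ [x]) c \<partial>\<mu>)"
proof -
  note xsx = admissible_order_snocD[OF xs]
  have sub: "set xs \<subseteq> \<X>" "set (xs @ [x]) \<subseteq> \<X>"
    using admissible_order_props[OF xs] by auto
  let ?G = "cexp g (xs @ [x])" and ?H = "cexp h (xs @ [x])"
  note G = bdd_incrD[OF bdd_incr_cexp[OF xs g]] and H = bdd_incrD[OF bdd_incr_cexp[OF xs h]]
  have GH: "\<bar>?G w * ?H w\<bar> \<le> C * D" if "w \<in> space \<Omega>" for w
    using G(2)[OF that] H(2)[OF that] by (simp add: abs_mult mult_mono')
  have GH_meas: "(\<lambda>c. ?G c * ?H c) \<in> borel_measurable \<Omega>"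
    using G(1) H(1) by measurable
  have "(\<integral>c. ?G c * ?H c \<partial>\<mu>) =
      (\<integral>c. (\<integral>w. ?G (set_coord x (coord x w) c) * ?H (set_coord x (coord x w) c) \<partial>K xs c) \<partial>\<mu>)"
    by (rule integral_resample[OF sub(1) xsx(2) GH_meas _ GH])
       (intro depends_on_mult depends_on_cexp)
  also have "\<dots> \<ge> (\<integral>c. cexp g xs c * cexp h xs c \<partial>\<mu>)"
  proof (rule integral_mono)
    show "integrable \<mu> (\<lambda>c. cexp g xs c * cexp h xs c)"
    proof (rule \<mu>.integrable_bounded)
      note g' = bdd_incrD[OF bdd_incr_cexp[OF xsx(1) g]] and h' = bdd_incrD[OF bdd_incr_cexp[OF xsx(1) h]]
      show "(\<lambda>c. cexp g xs c * cexp h xs c) \<in> borel_measurable \<mu>"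
        using g'(1) h'(1) by measurable
      show "\<bar>cexp g xs c * cexp h xs c\<bar> \<le> C * D" if "c \<in> space \<mu>" for c
        using that g'(2)[of c] h'(2)[of c] by (simp add: abs_mult mult_mono')
    qed
    have "(\<lambda>c. \<integral>w. ?G (set_coord x (coord x w) c) * ?H (set_coord x (coord x w) c) \<partial>K xs c) \<in> borel_measurable \<Omega>"
    proof (rule measurable_integral_kernel[OF _ measurable_K[OF sub(1)]])
      have "(\<lambda>z. set_coord x (coord x (snd z)) (fst z)) \<in> \<Omega> \<Otimes>\<^sub>M \<Omega> \<rightarrow>\<^sub>M \<Omega>"
        by (intro measurable_set_coord_\<Omega> xsx measurable_compose[OF measurable_snd measurable_coord_\<Omega>] measurable_fst)
      from measurable_compose[OF this GH_meas]
      show "(\<lambda>(c, w). ?G (set_coord x (coord x w) c) * ?H (set_coord x (coord x w) c)) \<in> borel_measurable (\<Omega> \<Otimes>\<^sub>M \<Omega>)"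
        by (simp add: split_beta')
    qed
    then show "integrable \<mu> (\<lambda>c. \<integral>w. ?G (set_coord x (coord x w) c) * ?H (set_coord x (coord x w) c) \<partial>K xs c)"
      by (intro \<mu>.integrable_bounded[of _ "C * D"] integral_K_abs_le GH sub xsx set_coord_in_space) auto
    fix c assume "c \<in> space \<mu>"
    then have c: "c \<in> space \<Omega>" by simp
    interpret KP: prob_space "K xs c" by (rule K_props[OF sub(1) c])
    have in_\<Omega>: "set_coord x r c \<in> space \<Omega>" for r
      by (rule set_coord_in_space[OF xsx(2) c])
    have meas: "(\<lambda>w. cexp k (xs @ [x]) (set_coord x (coord x w) c)) \<in> borel_measurable (K xs c)"
      if "k \<in> borel_measurable \<Omega>" for k
      unfolding measurable_K_iff[OF sub(1) c]
      by (rule measurable_cexp_set_coord[OF sub(2) xsx(2) that measurable_coord_\<Omega>[OF xsx(2)]]) (simp add: c)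
    have "(\<integral>w. ?G (set_coord x (coord x w) c) \<partial>K xs c) * (\<integral>w. ?H (set_coord x (coord x w) c) \<partial>K xs c)
        \<le> (\<integral>w. ?G (set_coord x (coord x w) c) * ?H (set_coord x (coord x w) c) \<partial>K xs c)"
    proof (rule KP.chebyshev_association)
      fix w w'
      have "set_coord x (coord x w) c \<le> set_coord x (coord x w') c \<or> set_coord x (coord x w') c \<le> set_coord x (coord x w) c"
        using linear[of "coord x w" "coord x w'"] by (auto intro: set_coord_mono)
      then show "0 \<le> (?G (set_coord x (coord x w) c) - ?G (set_coord x (coord x w') c)) *
                     (?H (set_coord x (coord x w) c) - ?H (set_coord x (coord x w') c))"
        using G(3)[OF in_\<Omega> in_\<Omega>] H(3)[OF in_\<Omega> in_\<Omega>]
        by (auto intro: mult_nonneg_nonneg mult_nonpos_nonpos)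
    qed (use G(2)[OF in_\<Omega>] H(2)[OF in_\<Omega>] meas bdd_incrD(1)[OF g] bdd_incrD(1)[OF h] in auto)
    then show "cexp g xs c * cexp h xs c \<le> (\<integral>w. ?G (set_coord x (coord x w) c) * ?H (set_coord x (coord x w) c) \<partial>K xs c)"
      by (simp add: cexp_tower[OF sub(1) xsx(2,3) c bdd_incrD(1,2)[OF g]]
                    cexp_tower[OF sub(1) xsx(2,3) c bdd_incrD(1,2)[OF h]])
  qed
  finally show ?thesis .
qed

text \<open>With nothing revealed the right-hand side equals the left-hand side, and no step along the
  order lowers it. Stated for conditional expectations, because \<open>step_gap_edge\<close> needs it at the moment
  at which an edge is about to be revealed.\<close>

lemma association_cexp:
  assumes xs: "admissible_order E \<Lambda> xs" and g: "bdd_incr C g" and h: "bdd_incr D h"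
  shows "(\<integral>c. g c \<partial>\<mu>) * (\<integral>c. h c \<partial>\<mu>) \<le> (\<integral>c. cexp g xs c * cexp h xs c \<partial>\<mu>)"
  using xs
proof induction
  case Nil
  have "cexp k [] c = (\<integral>c. k c \<partial>\<mu>)" if "c \<in> space \<mu>" "bdd_incr B k" for c B k
    using that(1) unfolding cexp_def
    by (intro integral_K_Nil[where C=B] bdd_incrD(1)[OF that(2)] bdd_incrD(2)[OF that(2)]) simp_all
  then have "(\<integral>c. cexp g [] c * cexp h [] c \<partial>\<mu>) = (\<integral>c. (\<integral>c. g c \<partial>\<mu>) * (\<integral>c. h c \<partial>\<mu>) \<partial>\<mu>)"
    using g h by (intro Bochner_Integration.integral_cong) auto
  then show ?case by simp
next
  case (snoc xs x)
  have "admissible_order E \<Lambda> (xs @ [x])"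
    using snoc by (intro admissible_order.snoc)
  from association_step[OF this g h] snoc.IH show ?case
    by linarith
qed

text \<open>All vertices first, then all edges.\<close>

lemma admissible_order_exhaustive: "\<exists>xs. admissible_order E \<Lambda> xs \<and> set xs = \<X>"
proof -
  have verts: "\<exists>xs. admissible_order E \<Lambda> xs \<and> set xs = Inl ` A" if "finite A" "A \<subseteq> \<Lambda>" for A
    using that
  proof (induction A)
    case empty
    then show ?case by (auto intro: admissible_order.Nil)
  next
    case (insert z A)
    then obtain xs where "admissible_order E \<Lambda> xs" "set xs = Inl ` A" by auto
    then have "admissible_order E \<Lambda> (xs @ [Inl z])"
      using insert by (intro admissible_order.snoc) (auto simp: \<X>_def)
    then show ?case
      using \<open>set xs = Inl ` A\<close> by (intro exI[of _ "xs @ [Inl z]"]) auto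
  qed
  then obtain vs where vs: "admissible_order E \<Lambda> vs" "set vs = Inl ` \<Lambda>"
    using verts[OF \<Lambda>(1) order.refl] by blast
  have edges: "\<exists>xs. admissible_order E \<Lambda> xs \<and> set xs = Inl ` \<Lambda> \<union> Inr ` F" if "finite F" "F \<subseteq> \<E>" for F
    using that
  proof (induction F)
    case empty
    then show ?case using vs by auto
  next
    case (insert e F)
    then obtain xs where "admissible_order E \<Lambda> xs" "set xs = Inl ` \<Lambda> \<union> Inr ` F" by auto
    then have "admissible_order E \<Lambda> (xs @ [Inr e])"
      using insert by (intro admissible_order.snoc) (auto simp: \<X>_def verts_of_def)
    then show ?case
      using \<open>set xs = _\<close> by (intro exI[of _ "xs @ [Inr e]"]) auto
  qed
  then show ?thesis
    using edges[OF finite_\<E> order.refl] by (simp add: \<X>_def Plus_def)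
qed

lemma proj_all:
  assumes "set xs = \<X>" "c \<in> space \<Omega>"
  shows "proj xs c = c"
proof -
  have "verts_of xs = \<Lambda>" "edges_of xs = \<E>"
    using assms by (auto simp: verts_of_def edges_of_def \<X>_def)
  then show ?thesis
    using assms(2) by (cases c) (auto simp: proj_def restrict_cfg_def space_cfg_space edge_cfgs_def dest!: PiE_restrict)
qed

text \<open>Once everything is revealed, a conditional expectation is the function itself.\<close>

lemma positive_association:
  assumes g: "bdd_incr C g" and h: "bdd_incr D h"
  shows "(\<integral>c. g c \<partial>\<mu>) * (\<integral>c. h c \<partial>\<mu>) \<le> (\<integral>c. g c * h c \<partial>\<mu>)"
proof -
  obtain xs where xs: "admissible_order E \<Lambda> xs" "set xs = \<X>"
    using admissible_order_exhaustive by auto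
  have dep: "depends_on xs \<phi>" for \<phi> :: "'v cfg \<Rightarrow> real"
    using proj_all[OF xs(2)] by (rule depends_on_all)
  have sub: "set xs \<subseteq> \<X>" using xs by simp
  note g' = bdd_incrD[OF g] and h' = bdd_incrD[OF h] and ch = bdd_incrD[OF bdd_incr_cexp[OF xs(1) h]]
  have "(\<integral>c. cexp g xs c * cexp h xs c \<partial>\<mu>) = (\<integral>c. cexp h xs c * cexp g xs c \<partial>\<mu>)"
    by (simp add: mult.commute)
  also have "\<dots> = (\<integral>c. cexp h xs c * g c \<partial>\<mu>)"
    by (rule integral_cexp[OF sub ch(1) dep ch(2) g'(1,2)])
  also have "\<dots> = (\<integral>c. g c * cexp h xs c \<partial>\<mu>)"
    by (simp add: mult.commute)
  also have "\<dots> = (\<integral>c. g c * h c \<partial>\<mu>)"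
    by (rule integral_cexp[OF sub g'(1) dep g'(2) h'(1,2)])
  finally show ?thesis
    using association_cexp[OF xs(1) g h] by simp
qed

section \<open>The cost of resampling one coordinate\<close>

text \<open>The price of replacing a coupled draw of \<open>x\<close> by an independent one. Only the
  positive part is paid: replacing the coupled draw by a larger one does not lower the mean of
  \<open>f(X) f(Y)\<close>.\<close>

definition step_gap :: "('v cfg \<Rightarrow> real) \<Rightarrow> 'v elem list \<Rightarrow> 'v elem \<Rightarrow> 'v cfg \<Rightarrow> real" where
  "step_gap g xs x y = (\<integral>w. (\<integral>w'. max 0 (cexp g (xs @ [x]) (set_coord x (coord x w) y)
      - cexp g (xs @ [x]) (set_coord x (coord x w') y)) \<partial>K xs y) \<partial>K xs y)"

lemma measurable_step_gap:
  assumes xs: "set xs \<subseteq> \<X>" and x: "x \<in> \<X>" and g: "g \<in> borel_measurable \<Omega>"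
  shows "step_gap g xs x \<in> borel_measurable \<Omega>"
  unfolding step_gap_def[abs_def]
proof (rule measurable_integral_kernel[OF _ measurable_K[OF xs]])
  have xsx: "set (xs @ [x]) \<subseteq> \<X>" using xs x by simp
  note cm = measurable_coord_\<Omega>[OF x]
  have "(\<lambda>z. \<integral>w'. max 0 (cexp g (xs @ [x]) (set_coord x (coord x (snd z)) (fst z))
      - cexp g (xs @ [x]) (set_coord x (coord x w') (fst z))) \<partial>K xs (fst z)) \<in> borel_measurable (\<Omega> \<Otimes>\<^sub>M \<Omega>)"
  proof (rule measurable_integral_kernel[where N=\<Omega>])
    have "(\<lambda>z. cexp g (xs @ [x]) (set_coord x (coord x (snd (fst z))) (fst (fst z)))) \<in> borel_measurable ((\<Omega> \<Otimes>\<^sub>M \<Omega>) \<Otimes>\<^sub>M \<Omega>)"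
      "(\<lambda>z. cexp g (xs @ [x]) (set_coord x (coord x (snd z)) (fst (fst z)))) \<in> borel_measurable ((\<Omega> \<Otimes>\<^sub>M \<Omega>) \<Otimes>\<^sub>M \<Omega>)"
      using cm by (intro measurable_cexp_set_coord[OF xsx x g]; measurable)+
    then show "(\<lambda>(z, w'). max 0 (cexp g (xs @ [x]) (set_coord x (coord x (snd z)) (fst z))
      - cexp g (xs @ [x]) (set_coord x (coord x w') (fst z)))) \<in> borel_measurable ((\<Omega> \<Otimes>\<^sub>M \<Omega>) \<Otimes>\<^sub>M \<Omega>)"
      unfolding split_beta' by measurable
    show "(\<lambda>z. K xs (fst z)) \<in> \<Omega> \<Otimes>\<^sub>M \<Omega> \<rightarrow>\<^sub>M prob_algebra \<Omega>"
      by (rule measurable_compose[OF measurable_fst measurable_K[OF xs]])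
  qed
  then show "(\<lambda>(y, w). \<integral>w'. max 0 (cexp g (xs @ [x]) (set_coord x (coord x w) y)
      - cexp g (xs @ [x]) (set_coord x (coord x w') y)) \<partial>K xs y) \<in> borel_measurable (\<Omega> \<Otimes>\<^sub>M \<Omega>)"
    by (simp add: split_beta')
qed

text \<open>For states \<open>v\<close>, \<open>v'\<close> in \<open>{0, 1}\<close> and an increasing \<open>m\<close>, the positive part of \<open>m v - m v'\<close> is
  \<open>v * (1 - v') * (m v - m v')\<close>. Expanding and integrating over both states gives the conditional
  covariance of \<open>m\<close> and the state; its mean is compared with the unconditional covariance through
  \<open>association_cexp\<close>.\<close>

lemma step_gap_edge:
  assumes xs: "admissible_order E \<Lambda> (xs @ [Inr e])" and g: "bdd_incr C g"
  shows "(\<integral>y. step_gap g xs (Inr e) y \<partial>\<mu>) \<le> covariance \<mu> g (\<lambda>c. of_bool (snd c e))"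
proof -
  let ?x = "Inr e :: 'v elem"
  note xsx = admissible_order_snocD[OF xs]
  have sub: "set xs \<subseteq> \<X>" "set (xs @ [?x]) \<subseteq> \<X>"
    using admissible_order_props[OF xs] by auto
  let ?v = "coord ?x" and ?m = "cexp g (xs @ [?x])"
  have v: "bdd_incr 1 ?v"
    using measurable_coord_\<Omega>[OF xsx(2)] unfolding bdd_incr_def by (intro conjI mono_onI coord_mono ballI) auto
  note g' = bdd_incrD[OF g] and v' = bdd_incrD[OF v] and m' = bdd_incrD[OF bdd_incr_cexp[OF xs g]]
    and pm = bdd_incrD[OF bdd_incr_cexp[OF xsx(1) g]] bdd_incrD[OF bdd_incr_cexp[OF xsx(1) v]]
  have vm_meas: "(\<lambda>c. ?v c * ?m c) \<in> borel_measurable \<Omega>"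
    using v'(1) m'(1) by measurable
  have vm_bd: "\<bar>?v c * ?m c\<bar> \<le> C" if "c \<in> space \<Omega>" for c
    using v'(2)[OF that] m'(2)[OF that] by (auto simp: abs_mult)
  have vG_bd: "\<bar>?v w * ?m (set_coord ?x r y)\<bar> \<le> C" if "y \<in> space \<Omega>" "w \<in> space \<Omega>" for w y r
    using mult_mono'[OF v'(2)[OF that(2)] m'(2)[OF set_coord_in_space[OF xsx(2) that(1)]]]
    by (simp add: abs_mult del: coord.simps set_coord.simps)
  have gap: "step_gap g xs ?x y = (\<integral>w. ?v w * ?m (set_coord ?x (?v w) y) \<partial>K xs y) - cexp g xs y * cexp ?v xs y"
    if y: "y \<in> space \<Omega>" for y
  proof -
    interpret KP: prob_space "K xs y" by (rule K_props[OF sub(1) y])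
    let ?G = "\<lambda>w. ?m (set_coord ?x (?v w) y)"
    have in_\<Omega>: "set_coord ?x r y \<in> space \<Omega>" for r
      by (rule set_coord_in_space[OF xsx(2) y])
    have G_meas: "?G \<in> borel_measurable (K xs y)"
      unfolding measurable_K_iff[OF sub(1) y]
      by (rule measurable_cexp_set_coord[OF sub(2) xsx(2) g'(1) v'(1)]) (simp add: y)
    have v_meas: "?v \<in> borel_measurable (K xs y)"
      unfolding measurable_K_iff[OF sub(1) y] by (rule v'(1))
    have vG_meas: "(\<lambda>w. ?v w * ?G w) \<in> borel_measurable (K xs y)"
      using G_meas v_meas by measurable
    have int: "integrable (K xs y) ?G" "integrable (K xs y) ?v" "integrable (K xs y) (\<lambda>w. ?v w * ?G w)"
      using KP.integrable_bounded[OF G_meas m'(2)[OF in_\<Omega>]] KP.integrable_bounded[OF v_meas v'(2)]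
        KP.integrable_bounded[OF vG_meas vG_bd[OF y]]
      by (simp_all add: K_props[OF sub(1) y] del: coord.simps set_coord.simps)
    let ?A = "\<integral>w. ?v w * ?G w \<partial>K xs y" and ?p = "\<integral>w. ?v w \<partial>K xs y" and ?M = "\<integral>w. ?G w \<partial>K xs y"
    have le: "?m (set_coord ?x 0 y) \<le> ?m (set_coord ?x 1 y)"
      by (rule bdd_incr_step[OF xs g y y]) auto
    have "step_gap g xs ?x y = (\<integral>w. (\<integral>w'. ?v w * ?G w - ?v w * ?G w' - (?v w * ?G w) * ?v w' + ?v w * (?v w' * ?G w') \<partial>K xs y) \<partial>K xs y)"
      unfolding step_gap_def using le
      by (intro Bochner_Integration.integral_cong refl) (auto simp: max_def split: if_splits)
    also have "\<dots> = (\<integral>w. ?v w * ?G w - ?v w * ?M - (?v w * ?G w) * ?p + ?v w * ?A \<partial>K xs y)"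
      using int by (simp add: KP.prob_space del: coord.simps)
    also have "\<dots> = ?A - ?p * ?M - ?A * ?p + ?p * ?A"
      using int by (simp add: KP.prob_space del: coord.simps)
    also have "\<dots> = ?A - ?M * ?p"
      by (simp add: mult.commute del: coord.simps)
    finally show ?thesis
      by (simp only: cexp_tower[OF sub(1) xsx(2,3) y g'(1,2)] cexp_def[of ?v])
  qed
  have prod_meas: "(\<lambda>c. cexp g xs c * cexp ?v xs c) \<in> borel_measurable \<mu>"
    using pm(1,4) by measurable
  have int1: "integrable \<mu> (\<lambda>c. cexp g xs c * cexp ?v xs c)"
  proof (rule \<mu>.integrable_bounded[OF prod_meas])
    show "\<bar>cexp g xs c * cexp ?v xs c\<bar> \<le> C * 1" if "c \<in> space \<mu>" for c
      unfolding abs_mult using pm(2)[of c] pm(5)[of c] that by (intro mult_mono) auto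
  qed
  have int2: "integrable \<mu> (\<lambda>y. \<integral>w. ?v w * ?m (set_coord ?x (?v w) y) \<partial>K xs y)"
  proof (rule \<mu>.integrable_bounded)
    have "(\<lambda>y. \<integral>w. ?v w * ?m (set_coord ?x (?v w) y) \<partial>K xs y) \<in> borel_measurable \<Omega>"
    proof (rule measurable_integral_kernel[OF _ measurable_K[OF sub(1)]])
      have "(\<lambda>z. ?m (set_coord ?x (?v (snd z)) (fst z))) \<in> borel_measurable (\<Omega> \<Otimes>\<^sub>M \<Omega>)"
        by (intro measurable_cexp_set_coord[OF sub(2) xsx(2) g'(1)] measurable_compose[OF measurable_snd v'(1)] measurable_fst)
      moreover have "(\<lambda>z. ?v (snd z)) \<in> borel_measurable (\<Omega> \<Otimes>\<^sub>M \<Omega>)"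
        by (rule measurable_compose[OF measurable_snd v'(1)])
      ultimately show "(\<lambda>(y, w). ?v w * ?m (set_coord ?x (?v w) y)) \<in> borel_measurable (\<Omega> \<Otimes>\<^sub>M \<Omega>)"
        unfolding split_beta' by measurable
    qed
    then show "(\<lambda>y. \<integral>w. ?v w * ?m (set_coord ?x (?v w) y) \<partial>K xs y) \<in> borel_measurable \<mu>"
      by simp
    show "\<bar>\<integral>w. ?v w * ?m (set_coord ?x (?v w) y) \<partial>K xs y\<bar> \<le> C" if "y \<in> space \<mu>" for y
      using that by (intro integral_K_abs_le sub vG_bd) (simp_all only: space_\<mu>)
  qed
  have eq: "?v (set_coord ?x (?v w) y) = ?v w" for w y
    by simp
  have "(\<integral>y. (\<integral>w. ?v w * ?m (set_coord ?x (?v w) y) \<partial>K xs y) \<partial>\<mu>) = (\<integral>c. ?v c * ?m c \<partial>\<mu>)"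
    using integral_resample[OF sub(1) xsx(2) vm_meas _ vm_bd]
      depends_on_mult[OF depends_on_coord[of ?x "xs @ [?x]"] depends_on_cexp[of "xs @ [?x]" g]]
    unfolding eq by (simp del: coord.simps)
  also have "\<dots> = (\<integral>c. ?v c * g c \<partial>\<mu>)"
    by (rule integral_cexp[OF sub(2) v'(1) depends_on_coord v'(2) g'(1,2)]) auto
  finally have first: "(\<integral>y. (\<integral>w. ?v w * ?m (set_coord ?x (?v w) y) \<partial>K xs y) \<partial>\<mu>) = (\<integral>c. ?v c * g c \<partial>\<mu>)" .
  have "(\<integral>y. step_gap g xs ?x y \<partial>\<mu>) =
      (\<integral>y. (\<integral>w. ?v w * ?m (set_coord ?x (?v w) y) \<partial>K xs y) - cexp g xs y * cexp ?v xs y \<partial>\<mu>)"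
    by (intro Bochner_Integration.integral_cong) (simp_all only: space_\<mu> gap)
  also have "\<dots> = (\<integral>c. ?v c * g c \<partial>\<mu>) - (\<integral>c. cexp g xs c * cexp ?v xs c \<partial>\<mu>)"
    unfolding first[symmetric] by (rule Bochner_Integration.integral_diff[OF int2 int1])
  also have "\<dots> \<le> (\<integral>c. ?v c * g c \<partial>\<mu>) - (\<integral>c. g c \<partial>\<mu>) * (\<integral>c. ?v c \<partial>\<mu>)"
    using association_cexp[OF xsx(1) g v] by simp
  also have "\<dots> = covariance \<mu> g ?v"
    using \<mu>.covariance_eq[of g ?v C 1] g' v' by (simp add: mult.commute del: coord.simps)
  also have "?v = (\<lambda>c. of_bool (snd c e))"
    by (rule ext) simp
  finally show ?thesis .
qed

text \<open>The second draw is replaced by the least spin. What remains is that the mean of the conditional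
  expectation with \<open>z\<close> set to 0 is at least the mean of \<open>g\<close> given spin 0 at \<open>z\<close>: by consistency both
  average the same increasing function of \<open>xs\<close>, once over \<open>\<mu>\<close> and once over the smaller law given
  spin 0. The configuration \<open>c\<^sub>0\<close> only serves to express that conditioning.\<close>

lemma step_gap_vertex:
  assumes xs: "admissible_order E \<Lambda> (xs @ [Inl z])" and g: "bdd_incr C g" and c\<^sub>0: "c\<^sub>0 \<in> space \<Omega>"
  shows "(\<integral>y. step_gap g xs (Inl z) y \<partial>\<mu>) \<le> (\<integral>c. g c \<partial>\<mu>) - cexp g [Inl z] (set_coord (Inl z) 0 c\<^sub>0)"
proof -
  let ?x = "Inl z :: 'v elem"
  note xsx = admissible_order_snocD[OF xs]
  have sub: "set xs \<subseteq> \<X>" "set (xs @ [?x]) \<subseteq> \<X>" "set [?x] \<subseteq> \<X>"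
    using admissible_order_props[OF xs] by auto
  have adm_x: "admissible_order E \<Lambda> [?x]"
    using admissible_order.snoc[OF admissible_order.Nil xsx(2)] by simp
  let ?m = "cexp g (xs @ [?x])" and ?y\<^sub>0 = "\<lambda>y. set_coord ?x 0 y"
  note g' = bdd_incrD[OF g] and m' = bdd_incrD[OF bdd_incr_cexp[OF xs g]]
    and gx = bdd_incrD[OF bdd_incr_cexp[OF xsx(1) g]]
  have m0_meas: "(\<lambda>y. ?m (?y\<^sub>0 y)) \<in> borel_measurable \<Omega>"
    by (rule measurable_cexp_set_coord[OF sub(2) xsx(2) g'(1)]) auto
  have m0_bd: "\<bar>?m (?y\<^sub>0 y)\<bar> \<le> C" if "y \<in> space \<Omega>" for y
    using that by (intro m'(2) set_coord_in_space xsx(2))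
  have m0: "bdd_incr C (\<lambda>y. ?m (?y\<^sub>0 y))"
    unfolding bdd_incr_def using m0_meas m0_bd by (intro conjI ballI mono_onI bdd_incr_step[OF xs g]) simp_all
  have gap: "step_gap g xs ?x y \<le> cexp g xs y - ?m (?y\<^sub>0 y)" if y: "y \<in> space \<Omega>" for y
  proof -
    interpret KP: prob_space "K xs y" by (rule K_props[OF sub(1) y])
    let ?G = "\<lambda>w. ?m (set_coord ?x (coord ?x w) y)"
    have in_\<Omega>: "set_coord ?x r y \<in> space \<Omega>" for r
      by (rule set_coord_in_space[OF xsx(2) y])
    have low: "?m (?y\<^sub>0 y) \<le> ?m (set_coord ?x r y)" for r
    proof -
      have "?m (set_coord ?x 0 y) \<le> ?m (set_coord ?x (max 0 r) y)"
        by (rule bdd_incr_step[OF xs g y y]) auto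
      then show ?thesis by simp
    qed
    have G_meas: "?G \<in> borel_measurable (K xs y)"
      unfolding measurable_K_iff[OF sub(1) y]
      by (rule measurable_cexp_set_coord[OF sub(2) xsx(2) g'(1) measurable_coord_\<Omega>[OF xsx(2)]]) (simp add: y)
    have int: "integrable (K xs y) ?G"
      using m'(2)[OF in_\<Omega>] G_meas by (intro KP.integrable_bounded)
    have inner: "(\<integral>w'. max 0 (?G w - ?G w') \<partial>K xs y) \<le> ?G w - ?m (?y\<^sub>0 y)" for w
    proof -
      have "(\<integral>w'. max 0 (?G w - ?G w') \<partial>K xs y) \<le> (\<integral>w'. ?G w - ?m (?y\<^sub>0 y) \<partial>K xs y)"
      proof (rule integral_mono)
        show "integrable (K xs y) (\<lambda>w'. max 0 (?G w - ?G w'))"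
          using int by (intro integrable_max Bochner_Integration.integrable_diff integrable_zero KP.integrable_const)
        show "max 0 (?G w - ?G w') \<le> ?G w - ?m (?y\<^sub>0 y)" for w'
          using low by (simp del: set_coord.simps coord.simps)
      qed simp
      then show ?thesis by (simp add: KP.prob_space del: set_coord.simps coord.simps)
    qed
    have "step_gap g xs ?x y \<le> (\<integral>w. ?G w - ?m (?y\<^sub>0 y) \<partial>K xs y)"
    proof (cases "integrable (K xs y) (\<lambda>w. \<integral>w'. max 0 (?G w - ?G w') \<partial>K xs y)")
      case True
      then show ?thesis
        unfolding step_gap_def using int inner by (intro integral_mono) auto
    next
      case False
      then have "step_gap g xs ?x y = 0"
        unfolding step_gap_def by (rule not_integrable_integral_eq)
      also have "0 \<le> (\<integral>w. ?G w - ?m (?y\<^sub>0 y) \<partial>K xs y)"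
        using low by (intro integral_nonneg_AE AE_I2) (simp del: set_coord.simps coord.simps)
      finally show ?thesis .
    qed
    also have "\<dots> = (\<integral>w. ?G w \<partial>K xs y) - ?m (?y\<^sub>0 y)"
      using int by (simp add: KP.prob_space del: set_coord.simps coord.simps)
    finally show ?thesis
      by (simp only: cexp_tower[OF sub(1) xsx(2,3) y g'(1,2)])
  qed
  have int_m0: "integrable \<mu> (\<lambda>y. ?m (?y\<^sub>0 y))"
    using m0_meas m0_bd by (intro \<mu>.integrable_bounded) simp_all
  have int_g: "integrable \<mu> (cexp g xs)"
    using gx by (intro \<mu>.integrable_bounded) simp_all
  have "(\<integral>y. step_gap g xs ?x y \<partial>\<mu>) \<le> (\<integral>y. cexp g xs y - ?m (?y\<^sub>0 y) \<partial>\<mu>)"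
  proof (cases "integrable \<mu> (step_gap g xs ?x)")
    case True
    then show ?thesis
      using gap int_m0 int_g by (intro integral_mono) auto
  next
    case False
    have "0 \<le> step_gap g xs ?x y" for y
      unfolding step_gap_def by (intro integral_nonneg_AE AE_I2) simp
    then have "0 \<le> cexp g xs y - ?m (?y\<^sub>0 y)" if "y \<in> space \<Omega>" for y
      using gap[OF that] by (rule order_trans)
    then have "0 \<le> (\<integral>y. cexp g xs y - ?m (?y\<^sub>0 y) \<partial>\<mu>)"
      by (intro integral_nonneg_AE AE_I2) (simp only: space_\<mu>)
    then show ?thesis
      by (simp only: not_integrable_integral_eq[OF False])
  qed
  also have "\<dots> = (\<integral>c. g c \<partial>\<mu>) - (\<integral>y. ?m (?y\<^sub>0 y) \<partial>\<mu>)"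
    using int_m0 int_g integral_cexp_1[OF sub(1) g'(1,2)] by (simp del: set_coord.simps)
  also have "\<dots> \<le> (\<integral>c. g c \<partial>\<mu>) - cexp g [?x] (?y\<^sub>0 c\<^sub>0)"
  proof -
    have "cexp g [?x] (?y\<^sub>0 c\<^sub>0) = cexp (\<lambda>y. ?m (?y\<^sub>0 y)) [?x] (?y\<^sub>0 c\<^sub>0)"
      unfolding cexp_def by (rule integral_zero_tower[OF sub(1) xsx(2,3) c\<^sub>0 g'(1,2)])
    also have "\<dots> \<le> (\<integral>y. cexp (\<lambda>y. ?m (?y\<^sub>0 y)) [?x] y \<partial>\<mu>)"
    proof -
      note mm = bdd_incrD[OF bdd_incr_cexp[OF adm_x m0]]
      have "(\<integral>y. cexp (\<lambda>y. ?m (?y\<^sub>0 y)) [?x] (?y\<^sub>0 c\<^sub>0) \<partial>\<mu>) \<le> (\<integral>y. cexp (\<lambda>y. ?m (?y\<^sub>0 y)) [?x] y \<partial>\<mu>)"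
      proof (rule integral_mono)
        show "integrable \<mu> (cexp (\<lambda>y. ?m (?y\<^sub>0 y)) [?x])"
          using mm by (intro \<mu>.integrable_bounded) simp_all
        fix y assume "y \<in> space \<mu>"
        then have y: "y \<in> space \<Omega>" by simp
        have "cexp (\<lambda>y. ?m (?y\<^sub>0 y)) [?x] (?y\<^sub>0 c\<^sub>0) = cexp (\<lambda>y. ?m (?y\<^sub>0 y)) [?x] (?y\<^sub>0 y)"
          by (rule cexp_cong) (auto simp: proj_eq_iff verts_of_def edges_of_def)
        also have "\<dots> \<le> cexp (\<lambda>y. ?m (?y\<^sub>0 y)) [?x] (set_coord ?x (coord ?x y) y)"
          using y xsx(2)
          by (intro mm(3) set_coord_in_space set_coord_mono order.refl)
             (auto simp: space_cfg_space \<X>_def PiE_iff)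
        finally show "cexp (\<lambda>y. ?m (?y\<^sub>0 y)) [?x] (?y\<^sub>0 c\<^sub>0) \<le> cexp (\<lambda>y. ?m (?y\<^sub>0 y)) [?x] y"
          unfolding set_coord_coord_\<Omega>[OF xsx(2) y] .
      qed simp
      then show ?thesis by simp
    qed
    also have "\<dots> = (\<integral>y. ?m (?y\<^sub>0 y) \<partial>\<mu>)"
      by (rule integral_cexp_1[OF sub(3) m0_meas m0_bd])
    finally show ?thesis by simp
  qed
  finally show ?thesis .
qed

end

section \<open>Running a decision tree\<close>

locale tree_model = monotonic_model +
  fixes f :: "('a set \<Rightarrow> bool) \<Rightarrow> real" and T :: "'a dtree"
  assumes f: "increasing_edge_fun (incident_edges E \<Lambda>) f"
    and tree: "decision_tree E \<Lambda> T"
    and adm: "admissible E \<Lambda> T"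
begin

abbreviation F :: "'a cfg \<Rightarrow> real" where "F c \<equiv> f (snd c)"

abbreviation "n \<equiv> card \<X>"

lemma snd_\<Omega>: "c \<in> space \<Omega> \<Longrightarrow> snd c \<in> edge_cfgs \<E>"
  by (simp add: space_cfg_space)

lemma f_range: "c \<in> space \<Omega> \<Longrightarrow> 0 \<le> F c \<and> F c \<le> 1"
  using f snd_\<Omega>[of c] by (auto simp: increasing_edge_fun_def Pi_iff)

lemma bdd_incr_f: "bdd_incr 1 F"
  unfolding bdd_incr_def
proof (intro conjI ballI mono_onI)
  show "F \<in> borel_measurable \<Omega>"
    by (rule measurable_edge_fun[OF finite_\<E>])
  show "\<bar>F c\<bar> \<le> 1" if "c \<in> space \<Omega>" for c
    using f_range[OF that] by simp
  show "F c \<le> F c'" if "c \<in> space \<Omega>" "c' \<in> space \<Omega>" "c \<le> c'" for c c'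
    using f that snd_\<Omega>[of c] snd_\<Omega>[of c'] unfolding increasing_edge_fun_def mono_on_def less_eq_prod_def by blast
qed

lemmas f_bdd = bdd_incrD[OF bdd_incr_f]

definition next_elem :: "'a elem list \<Rightarrow> 'a cfg \<Rightarrow> 'a elem" where
  "next_elem xs c = (if xs = [] then fst T else snd T (Suc (length xs)) xs (proj xs c))"

lemma length_revealed [simp]: "length (revealed T c t) = t"
  by (induction T c t rule: revealed.induct) (auto simp: Let_def)

lemma revealed_Suc: "revealed T c (Suc t) = revealed T c t @ [next_elem (revealed T c t) c]"
proof (cases t)
  case (Suc s)
  have "revealed T c (Suc s) \<noteq> []"
    using length_revealed[of c "Suc s"] by (metis list.size(3) nat.distinct(1))
  then show ?thesis
    by (simp add: Suc Let_def next_elem_def proj_def)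
qed (simp add: next_elem_def)

declare revealed.simps(2,3) [simp del]

lemma next_elem_cong: "proj xs c = proj xs c' \<Longrightarrow> next_elem xs c = next_elem xs c'"
  by (simp add: next_elem_def)

lemma measurable_next_elem:
  assumes xs: "set xs \<subseteq> \<X>" "distinct xs" "length xs < n"
  shows "next_elem xs \<in> \<Omega> \<rightarrow>\<^sub>M count_space (\<X> - set xs)"
proof (cases "xs = []")
  case True
  then show ?thesis
    using tree by (auto simp: next_elem_def[abs_def] decision_tree_def split: prod.splits)
next
  case False
  then have "snd T (Suc (length xs)) xs \<in> cfg_space (verts_of xs) (edges_of xs) \<rightarrow>\<^sub>M count_space (\<X> - set xs)"
    using tree xs unfolding decision_tree_def
    by (cases T) (auto dest!: bspec[where x="Suc (length xs)"] simp: Suc_le_eq)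
  from measurable_compose[OF measurable_proj[OF xs(1)] this] show ?thesis
    using False by (simp add: next_elem_def[abs_def])
qed

lemma next_elem_in: "set xs \<subseteq> \<X> \<Longrightarrow> distinct xs \<Longrightarrow> length xs < n \<Longrightarrow> c \<in> space \<Omega> \<Longrightarrow> next_elem xs c \<in> \<X> - set xs"
  using measurable_space[OF measurable_next_elem] by simp

lemma revealed_admissible:
  assumes c: "c \<in> space \<Omega>" and "t \<le> n"
  shows "admissible_order E \<Lambda> (revealed T c t)"
  using assms(2)
proof (induction t)
  case 0
  then show ?case by (simp add: admissible_order.Nil)
next
  case (Suc t)
  let ?xs = "revealed T c t"
  have xs: "admissible_order E \<Lambda> ?xs" using Suc by simp
  have x: "next_elem ?xs c \<in> \<X> - set ?xs"
    using admissible_order_props[OF xs] Suc.prems c by (intro next_elem_in) auto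
  show ?case
    unfolding revealed_Suc
  proof (rule admissible_order.snoc[OF xs])
    fix e assume "next_elem ?xs c = Inr e"
    then show "e \<inter> \<Lambda> \<subseteq> verts_of ?xs"
      using adm[unfolded admissible_def, rule_format, OF c, of "Suc t" e] Suc.prems by (simp add: revealed_Suc)
  qed (use x in auto)
qed

lemma revealed_cong:
  "proj (revealed T c t) c = proj (revealed T c t) c' \<Longrightarrow> revealed T c' t = revealed T c t"
proof (induction t)
  case (Suc t)
  have "proj (revealed T c t) c = proj (revealed T c t) c'"
    using Suc.prems unfolding revealed_Suc by (rule proj_snocD)
  from Suc.IH[OF this] next_elem_cong[OF this] show ?case
    by (simp add: revealed_Suc)
qed simp

text \<open>The stopping rule: the revealed edges determine the value of \<open>f\<close>.\<close>

definition determined :: "'a elem list \<Rightarrow> 'a cfg \<Rightarrow> bool" where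
  "determined xs c \<longleftrightarrow> (\<forall>\<omega>'\<in>edge_cfgs \<E>.
     restrict \<omega>' (edges_of xs) = restrict (snd c) (edges_of xs) \<longrightarrow> f \<omega>' = f (snd c))"

lemma restrict_snd_cong: "proj xs c = proj xs c' \<Longrightarrow> restrict (snd c) (edges_of xs) = restrict (snd c') (edges_of xs)"
  by (simp add: proj_def restrict_cfg_def)

lemma determined_f_cong: "determined xs c \<Longrightarrow> proj xs c = proj xs c' \<Longrightarrow> c' \<in> space \<Omega> \<Longrightarrow> F c' = F c"
  unfolding determined_def using restrict_snd_cong[of xs c c'] snd_\<Omega>[of c'] by auto

lemma determined_cong:
  assumes "c \<in> space \<Omega>" "c' \<in> space \<Omega>" "proj xs c = proj xs c'"
  shows "determined xs c \<longleftrightarrow> determined xs c'"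
proof -
  have *: "determined xs d'" if "determined xs d" "d \<in> space \<Omega>" "d' \<in> space \<Omega>" "proj xs d = proj xs d'" for d d'
    using determined_f_cong[OF that(1,4,3)] that(1) restrict_snd_cong[OF that(4)] by (simp add: determined_def)
  show ?thesis
    using *[OF _ assms] *[OF _ assms(2,1) assms(3)[symmetric]] by blast
qed

lemma measurable_determined: "Measurable.pred \<Omega> (determined xs)"
proof -
  define d :: "('a set \<Rightarrow> bool) \<Rightarrow> real" where "d \<omega> = of_bool (\<forall>\<omega>'\<in>edge_cfgs \<E>.
     restrict \<omega>' (edges_of xs) = restrict \<omega> (edges_of xs) \<longrightarrow> f \<omega>' = f \<omega>)" for \<omega>
  have [measurable]: "(\<lambda>c. d (snd c)) \<in> borel_measurable \<Omega>"
    by (rule measurable_edge_fun[OF finite_\<E>])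
  have "determined xs = (\<lambda>c. d (snd c) = 1)"
    by (auto simp: fun_eq_iff determined_def d_def)
  then show ?thesis by simp
qed

lemma full_list:
  assumes "set xs \<subseteq> \<X>" "distinct xs" "length xs = n"
  shows "set xs = \<X>"
  using assms finite_\<X> by (intro card_subset_eq) (auto simp: distinct_card)

lemma determined_full:
  assumes "set xs \<subseteq> \<X>" "distinct xs" "length xs = n" "c \<in> space \<Omega>"
  shows "determined xs c"
proof -
  have "edges_of xs = \<E>"
    using full_list[OF assms(1-3)] by (auto simp: edges_of_def \<X>_def)
  then show ?thesis
    using snd_\<Omega>[OF assms(4)] by (auto simp: determined_def edge_cfgs_def dest!: PiE_restrict)
qed

section \<open>The quantile coupling\<close>

text \<open>The common uniform variable \<open>u\<close> draws the element \<open>x\<close> of every configuration \<open>c\<close> at once, each from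
  its own conditional law given \<open>xs\<close>.\<close>

definition resample :: "'a elem list \<Rightarrow> 'a elem \<Rightarrow> real \<Rightarrow> 'a cfg \<Rightarrow> 'a cfg" where
  "resample xs x u c = set_coord x (quantile (K xs c) (coord x) u) c"

lemma measurable_resample:
  assumes "set xs \<subseteq> \<X>" "x \<in> \<X>" "c \<in> M \<rightarrow>\<^sub>M \<Omega>" "u \<in> M \<rightarrow>\<^sub>M unit_law"
  shows "(\<lambda>w. resample xs x (u w) (c w)) \<in> M \<rightarrow>\<^sub>M \<Omega>"
  unfolding resample_def
proof (rule measurable_set_coord_\<Omega>[OF assms(2) _ assms(3)])
  have "(\<lambda>w. (c w, u w)) \<in> M \<rightarrow>\<^sub>M \<Omega> \<Otimes>\<^sub>M unit_law"
    using assms by measurable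
  from measurable_compose[OF this measurable_quantile[OF measurable_K[OF assms(1)] measurable_coord_\<Omega>[OF assms(2)]]]
  show "(\<lambda>w. quantile (K xs (c w)) (coord x) (u w)) \<in> borel_measurable M"
    by simp
qed

lemma resample_in_space: "x \<in> \<X> \<Longrightarrow> c \<in> space \<Omega> \<Longrightarrow> resample xs x u c \<in> space \<Omega>"
  unfolding resample_def by (rule set_coord_in_space)

lemma proj_resample:
  assumes "proj xs c = proj xs c'"
  shows "proj (xs @ [x]) (resample xs x u c) = proj (xs @ [x]) (resample xs x u c')"
  unfolding resample_def K_cong[OF assms] by (rule proj_set_coord[OF assms])

lemma proj_resample_fresh: "x \<notin> set xs \<Longrightarrow> proj xs (resample xs x u c) = proj xs c"
  unfolding resample_def by (rule proj_set_coord_fresh)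

lemma integral_resample_unit:
  fixes h :: "'a cfg \<Rightarrow> real"
  assumes xs: "set xs \<subseteq> \<X>" and x: "x \<in> \<X>" and c: "c \<in> space \<Omega>" and y: "y \<in> space \<Omega>"
    and h: "h \<in> borel_measurable \<Omega>"
  shows "(\<integral>u. h (set_coord x (quantile (K xs c) (coord x) u) y) \<partial>unit_law) = (\<integral>w. h (set_coord x (coord x w) y) \<partial>K xs c)"
proof (rule prob_space.integral_quantile[OF K_props(1)[OF xs c]])
  show "coord x \<in> borel_measurable (K xs c)"
    unfolding measurable_K_iff[OF xs c] by (rule measurable_coord_\<Omega>[OF x])
  show "(\<lambda>r. h (set_coord x r y)) \<in> borel_measurable borel"
    using y by (intro measurable_compose[OF measurable_set_coord_\<Omega>[OF x] h]) auto
qed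

lemma integral_resample_eq:
  fixes h :: "'a cfg \<Rightarrow> real"
  assumes xs: "set xs \<subseteq> \<X>" and x: "x \<in> \<X>" and c: "c \<in> space \<Omega>"
    and h: "h \<in> borel_measurable \<Omega>"
  shows "(\<integral>u. h (resample xs x u c) \<partial>unit_law) = (\<integral>w. h (set_coord x (coord x w) c) \<partial>K xs c)"
  unfolding resample_def by (rule integral_resample_unit[OF xs x c c h])

text \<open>This is where weak monotonicity produces a monotone coupling: the law of a single coordinate is
  compared through the increasing indicators of exceeding a level.\<close>

lemma resample_mono:
  assumes xs: "admissible_order E \<Lambda> xs" and x: "x \<in> \<X>"
    and c: "c \<in> space \<Omega>" "c' \<in> space \<Omega>" "c \<le> c'" and u: "0 < u" "u < 1"
  shows "resample xs x u c \<le> resample xs x u c'"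
  unfolding resample_def
proof (rule set_coord_mono[OF _ c(3)])
  have sub: "set xs \<subseteq> \<X>" using admissible_order_props[OF xs] by simp
  note cm[measurable] = measurable_coord_\<Omega>[OF x]
  show "quantile (K xs c) (coord x) u \<le> quantile (K xs c') (coord x) u"
  proof (rule quantile_mono[OF K_props(1)[OF sub c(1)] K_props(1)[OF sub c(2)] _ _ _ u])
    show "coord x \<in> borel_measurable (K xs c)" "coord x \<in> borel_measurable (K xs c')"
      unfolding measurable_K_iff[OF sub c(1)] measurable_K_iff[OF sub c(2)] by (rule cm)+
    fix r
    let ?h = "\<lambda>w. of_bool (r < coord x w) :: real"
    have eq: "measure (K xs d) {w \<in> space (K xs d). coord x w \<le> r} = 1 - (\<integral>w. ?h w \<partial>K xs d)"
      if d: "d \<in> space \<Omega>" for d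
    proof -
      interpret KP: prob_space "K xs d" by (rule K_props[OF sub d])
      have A: "{w \<in> space (K xs d). r < coord x w} \<in> sets (K xs d)"
        by (simp add: K_props[OF sub d])
      have "(\<integral>w. ?h w \<partial>K xs d) = (\<integral>w. indicator {w \<in> space (K xs d). r < coord x w} w \<partial>K xs d)"
        by (intro Bochner_Integration.integral_cong refl) (simp add: indicator_def)
      also have "\<dots> = measure (K xs d) {w \<in> space (K xs d). r < coord x w}"
        using A by simp
      also have "\<dots> = 1 - measure (K xs d) (space (K xs d) - {w \<in> space (K xs d). r < coord x w})"
        using KP.prob_compl[OF A] by simp
      also have "space (K xs d) - {w \<in> space (K xs d). r < coord x w} = {w \<in> space (K xs d). coord x w \<le> r}"
        by auto
      finally show ?thesis by simp
    qed
    have "(\<integral>w. ?h w \<partial>K xs c) \<le> (\<integral>w. ?h w \<partial>K xs c')"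
    proof (rule integral_K_mono[OF xs c])
      show "?h \<in> borel_measurable \<Omega>" by measurable
      show "mono_on (space \<Omega>) ?h"
      proof (rule mono_onI)
        show "?h w \<le> ?h w'" if "w \<le> w'" for w w'
          using coord_mono[OF that, of x] by (simp add: of_bool_def)
      qed
      show "\<bar>?h w\<bar> \<le> 1" for w by simp
    qed
    then show "measure (K xs c') {w \<in> space (K xs c'). coord x w \<le> r}
        \<le> measure (K xs c) {w \<in> space (K xs c). coord x w \<le> r}"
      unfolding eq[OF c(1)] eq[OF c(2)] by simp
  qed
qed

lemma revealed_resample:
  assumes "revealed T c (length xs) = xs" "set xs \<subseteq> \<X>" "distinct xs" "length xs < n" "c \<in> space \<Omega>"
  shows "revealed T (resample xs (next_elem xs c) u c) (length (xs @ [next_elem xs c])) = xs @ [next_elem xs c]"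
proof -
  let ?c = "resample xs (next_elem xs c) u c"
  have p: "proj xs c = proj xs ?c"
    using next_elem_in[OF assms(2-5)] by (intro proj_resample_fresh[symmetric]) auto
  have "revealed T ?c (length xs) = xs"
    using revealed_cong[of c "length xs" ?c] p by (simp add: assms(1))
  then show ?thesis
    using next_elem_cong[OF p] by (simp add: revealed_Suc)
qed

section \<open>Backward recursion along the tree\<close>

text \<open>With \<open>c\<close> and \<open>y\<close> the states of \<open>xs\<close> in the two configurations, this is the conditional expectation
  of the final reward \<open>b\<close> plus the costs \<open>g\<close> of the elements revealed later, when both
  configurations are continued with common uniform variables. The tree follows \<open>c\<close> and stops once \<open>f\<close>
  is determined. In use, \<open>k\<close> is the number of elements that are still hidden.\<close>

primrec coupled :: "('a elem \<Rightarrow> real) \<Rightarrow> ('a elem list \<Rightarrow> 'a cfg \<Rightarrow> 'a cfg \<Rightarrow> real) \<Rightarrow>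
    nat \<Rightarrow> 'a elem list \<Rightarrow> 'a cfg \<Rightarrow> 'a cfg \<Rightarrow> real" where
  "coupled g b 0 xs c y = b xs c y"
| "coupled g b (Suc k) xs c y =
    (if determined xs c then b xs c y
     else g (next_elem xs c) + (\<integral>u. coupled g b k (xs @ [next_elem xs c])
            (resample xs (next_elem xs c) u c) (resample xs (next_elem xs c) u y) \<partial>unit_law))"

text \<open>The same total along the tree for a fixed configuration, without resampling.\<close>

primrec pathwise :: "('a elem \<Rightarrow> real) \<Rightarrow> ('a elem list \<Rightarrow> 'a cfg \<Rightarrow> real) \<Rightarrow>
    nat \<Rightarrow> 'a elem list \<Rightarrow> 'a cfg \<Rightarrow> real" where
  "pathwise g b 0 xs c = b xs c"
| "pathwise g b (Suc k) xs c =
    (if determined xs c then b xs c else g (next_elem xs c) + pathwise g b k (xs @ [next_elem xs c]) c)"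

sublocale unit: prob_space unit_law
  by (rule prob_space_unit_law)

lemma coupled_measurable:
  assumes b: "\<And>xs. set xs \<subseteq> \<X> \<Longrightarrow> (\<lambda>z. b xs (fst z) (snd z)) \<in> borel_measurable (\<Omega> \<Otimes>\<^sub>M \<Omega>)"
  shows "set xs \<subseteq> \<X> \<Longrightarrow> distinct xs \<Longrightarrow> length xs + k = n \<Longrightarrow>
    (\<lambda>z. coupled g b k xs (fst z) (snd z)) \<in> borel_measurable (\<Omega> \<Otimes>\<^sub>M \<Omega>)"
proof (induction k arbitrary: xs)
  case 0
  then show ?case using b by simp
next
  case (Suc k)
  let ?H = "\<lambda>x z. g x + (\<integral>u. coupled g b k (xs @ [x]) (resample xs x u (fst z)) (resample xs x u (snd z)) \<partial>unit_law)"
  have nx: "(\<lambda>z. next_elem xs (fst z)) \<in> \<Omega> \<Otimes>\<^sub>M \<Omega> \<rightarrow>\<^sub>M count_space (\<X> - set xs)"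
    using Suc.prems by (intro measurable_compose[OF measurable_fst measurable_next_elem]) auto
  have H: "?H x \<in> borel_measurable (\<Omega> \<Otimes>\<^sub>M \<Omega>)" if x: "x \<in> \<X> - set xs" for x
  proof -
    have IH: "(\<lambda>z. coupled g b k (xs @ [x]) (fst z) (snd z)) \<in> borel_measurable (\<Omega> \<Otimes>\<^sub>M \<Omega>)"
      using Suc.prems x by (intro Suc.IH) auto
    have "(\<lambda>z. resample xs x (snd z) (fst (fst z))) \<in> (\<Omega> \<Otimes>\<^sub>M \<Omega>) \<Otimes>\<^sub>M unit_law \<rightarrow>\<^sub>M \<Omega>"
      "(\<lambda>z. resample xs x (snd z) (snd (fst z))) \<in> (\<Omega> \<Otimes>\<^sub>M \<Omega>) \<Otimes>\<^sub>M unit_law \<rightarrow>\<^sub>M \<Omega>"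
      using Suc.prems x by (intro measurable_resample; simp)+
    from measurable_compose[OF measurable_Pair[OF this] IH]
    have "(\<lambda>(z, u). coupled g b k (xs @ [x]) (resample xs x u (fst z)) (resample xs x u (snd z)))
        \<in> borel_measurable ((\<Omega> \<Otimes>\<^sub>M \<Omega>) \<Otimes>\<^sub>M unit_law)"
      by (simp add: split_beta')
    from unit.borel_measurable_lebesgue_integral[OF this] show ?thesis
      by simp
  qed
  have [measurable]: "(\<lambda>z. ?H (next_elem xs (fst z)) z) \<in> borel_measurable (\<Omega> \<Otimes>\<^sub>M \<Omega>)"
    by (rule measurable_compose_countable'[OF H nx]) (use finite_\<X> in \<open>auto intro: countable_finite\<close>)
  have [measurable]: "Measurable.pred (\<Omega> \<Otimes>\<^sub>M \<Omega>) (\<lambda>z. determined xs (fst z))"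
    by (rule measurable_compose[OF measurable_fst measurable_determined])
  have [measurable]: "(\<lambda>z. b xs (fst z) (snd z)) \<in> borel_measurable (\<Omega> \<Otimes>\<^sub>M \<Omega>)"
    using b Suc.prems by auto
  show ?case
    unfolding coupled.simps by measurable
qed

lemma coupled_bound:
  assumes b: "\<And>xs c y. set xs \<subseteq> \<X> \<Longrightarrow> c \<in> space \<Omega> \<Longrightarrow> y \<in> space \<Omega> \<Longrightarrow> \<bar>b xs c y\<bar> \<le> C"
    and g: "\<And>x. x \<in> \<X> \<Longrightarrow> \<bar>g x\<bar> \<le> D" and D: "0 \<le> D"
  shows "set xs \<subseteq> \<X> \<Longrightarrow> distinct xs \<Longrightarrow> length xs + k = n \<Longrightarrow> c \<in> space \<Omega> \<Longrightarrow> y \<in> space \<Omega> \<Longrightarrow>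
    \<bar>coupled g b k xs c y\<bar> \<le> C + real k * D"
proof (induction k arbitrary: xs c y)
  case 0
  then show ?case using b by simp
next
  case (Suc k)
  let ?x = "next_elem xs c"
  have x: "?x \<in> \<X> - set xs"
    using Suc.prems by (intro next_elem_in) auto
  have "\<bar>\<integral>u. coupled g b k (xs @ [?x]) (resample xs ?x u c) (resample xs ?x u y) \<partial>unit_law\<bar> \<le> C + real k * D"
    using Suc.prems x by (intro unit.abs_integral_le Suc.IH resample_in_space) auto
  moreover have "\<bar>g ?x\<bar> \<le> D" "\<bar>b xs c y\<bar> \<le> C"
    using x g b Suc.prems by auto
  moreover have "0 \<le> real k * D" "real (Suc k) * D = real k * D + D"
    using D by (simp_all add: distrib_right)
  ultimately show ?case
    using D unfolding coupled.simps by (simp only: split: if_split) linarith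
qed

lemma coupled_cong:
  assumes b: "\<And>xs c c' y y'. set xs \<subseteq> \<X> \<Longrightarrow> c \<in> space \<Omega> \<Longrightarrow> c' \<in> space \<Omega> \<Longrightarrow> y \<in> space \<Omega> \<Longrightarrow> y' \<in> space \<Omega> \<Longrightarrow>
      determined xs c \<Longrightarrow> proj xs c = proj xs c' \<Longrightarrow> proj xs y = proj xs y' \<Longrightarrow> b xs c y = b xs c' y'"
  shows "set xs \<subseteq> \<X> \<Longrightarrow> distinct xs \<Longrightarrow> length xs + k = n \<Longrightarrow>
    c \<in> space \<Omega> \<Longrightarrow> c' \<in> space \<Omega> \<Longrightarrow> y \<in> space \<Omega> \<Longrightarrow> y' \<in> space \<Omega> \<Longrightarrow>
    proj xs c = proj xs c' \<Longrightarrow> proj xs y = proj xs y' \<Longrightarrow> coupled g b k xs c y = coupled g b k xs c' y'"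
proof (induction k arbitrary: xs c c' y y')
  case 0
  then show ?case using b[of xs c c' y y'] determined_full[of xs c] by simp
next
  case (Suc k)
  let ?x = "next_elem xs c"
  have x: "?x \<in> \<X> - set xs"
    using Suc.prems by (intro next_elem_in) auto
  have x': "next_elem xs c' = ?x"
    by (rule next_elem_cong[OF Suc.prems(8)[symmetric]])
  have d: "determined xs c \<longleftrightarrow> determined xs c'"
    by (rule determined_cong[OF Suc.prems(4,5,8)])
  have "coupled g b k (xs @ [?x]) (resample xs ?x u c) (resample xs ?x u y)
      = coupled g b k (xs @ [?x]) (resample xs ?x u c') (resample xs ?x u y')" for u
    using Suc.prems(1-3) x
    by (intro Suc.IH resample_in_space proj_resample Suc.prems(4-9)) auto
  then show ?case
    using b[OF Suc.prems(1,4-7) _ Suc.prems(8,9)] d by (simp add: x')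
qed

lemma depends_on_snoc: "depends_on xs h \<Longrightarrow> depends_on (xs @ [x]) h"
  by (rule depends_onI, erule depends_onD, erule proj_snocD)

lemma pathwise_measurable:
  assumes b: "\<And>xs. set xs \<subseteq> \<X> \<Longrightarrow> b xs \<in> borel_measurable \<Omega>"
  shows "set xs \<subseteq> \<X> \<Longrightarrow> distinct xs \<Longrightarrow> length xs + k = n \<Longrightarrow> pathwise g b k xs \<in> borel_measurable \<Omega>"
proof (induction k arbitrary: xs)
  case 0
  then show ?case using b by (simp add: ext[of "pathwise g b 0 xs", OF pathwise.simps(1)])
next
  case (Suc k)
  have H: "(\<lambda>c. g x + pathwise g b k (xs @ [x]) c) \<in> borel_measurable \<Omega>" if "x \<in> \<X> - set xs" for x
    using Suc.IH[of "xs @ [x]"] Suc.prems that by (intro borel_measurable_add borel_measurable_const) auto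
  have nx: "next_elem xs \<in> \<Omega> \<rightarrow>\<^sub>M count_space (\<X> - set xs)"
    using Suc.prems by (intro measurable_next_elem) auto
  have [measurable]: "(\<lambda>c. g (next_elem xs c) + pathwise g b k (xs @ [next_elem xs c]) c) \<in> borel_measurable \<Omega>"
    by (rule measurable_compose_countable'[OF H nx]) (use finite_\<X> in \<open>auto intro: countable_finite\<close>)
  note [measurable] = measurable_determined b[OF Suc.prems(1)]
  have "(\<lambda>c. if determined xs c then b xs c else g (next_elem xs c) + pathwise g b k (xs @ [next_elem xs c]) c) \<in> borel_measurable \<Omega>"
    by measurable
  then show ?case
    by (simp add: ext[of "pathwise g b (Suc k) xs", OF pathwise.simps(2)])
qed

lemma pathwise_bound:
  assumes b: "\<And>xs c. set xs \<subseteq> \<X> \<Longrightarrow> c \<in> space \<Omega> \<Longrightarrow> \<bar>b xs c\<bar> \<le> C"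
    and g: "\<And>x. x \<in> \<X> \<Longrightarrow> \<bar>g x\<bar> \<le> D" and D: "0 \<le> D"
  shows "set xs \<subseteq> \<X> \<Longrightarrow> distinct xs \<Longrightarrow> length xs + k = n \<Longrightarrow> c \<in> space \<Omega> \<Longrightarrow>
    \<bar>pathwise g b k xs c\<bar> \<le> C + real k * D"
proof (induction k arbitrary: xs)
  case 0
  then show ?case using b by simp
next
  case (Suc k)
  let ?x = "next_elem xs c"
  have x: "?x \<in> \<X> - set xs"
    using Suc.prems by (intro next_elem_in) auto
  have "\<bar>pathwise g b k (xs @ [?x]) c\<bar> \<le> C + real k * D"
    using Suc.prems x by (intro Suc.IH) auto
  moreover have "\<bar>g ?x\<bar> \<le> D" "\<bar>b xs c\<bar> \<le> C"
    using x g b Suc.prems by auto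
  moreover have "0 \<le> real k * D" "real (Suc k) * D = real k * D + D"
    using D by (simp_all add: distrib_right)
  ultimately show ?case
    using D unfolding pathwise.simps by (simp only: split: if_split) linarith
qed

text \<open>Two configurations that start equal stay equal, and each step of the recursion then is a
  conditional expectation under \<open>\<mu>\<close>; so the mean of the recursion is the mean of the pathwise
  total. The weight \<open>\<phi>\<close> localises the induction to the event that a particular element comes next, and
  \<open>b\<close> may be replaced by any \<open>b'\<close> that has the same conditional mean where the tree stops.\<close>

lemma integral_coupled_diagonal:
  assumes b_meas: "\<And>xs. set xs \<subseteq> \<X> \<Longrightarrow> (\<lambda>z. b xs (fst z) (snd z)) \<in> borel_measurable (\<Omega> \<Otimes>\<^sub>M \<Omega>)"
    and b_bd: "\<And>xs c y. set xs \<subseteq> \<X> \<Longrightarrow> c \<in> space \<Omega> \<Longrightarrow> y \<in> space \<Omega> \<Longrightarrow> \<bar>b xs c y\<bar> \<le> C"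
    and b_cong: "\<And>xs c c' y y'. set xs \<subseteq> \<X> \<Longrightarrow> c \<in> space \<Omega> \<Longrightarrow> c' \<in> space \<Omega> \<Longrightarrow> y \<in> space \<Omega> \<Longrightarrow> y' \<in> space \<Omega> \<Longrightarrow>
      determined xs c \<Longrightarrow> proj xs c = proj xs c' \<Longrightarrow> proj xs y = proj xs y' \<Longrightarrow> b xs c y = b xs c' y'"
    and b'_meas: "\<And>xs. set xs \<subseteq> \<X> \<Longrightarrow> b' xs \<in> borel_measurable \<Omega>"
    and b'_bd: "\<And>xs c. set xs \<subseteq> \<X> \<Longrightarrow> c \<in> space \<Omega> \<Longrightarrow> \<bar>b' xs c\<bar> \<le> C"
    and g: "\<And>x. x \<in> \<X> \<Longrightarrow> \<bar>g x\<bar> \<le> D" and D: "0 \<le> D"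
    and eq: "\<And>xs \<phi>. set xs \<subseteq> \<X> \<Longrightarrow> \<phi> \<in> borel_measurable \<Omega> \<Longrightarrow> depends_on xs \<phi> \<Longrightarrow>
      (\<And>c. c \<in> space \<Omega> \<Longrightarrow> \<bar>\<phi> c\<bar> \<le> 1) \<Longrightarrow> (\<And>c. c \<in> space \<Omega> \<Longrightarrow> \<not> determined xs c \<Longrightarrow> \<phi> c = 0) \<Longrightarrow>
      (\<integral>c. \<phi> c * b xs c c \<partial>\<mu>) = (\<integral>c. \<phi> c * b' xs c \<partial>\<mu>)"
  shows "set xs \<subseteq> \<X> \<Longrightarrow> distinct xs \<Longrightarrow> length xs + k = n \<Longrightarrow> \<phi> \<in> borel_measurable \<Omega> \<Longrightarrow>
    depends_on xs \<phi> \<Longrightarrow> (\<And>c. c \<in> space \<Omega> \<Longrightarrow> \<bar>\<phi> c\<bar> \<le> 1) \<Longrightarrow>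
    (\<integral>c. \<phi> c * coupled g b k xs c c \<partial>\<mu>) = (\<integral>c. \<phi> c * pathwise g b' k xs c \<partial>\<mu>)"
proof (induction k arbitrary: xs \<phi>)
  case 0
  then show ?case
    using eq[of xs \<phi>] determined_full[of xs] by simp
next
  case (Suc k)
  note xs = Suc.prems(1-3) and \<phi> = Suc.prems(4-6)
  have len: "length xs < n" using xs by simp
  define A where "A = \<X> - set xs"
  have A: "finite A" "\<And>x. x \<in> A \<Longrightarrow> x \<in> \<X>" "\<And>x. x \<in> A \<Longrightarrow> x \<notin> set xs"
    using finite_\<X> by (auto simp: A_def)
  (* Split according to whether the tree stops at xs and, if not, which element comes next. *)
  define \<phi>\<^sub>d where "\<phi>\<^sub>d c = \<phi> c * of_bool (determined xs c)" for c
  define \<psi> where "\<psi> x c = \<phi> c * of_bool (\<not> determined xs c \<and> next_elem xs c = x)" for x c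
  define H where "H x c = (\<integral>u. coupled g b k (xs @ [x]) (resample xs x u c) (resample xs x u c) \<partial>unit_law)" for x c
  define P where "P x c = pathwise g b' k (xs @ [x]) c" for x c
  have dep_determined: "depends_on xs (determined xs)"
    by (rule depends_onI) (rule determined_cong)
  have \<phi>\<^sub>d_dep: "depends_on xs \<phi>\<^sub>d"
  proof (rule depends_onI)
    fix c c' assume "c \<in> space \<Omega>" "c' \<in> space \<Omega>" "proj xs c = proj xs c'"
    with depends_onD[OF \<phi>(2), of c c'] determined_cong[of c c' xs] show "\<phi>\<^sub>d c = \<phi>\<^sub>d c'"
      unfolding \<phi>\<^sub>d_def by (simp only:)
  qed
  have \<psi>_dep: "depends_on xs (\<psi> x)" for x
  proof (rule depends_onI)
    fix c c' assume "c \<in> space \<Omega>" "c' \<in> space \<Omega>" "proj xs c = proj xs c'"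
    with depends_onD[OF \<phi>(2), of c c'] determined_cong[of c c' xs] next_elem_cong[of xs c c'] show "\<psi> x c = \<psi> x c'"
      unfolding \<psi>_def by (simp only:)
  qed
  note [measurable] = \<phi>(1) measurable_determined[of xs]
  have [measurable]: "Measurable.pred \<Omega> (\<lambda>c. next_elem xs c = x)" for x
    using measurable_compose[OF measurable_next_elem[OF xs(1,2) len], of "\<lambda>y. y = x" "count_space UNIV"] by simp
  have \<phi>\<^sub>d_meas: "\<phi>\<^sub>d \<in> borel_measurable \<Omega>"
    unfolding \<phi>\<^sub>d_def by measurable
  have \<psi>_meas: "\<psi> x \<in> borel_measurable \<Omega>" for x
    unfolding \<psi>_def by measurable
  have \<phi>\<^sub>d_bd: "\<bar>\<phi>\<^sub>d c\<bar> \<le> 1" if "c \<in> space \<Omega>" for c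
    using \<phi>(3)[OF that] by (simp add: \<phi>\<^sub>d_def)
  have \<psi>_bd: "\<bar>\<psi> x c\<bar> \<le> 1" if "c \<in> space \<Omega>" for x c
    using \<phi>(3)[OF that] by (simp add: \<psi>_def)
  have split: "\<phi> c * (if determined xs c then p else q (next_elem xs c)) = \<phi>\<^sub>d c * p + (\<Sum>x\<in>A. \<psi> x c * q x)"
    if c: "c \<in> space \<Omega>" for c p and q :: "'a elem \<Rightarrow> real"
  proof (cases "determined xs c")
    case False
    have "(\<Sum>x\<in>A. \<psi> x c * q x) = (\<Sum>x\<in>A. if next_elem xs c = x then \<phi> c * q x else 0)"
      using False by (intro sum.cong) (auto simp: \<psi>_def)
    also have "\<dots> = \<phi> c * q (next_elem xs c)"
      using next_elem_in[OF xs(1,2) len c] A(1) by (simp add: A_def)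
    finally show ?thesis
      using False by (simp add: \<phi>\<^sub>d_def)
  qed (simp add: \<phi>\<^sub>d_def \<psi>_def)
  have bd_mult: "\<bar>a * r\<bar> \<le> R" if "\<bar>a\<bar> \<le> 1" "\<bar>r\<bar> \<le> R" for a r R :: real
    using mult_mono'[OF that] by (simp add: abs_mult)
  have diag_meas: "(\<lambda>c. coupled g b k (xs @ [x]) c c) \<in> borel_measurable \<Omega>" if "x \<in> A" for x
  proof -
    have "(\<lambda>c. (c, c)) \<in> \<Omega> \<rightarrow>\<^sub>M \<Omega> \<Otimes>\<^sub>M \<Omega>" by measurable
    from measurable_compose[OF this coupled_measurable[OF b_meas, where xs="xs @ [x]" and k=k and g=g]] show ?thesis
      using xs A(2,3)[OF that] by simp
  qed
  have diag_bd: "\<bar>coupled g b k (xs @ [x]) c c\<bar> \<le> C + real k * D" if "x \<in> A" "c \<in> space \<Omega>" for x c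
    using xs A(2,3)[OF that(1)] that(2) by (intro coupled_bound b_bd g D) auto
  have H_meas: "H x \<in> borel_measurable \<Omega>" if x: "x \<in> A" for x
  proof -
    have "(\<lambda>z. resample xs x (snd z) (fst z)) \<in> \<Omega> \<Otimes>\<^sub>M unit_law \<rightarrow>\<^sub>M \<Omega>"
      by (intro measurable_resample xs A(2)[OF x] measurable_fst measurable_snd)
    from measurable_compose[OF this diag_meas[OF x]]
    have "(\<lambda>(c, u). coupled g b k (xs @ [x]) (resample xs x u c) (resample xs x u c)) \<in> borel_measurable (\<Omega> \<Otimes>\<^sub>M unit_law)"
      by (simp add: split_beta')
    from unit.borel_measurable_lebesgue_integral[OF this] show ?thesis
      by (simp add: H_def[abs_def])
  qed
  have H_bd: "\<bar>H x c\<bar> \<le> C + real k * D" if x: "x \<in> A" and c: "c \<in> space \<Omega>" for x c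
    unfolding H_def by (intro unit.abs_integral_le diag_bd[OF x] resample_in_space A(2)[OF x] c)
  have P_meas: "P x \<in> borel_measurable \<Omega>" if "x \<in> A" for x
    unfolding P_def[abs_def] using pathwise_measurable[OF b'_meas, where xs="xs @ [x]" and k=k and g=g] xs A(2,3)[OF that] by simp
  have P_bd: "\<bar>P x c\<bar> \<le> C + real k * D" if "x \<in> A" "c \<in> space \<Omega>" for x c
    unfolding P_def using xs A(2,3)[OF that(1)] that(2) by (intro pathwise_bound b'_bd g D) auto
  have int_\<phi>: "integrable \<mu> (\<lambda>c. \<phi>\<^sub>d c * h c)" if "h \<in> borel_measurable \<Omega>" "\<And>c. c \<in> space \<Omega> \<Longrightarrow> \<bar>h c\<bar> \<le> R" for h R
    using \<phi>\<^sub>d_meas that by (intro \<mu>.integrable_bounded[of _ R] bd_mult \<phi>\<^sub>d_bd) auto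
  have int_\<psi>: "integrable \<mu> (\<lambda>c. \<psi> x c * h c)" if "h \<in> borel_measurable \<Omega>" "\<And>c. c \<in> space \<Omega> \<Longrightarrow> \<bar>h c\<bar> \<le> R" for h R x
    using \<psi>_meas that by (intro \<mu>.integrable_bounded[of _ R] bd_mult \<psi>_bd) auto
  have int_\<psi>g: "integrable \<mu> (\<lambda>c. \<psi> x c * g x)" for x
    by (rule int_\<psi>[of "\<lambda>_. g x" "\<bar>g x\<bar>"]) auto
  have HP: "(\<integral>c. \<psi> x c * H x c \<partial>\<mu>) = (\<integral>c. \<psi> x c * P x c \<partial>\<mu>)" if x: "x \<in> A" for x
  proof -
    let ?h = "\<lambda>c. \<psi> x c * coupled g b k (xs @ [x]) c c"
    have h_meas: "?h \<in> borel_measurable \<Omega>"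
      using \<psi>_meas diag_meas[OF x] by (rule borel_measurable_times)
    have h_bd: "\<bar>?h c\<bar> \<le> C + real k * D" if "c \<in> space \<Omega>" for c
      by (intro bd_mult \<psi>_bd diag_bd x that)
    have h_dep: "depends_on (xs @ [x]) ?h"
    proof (rule depends_on_mult[OF depends_on_snoc[OF \<psi>_dep]])
      show "depends_on (xs @ [x]) (\<lambda>c. coupled g b k (xs @ [x]) c c)"
        using xs A(2,3)[OF x] by (intro depends_onI coupled_cong[OF b_cong]) auto
    qed
    have "(\<integral>c. \<psi> x c * H x c \<partial>\<mu>) = (\<integral>c. (\<integral>w. ?h (set_coord x (coord x w) c) \<partial>K xs c) \<partial>\<mu>)"
    proof (intro Bochner_Integration.integral_cong refl)
      fix c assume "c \<in> space \<mu>"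
      then have c: "c \<in> space \<Omega>" by simp
      have "\<psi> x (resample xs x u c) = \<psi> x c" for u
        by (rule depends_onD[OF \<psi>_dep proj_resample_fresh[OF A(3)[OF x]] resample_in_space[OF A(2)[OF x] c] c])
      then have "\<psi> x c * H x c = (\<integral>u. ?h (resample xs x u c) \<partial>unit_law)"
        by (simp add: H_def)
      also have "\<dots> = (\<integral>w. ?h (set_coord x (coord x w) c) \<partial>K xs c)"
        by (rule integral_resample_eq[OF xs(1) A(2)[OF x] c h_meas])
      finally show "\<psi> x c * H x c = (\<integral>w. ?h (set_coord x (coord x w) c) \<partial>K xs c)" .
    qed
    also have "\<dots> = (\<integral>c. ?h c \<partial>\<mu>)"
      by (rule integral_resample[OF xs(1) A(2)[OF x] h_meas h_dep h_bd, symmetric])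
    also have "\<dots> = (\<integral>c. \<psi> x c * P x c \<partial>\<mu>)"
      unfolding P_def using xs A(2,3)[OF x]
      by (intro Suc.IH \<psi>_meas depends_on_snoc \<psi>_dep \<psi>_bd) auto
    finally show ?thesis .
  qed
  have b_diag: "(\<lambda>c. b xs c c) \<in> borel_measurable \<Omega>"
  proof -
    have "(\<lambda>c. (c, c)) \<in> \<Omega> \<rightarrow>\<^sub>M \<Omega> \<Otimes>\<^sub>M \<Omega>" by measurable
    from measurable_compose[OF this b_meas[OF xs(1)]] show ?thesis by simp
  qed
  have "(\<integral>c. \<phi> c * coupled g b (Suc k) xs c c \<partial>\<mu>) =
      (\<integral>c. \<phi>\<^sub>d c * b xs c c + (\<Sum>x\<in>A. \<psi> x c * g x + \<psi> x c * H x c) \<partial>\<mu>)"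
  proof (intro Bochner_Integration.integral_cong refl)
    fix c assume "c \<in> space \<mu>"
    then show "\<phi> c * coupled g b (Suc k) xs c c = \<phi>\<^sub>d c * b xs c c + (\<Sum>x\<in>A. \<psi> x c * g x + \<psi> x c * H x c)"
      using split[of c "b xs c c" "\<lambda>x. g x + H x c"] by (simp only: coupled.simps H_def distrib_left space_\<mu>)
  qed
  also have "\<dots> = (\<integral>c. \<phi>\<^sub>d c * b xs c c \<partial>\<mu>) + (\<Sum>x\<in>A. (\<integral>c. \<psi> x c * g x \<partial>\<mu>) + (\<integral>c. \<psi> x c * H x c \<partial>\<mu>))"
    using int_\<phi>[OF b_diag b_bd[OF xs(1)]] int_\<psi>g int_\<psi>[OF H_meas H_bd]
    by (simp add: Bochner_Integration.integral_sum)
  also have "\<dots> = (\<integral>c. \<phi>\<^sub>d c * b' xs c \<partial>\<mu>) + (\<Sum>x\<in>A. (\<integral>c. \<psi> x c * g x \<partial>\<mu>) + (\<integral>c. \<psi> x c * P x c \<partial>\<mu>))"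
  proof -
    have "(\<integral>c. \<phi>\<^sub>d c * b xs c c \<partial>\<mu>) = (\<integral>c. \<phi>\<^sub>d c * b' xs c \<partial>\<mu>)"
      by (rule eq[OF xs(1) \<phi>\<^sub>d_meas \<phi>\<^sub>d_dep \<phi>\<^sub>d_bd]) (simp_all add: \<phi>\<^sub>d_def)
    then show ?thesis
      using HP by simp
  qed
  also have "\<dots> = (\<integral>c. \<phi>\<^sub>d c * b' xs c + (\<Sum>x\<in>A. \<psi> x c * g x + \<psi> x c * P x c) \<partial>\<mu>)"
    using int_\<phi>[OF b'_meas[OF xs(1)] b'_bd[OF xs(1)]] int_\<psi>g int_\<psi>[OF P_meas P_bd]
    by (simp add: Bochner_Integration.integral_sum)
  also have "\<dots> = (\<integral>c. \<phi> c * pathwise g b' (Suc k) xs c \<partial>\<mu>)"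
  proof (intro Bochner_Integration.integral_cong refl)
    fix c assume "c \<in> space \<mu>"
    then show "\<phi>\<^sub>d c * b' xs c + (\<Sum>x\<in>A. \<psi> x c * g x + \<psi> x c * P x c) = \<phi> c * pathwise g b' (Suc k) xs c"
      using split[of c "b' xs c" "\<lambda>x. g x + P x c"] by (simp only: pathwise.simps P_def distrib_left space_\<mu>)
  qed
  finally show ?case .
qed

section \<open>The coupling inequality\<close>

text \<open>The mean of \<open>f(X) f(Y)\<close> given the states \<open>c\<close> and \<open>y\<close> of \<open>xs\<close> in X and Y. Once \<open>f(X)\<close> is
  determined, Y continues independently and contributes its own conditional expectation.\<close>

definition joint_mean :: "nat \<Rightarrow> 'a elem list \<Rightarrow> 'a cfg \<Rightarrow> 'a cfg \<Rightarrow> real" where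
  "joint_mean = coupled (\<lambda>_. 0) (\<lambda>xs c y. F c * cexp F xs y)"

lemma joint_mean_simps:
  "joint_mean 0 xs c y = F c * cexp F xs y"
  "joint_mean (Suc k) xs c y = (if determined xs c then F c * cexp F xs y
     else \<integral>u. joint_mean k (xs @ [next_elem xs c]) (resample xs (next_elem xs c) u c) (resample xs (next_elem xs c) u y) \<partial>unit_law)"
  by (simp_all add: joint_mean_def)

lemma cexp_f_meas: "set xs \<subseteq> \<X> \<Longrightarrow> cexp F xs \<in> borel_measurable \<Omega>"
  unfolding cexp_def[abs_def] by (rule integral_K_measurable[OF _ f_bdd(1)])

lemma cexp_f_bd: "set xs \<subseteq> \<X> \<Longrightarrow> c \<in> space \<Omega> \<Longrightarrow> \<bar>cexp F xs c\<bar> \<le> 1"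
  unfolding cexp_def by (rule integral_K_abs_le[OF _ _ f_bdd(2)])

lemma f_cexp_measurable: "set xs \<subseteq> \<X> \<Longrightarrow> (\<lambda>z. F (fst z) * cexp F xs (snd z)) \<in> borel_measurable (\<Omega> \<Otimes>\<^sub>M \<Omega>)"
  by (intro borel_measurable_times measurable_compose[OF measurable_fst f_bdd(1)]
      measurable_compose[OF measurable_snd cexp_f_meas])

lemma f_cexp_bound:
  assumes "set xs \<subseteq> \<X>" "c \<in> space \<Omega>" "y \<in> space \<Omega>"
  shows "\<bar>F c * cexp F xs y\<bar> \<le> 1"
  using mult_mono'[OF f_bdd(2)[OF assms(2)] cexp_f_bd[OF assms(1,3)]] by (simp add: abs_mult)

lemma f_cexp_cong:
  assumes "c' \<in> space \<Omega>" "determined xs c" "proj xs c = proj xs c'" "proj xs y = proj xs y'"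
  shows "F c * cexp F xs y = F c' * cexp F xs y'"
  by (simp only: determined_f_cong[OF assms(2,3,1)] cexp_cong[OF assms(4)])

lemma joint_mean_measurable:
  "set xs \<subseteq> \<X> \<Longrightarrow> distinct xs \<Longrightarrow> length xs + k = n \<Longrightarrow> (\<lambda>z. joint_mean k xs (fst z) (snd z)) \<in> borel_measurable (\<Omega> \<Otimes>\<^sub>M \<Omega>)"
  unfolding joint_mean_def by (rule coupled_measurable[OF f_cexp_measurable])

lemma joint_mean_bd:
  assumes "set xs \<subseteq> \<X>" "distinct xs" "length xs + k = n" "c \<in> space \<Omega>" "y \<in> space \<Omega>"
  shows "\<bar>joint_mean k xs c y\<bar> \<le> 1"
  using coupled_bound[where g="\<lambda>_. 0" and D=0, OF f_cexp_bound _ order.refl assms] by (simp add: joint_mean_def)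

lemma joint_mean_cong:
  assumes "set xs \<subseteq> \<X>" "distinct xs" "length xs + k = n" "c \<in> space \<Omega>" "c' \<in> space \<Omega>"
    "y \<in> space \<Omega>" "y' \<in> space \<Omega>" "proj xs c = proj xs c'" "proj xs y = proj xs y'"
  shows "joint_mean k xs c y = joint_mean k xs c' y'"
  unfolding joint_mean_def by (rule coupled_cong[OF f_cexp_cong assms])

lemma joint_mean_compose_measurable:
  "set xs \<subseteq> \<X> \<Longrightarrow> distinct xs \<Longrightarrow> length xs + k = n \<Longrightarrow> c \<in> M \<rightarrow>\<^sub>M \<Omega> \<Longrightarrow> y \<in> M \<rightarrow>\<^sub>M \<Omega> \<Longrightarrow>
    (\<lambda>w. joint_mean k xs (c w) (y w)) \<in> borel_measurable M"
  using measurable_compose[OF measurable_Pair[of c M \<Omega> y \<Omega>] joint_mean_measurable[of xs k]] by simp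

lemma unit_space: "u \<in> space unit_law \<longleftrightarrow> 0 < u \<and> u < 1"
  by (auto simp: space_restrict_space)

text \<open>The coupling keeps the order of \<open>y\<close> and \<open>y'\<close>, and at the end the difference is multiplied by
  \<open>f(X)\<close>, which lies in the unit interval. Without that factor the difference would be the one of the
  conditional expectations of \<open>f\<close>.\<close>

lemma joint_mean_increment:
  assumes "revealed T c (length xs) = xs" "length xs + k = n"
    and "c \<in> space \<Omega>" "y \<in> space \<Omega>" "y' \<in> space \<Omega>" "y \<le> y'"
  shows "0 \<le> joint_mean k xs c y' - joint_mean k xs c y \<and> joint_mean k xs c y' - joint_mean k xs c y \<le> cexp F xs y' - cexp F xs y"
  using assms
proof (induction k arbitrary: xs c y y')
  case (Suc k)
  note p = Suc.prems
  have adm_xs: "admissible_order E \<Lambda> xs"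
    using revealed_admissible[OF p(3), of "length xs"] p(1,2) by simp
  note xs = admissible_order_props[OF adm_xs]
  have base: "0 \<le> F c * d \<and> F c * d \<le> d" if "0 \<le> d" for d
    using f_range[OF p(3)] that by (auto intro: mult_left_le_one_le)
  have mono: "0 \<le> cexp F xs y' - cexp F xs y"
    using bdd_incrD(3)[OF bdd_incr_cexp[OF adm_xs bdd_incr_f] p(4-6)] by simp
  show ?case
  proof (cases "determined xs c")
    case True
    then show ?thesis
      using base[OF mono] by (simp add: joint_mean_simps right_diff_distrib)
  next
    case False
    define x where "x = next_elem xs c"
    have x: "x \<in> \<X>" "x \<notin> set xs"
      using next_elem_in[of xs c] xs p by (auto simp: x_def)
    let ?r = "resample xs x"
    have xsx: "set (xs @ [x]) \<subseteq> \<X>" "distinct (xs @ [x])" "length (xs @ [x]) + k = n"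
      using xs x p by auto
    have rs: "(\<lambda>u. ?r u z) \<in> unit_law \<rightarrow>\<^sub>M \<Omega>" if "z \<in> space \<Omega>" for z
      using xs x that by (intro measurable_resample measurable_const) auto
    have intW: "integrable unit_law (\<lambda>u. joint_mean k (xs @ [x]) (?r u c) (?r u z))" if z: "z \<in> space \<Omega>" for z
      using joint_mean_compose_measurable[OF xsx rs[OF p(3)] rs[OF z]] joint_mean_bd[OF xsx resample_in_space[OF x(1) p(3)] resample_in_space[OF x(1) z]]
      by (intro unit.integrable_bounded)
    have intm: "integrable unit_law (\<lambda>u. cexp F (xs @ [x]) (?r u z))" if z: "z \<in> space \<Omega>" for z
      using measurable_compose[OF rs[OF z] cexp_f_meas[OF xsx(1)]] cexp_f_bd[OF xsx(1) resample_in_space[OF x(1) z]]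
      by (intro unit.integrable_bounded)
    have m: "(\<integral>u. cexp F (xs @ [x]) (?r u z) \<partial>unit_law) = cexp F xs z" if z: "z \<in> space \<Omega>" for z
    proof -
      have sub: "set xs \<subseteq> \<X>" using xs by simp
      show ?thesis
        unfolding integral_resample_eq[OF sub x(1) z cexp_f_meas[OF xsx(1)]]
        by (rule cexp_tower[OF sub x z f_bdd(1,2), symmetric])
    qed
    have IH: "0 \<le> joint_mean k (xs @ [x]) (?r u c) (?r u y') - joint_mean k (xs @ [x]) (?r u c) (?r u y) \<and>
        joint_mean k (xs @ [x]) (?r u c) (?r u y') - joint_mean k (xs @ [x]) (?r u c) (?r u y)
          \<le> cexp F (xs @ [x]) (?r u y') - cexp F (xs @ [x]) (?r u y)" if u: "u \<in> space unit_law" for u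
    proof (rule Suc.IH)
      show "revealed T (?r u c) (length (xs @ [x])) = xs @ [x]"
        unfolding x_def using xs p by (intro revealed_resample) auto
      show "?r u y \<le> ?r u y'"
        using u by (intro resample_mono adm_xs x p) (auto simp: unit_space)
    qed (use xsx p resample_in_space x in auto)
    have diff: "joint_mean (Suc k) xs c y' - joint_mean (Suc k) xs c y =
        (\<integral>u. joint_mean k (xs @ [x]) (?r u c) (?r u y') - joint_mean k (xs @ [x]) (?r u c) (?r u y) \<partial>unit_law)"
      using False intW[OF p(4)] intW[OF p(5)] by (simp add: joint_mean_simps x_def[symmetric])
    have "0 \<le> (\<integral>u. joint_mean k (xs @ [x]) (?r u c) (?r u y') - joint_mean k (xs @ [x]) (?r u c) (?r u y) \<partial>unit_law)"
      using IH by (intro integral_nonneg_AE AE_I2) blast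
    moreover have "(\<integral>u. joint_mean k (xs @ [x]) (?r u c) (?r u y') - joint_mean k (xs @ [x]) (?r u c) (?r u y) \<partial>unit_law)
        \<le> (\<integral>u. cexp F (xs @ [x]) (?r u y') - cexp F (xs @ [x]) (?r u y) \<partial>unit_law)"
      using IH intW intm p by (intro integral_mono Bochner_Integration.integrable_diff) blast+
    moreover have "(\<integral>u. cexp F (xs @ [x]) (?r u y') - cexp F (xs @ [x]) (?r u y) \<partial>unit_law)
        = cexp F xs y' - cexp F xs y"
      using intm m p by simp
    ultimately show ?thesis
      unfolding diff by simp
  qed
next
  case 0
  note p = 0
  have adm_xs: "admissible_order E \<Lambda> xs"
    using revealed_admissible[OF p(3), of "length xs"] p(1,2) by simp
  have "0 \<le> cexp F xs y' - cexp F xs y"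
    using bdd_incrD(3)[OF bdd_incr_cexp[OF adm_xs bdd_incr_f] p(4-6)] by simp
  then show ?case
    using f_range[OF p(3)] mult_left_le_one_le[of "cexp F xs y' - cexp F xs y" "F c"]
    by (simp add: joint_mean_simps right_diff_distrib[symmetric])
qed

lemma abs_max_diff_le: "\<bar>a\<bar> \<le> 1 \<Longrightarrow> \<bar>b\<bar> \<le> 1 \<Longrightarrow> \<bar>max 0 (a - b)\<bar> \<le> 2" for a b :: real
  by (simp add: max_def abs_le_iff)

abbreviation "mean \<equiv> \<integral>c. F c \<partial>\<mu>"

abbreviation "cost_bound B \<equiv> coupled B (\<lambda>xs c y. F c * mean)"

lemma abs_mean_le: "\<bar>mean\<bar> \<le> 1"
  by (rule \<mu>.abs_integral_le) (simp add: f_bdd(2))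

lemma abs_le_sum_elems: "x \<in> \<X> \<Longrightarrow> \<bar>g x\<bar> \<le> (\<Sum>x\<in>\<X>. \<bar>g x :: real\<bar>)"
  using finite_\<X> by (intro member_le_sum) auto

lemma f_mean_measurable: "(\<lambda>z. F (fst z) * mean) \<in> borel_measurable (\<Omega> \<Otimes>\<^sub>M \<Omega>)"
  by (intro borel_measurable_times measurable_compose[OF measurable_fst f_bdd(1)] borel_measurable_const)

lemma f_mean_bound: "c \<in> space \<Omega> \<Longrightarrow> \<bar>F c * mean\<bar> \<le> 1"
  using mult_mono'[OF f_bdd(2)[of c] abs_mean_le] by (simp add: abs_mult)

lemma f_mean_cong: "determined xs c \<Longrightarrow> proj xs c = proj xs c' \<Longrightarrow> c' \<in> space \<Omega> \<Longrightarrow> F c * mean = F c' * mean"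
  by (simp only: determined_f_cong)

lemma step_gap_bound:
  assumes "set xs \<subseteq> \<X>" "x \<in> \<X>" "y \<in> space \<Omega>"
  shows "\<bar>step_gap F xs x y\<bar> \<le> 2"
proof -
  have "\<bar>cexp F (xs @ [x]) (set_coord x r y)\<bar> \<le> 1" for r
    using assms by (intro cexp_f_bd set_coord_in_space) auto
  then have "\<bar>max 0 (cexp F (xs @ [x]) (set_coord x r y) - cexp F (xs @ [x]) (set_coord x r' y))\<bar> \<le> 2" for r r'
    by (intro abs_max_diff_le)
  then show ?thesis
    unfolding step_gap_def using assms by (intro integral_K_abs_le)
qed

lemma integral_f_cexp:
  assumes "set xs \<subseteq> \<X>"
  shows "(\<integral>y. F c * cexp F xs y \<partial>\<mu>) = F c * mean"
  using integral_cexp_1[OF assms f_bdd(1,2)] by simp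

text \<open>The left-hand side averages over an independent past of Y. One step of the recursion draws the next
  element of X and of Y with the same uniform variable. Replacing the draw for Y by an independent one
  costs at most \<open>step_gap\<close>, and afterwards Y again has an independent past, now longer by one
  element; so the costs accumulate along the tree run on X. The reward after stopping is \<open>f(X)\<close> times
  the mean of \<open>f\<close>.\<close>

lemma joint_mean_average:
  assumes B: "\<And>xs x. admissible_order E \<Lambda> (xs @ [x]) \<Longrightarrow> (\<integral>y. step_gap F xs x y \<partial>\<mu>) \<le> B x"
  shows "revealed T c (length xs) = xs \<Longrightarrow> length xs + k = n \<Longrightarrow> c \<in> space \<Omega> \<Longrightarrow>
    (\<integral>y. joint_mean k xs c y \<partial>\<mu>) \<le> cost_bound B k xs c c"
proof (induction k arbitrary: xs c)
  case 0
  have "admissible_order E \<Lambda> xs"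
    using revealed_admissible[OF 0(3), of "length xs"] 0(1,2) by simp
  then have "set xs \<subseteq> \<X>"
    using admissible_order_props by blast
  from integral_f_cexp[OF this, of c] show ?case
    by (simp only: joint_mean_simps coupled.simps)
next
  case (Suc k)
  note p = Suc.prems
  have adm_xs: "admissible_order E \<Lambda> xs"
    using revealed_admissible[OF p(3), of "length xs"] p(1,2) by simp
  then have sub: "set xs \<subseteq> \<X>" and dist: "distinct xs"
    using admissible_order_props[OF adm_xs] by auto
  show ?case
  proof (cases "determined xs c")
    case True
    then show ?thesis
      using integral_f_cexp[OF sub, of c] by (simp only: joint_mean_simps coupled.simps if_True order.refl)
  next
    case False
    define x where "x = next_elem xs c"
    have x: "x \<in> \<X>" "x \<notin> set xs"
      using next_elem_in[OF sub dist _ p(3)] p by (auto simp: x_def)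
    define r where "r = resample xs x"
    have xsx: "set (xs @ [x]) \<subseteq> \<X>" "distinct (xs @ [x])" "length (xs @ [x]) + k = n"
      using sub dist x p by auto
    have rev: "revealed T (r u c) (length (xs @ [x])) = xs @ [x]" for u
      unfolding x_def r_def using sub dist p by (intro revealed_resample) auto
    have "admissible_order E \<Lambda> (revealed T (r 0 c) (length (xs @ [x])))"
      using p x by (intro revealed_admissible) (auto simp: r_def resample_in_space)
    then have adm_xsx: "admissible_order E \<Lambda> (xs @ [x])"
      by (simp only: rev)
    have r_in: "r u z \<in> space \<Omega>" if "z \<in> space \<Omega>" for u z
      unfolding r_def by (rule resample_in_space[OF x(1) that])
    have r_meas: "(\<lambda>w. r (u w) (z w)) \<in> M \<rightarrow>\<^sub>M \<Omega>" if "z \<in> M \<rightarrow>\<^sub>M \<Omega>" "u \<in> M \<rightarrow>\<^sub>M unit_law" for z u and M :: "'m measure"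
      unfolding r_def by (rule measurable_resample[OF sub x(1) that])
    have r_meas': "(\<lambda>u. r u z) \<in> unit_law \<rightarrow>\<^sub>M \<Omega>" if "z \<in> space \<Omega>" for z
      unfolding r_def using that by (intro measurable_resample[OF sub x(1)]) auto
    define s where "s w y = set_coord x (coord x w) y" for w y
    have s_in: "s w y \<in> space \<Omega>" if "y \<in> space \<Omega>" for w y
      unfolding s_def by (rule set_coord_in_space[OF x(1) that])
    define W' where "W' = joint_mean k (xs @ [x])"
    define m where "m = cexp F (xs @ [x])"
    have W'_bd: "\<bar>W' z y\<bar> \<le> 1" if "z \<in> space \<Omega>" "y \<in> space \<Omega>" for z y
      unfolding W'_def by (rule joint_mean_bd[OF xsx that])
    have W'_meas: "(\<lambda>w. W' (z w) (y w)) \<in> borel_measurable M" if "z \<in> M \<rightarrow>\<^sub>M \<Omega>" "y \<in> M \<rightarrow>\<^sub>M \<Omega>" for z y and M :: "'m measure"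
      unfolding W'_def by (rule joint_mean_compose_measurable[OF xsx that])
    have W'_meas1: "(\<lambda>w. W' z (y w)) \<in> borel_measurable M" if "z \<in> space \<Omega>" "y \<in> M \<rightarrow>\<^sub>M \<Omega>" for z y and M :: "'a cfg measure"
      unfolding W'_def using that by (intro joint_mean_compose_measurable[OF xsx]) auto
    have m_meas: "m \<in> borel_measurable \<Omega>"
      unfolding m_def by (rule cexp_f_meas[OF xsx(1)])
    have m_bd: "\<bar>m y\<bar> \<le> 1" if "y \<in> space \<Omega>" for y
      unfolding m_def by (rule cexp_f_bd[OF xsx(1) that])
    define I where "I y u = (\<integral>w. W' (r u c) (s w y) \<partial>K xs y)" for y u
    define J where "J y z = (\<integral>w. max 0 (m z - m (s w y)) \<partial>K xs y)" for y z
    have s_meas: "(\<lambda>w. s w y) \<in> \<Omega> \<rightarrow>\<^sub>M \<Omega>" if "y \<in> space \<Omega>" for y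
      unfolding s_def using that by (intro measurable_set_coord_\<Omega>[OF x(1) measurable_coord_\<Omega>[OF x(1)]]) auto
    have IJ: "W' (r u c) (r u y) \<le> I y u + J y (r u y)" if u: "u \<in> space unit_law" and y: "y \<in> space \<Omega>" for u y
    proof -
      interpret KP: prob_space "K xs y" by (rule K_props[OF sub y])
      (* The coupled draw and the fresh draw differ in one coordinate only, so they are comparable. *)
    have ptw: "W' (r u c) (r u y) \<le> W' (r u c) (s w y) + max 0 (m (r u y) - m (s w y))" for w
      proof (cases "quantile (K xs y) (coord x) u \<le> coord x w")
        case True
        then have "r u y \<le> s w y"
          unfolding r_def s_def resample_def by (intro set_coord_mono order.refl)
        from joint_mean_increment[OF rev[of u] xsx(3) r_in[OF p(3)] r_in[OF y] s_in[OF y] this, THEN conjunct1]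
        show ?thesis
          unfolding W'_def using max.cobounded1[of 0 "m (r u y) - m (s w y)"] by linarith
      next
        case False
        then have "s w y \<le> r u y"
          unfolding r_def s_def resample_def by (intro set_coord_mono order.refl) simp
        from joint_mean_increment[OF rev[of u] xsx(3) r_in[OF p(3)] s_in[OF y] r_in[OF y] this, THEN conjunct2]
        show ?thesis
          unfolding W'_def m_def[symmetric] using max.cobounded2[of "m (r u y) - m (s w y)" 0] by linarith
      qed
      have int1: "integrable (K xs y) (\<lambda>w. W' (r u c) (s w y))"
      proof (rule KP.integrable_bounded)
        show "(\<lambda>w. W' (r u c) (s w y)) \<in> borel_measurable (K xs y)"
          unfolding measurable_K_iff[OF sub y] by (rule W'_meas1[OF r_in[OF p(3)] s_meas[OF y]])
      qed (rule W'_bd[OF r_in[OF p(3)] s_in[OF y]])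
      have int2: "integrable (K xs y) (\<lambda>w. m (s w y))"
      proof (rule KP.integrable_bounded)
        show "(\<lambda>w. m (s w y)) \<in> borel_measurable (K xs y)"
          unfolding measurable_K_iff[OF sub y] by (rule measurable_compose[OF s_meas[OF y] m_meas])
      qed (rule m_bd[OF s_in[OF y]])
      have int3: "integrable (K xs y) (\<lambda>w. max 0 (m (r u y) - m (s w y)))"
        using int2 by (intro integrable_max Bochner_Integration.integrable_diff integrable_zero KP.integrable_const)
      have "W' (r u c) (r u y) = (\<integral>w. W' (r u c) (r u y) \<partial>K xs y)"
        by (simp add: KP.prob_space)
      also have "\<dots> \<le> (\<integral>w. W' (r u c) (s w y) + max 0 (m (r u y) - m (s w y)) \<partial>K xs y)"
        by (intro integral_mono ptw Bochner_Integration.integrable_add int1 int3 KP.integrable_const)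
      also have "\<dots> = I y u + J y (r u y)"
        unfolding I_def J_def by (rule Bochner_Integration.integral_add[OF int1 int3])
      finally show ?thesis .
    qed
    have I_meas: "case_prod I \<in> borel_measurable (\<Omega> \<Otimes>\<^sub>M unit_law)"
    proof -
      have "(\<lambda>z. \<integral>w. W' (r (snd z) c) (s w (fst z)) \<partial>K xs (fst z)) \<in> borel_measurable (\<Omega> \<Otimes>\<^sub>M unit_law)"
      proof (rule measurable_integral_kernel[where N=\<Omega>])
        show "(\<lambda>z. K xs (fst z)) \<in> \<Omega> \<Otimes>\<^sub>M unit_law \<rightarrow>\<^sub>M prob_algebra \<Omega>"
          by (rule measurable_compose[OF measurable_fst measurable_K[OF sub]])
        have "(\<lambda>p. s (snd p) (fst (fst p))) \<in> (\<Omega> \<Otimes>\<^sub>M unit_law) \<Otimes>\<^sub>M \<Omega> \<rightarrow>\<^sub>M \<Omega>"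
          unfolding s_def
          by (intro measurable_set_coord_\<Omega>[OF x(1)] measurable_compose[OF measurable_snd measurable_coord_\<Omega>[OF x(1)]]
               measurable_compose[OF measurable_fst measurable_fst])
        moreover have "(\<lambda>p. r (snd (fst p)) c) \<in> (\<Omega> \<Otimes>\<^sub>M unit_law) \<Otimes>\<^sub>M \<Omega> \<rightarrow>\<^sub>M \<Omega>"
          by (rule measurable_compose[OF measurable_fst measurable_compose[OF measurable_snd r_meas'[OF p(3)]]])
        ultimately have "(\<lambda>p. joint_mean k (xs @ [x]) (r (snd (fst p)) c) (s (snd p) (fst (fst p)))) \<in> borel_measurable ((\<Omega> \<Otimes>\<^sub>M unit_law) \<Otimes>\<^sub>M \<Omega>)"
          by (intro joint_mean_compose_measurable[OF xsx])
        then show "(\<lambda>(z, w). W' (r (snd z) c) (s w (fst z))) \<in> borel_measurable ((\<Omega> \<Otimes>\<^sub>M unit_law) \<Otimes>\<^sub>M \<Omega>)"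
          by (simp add: W'_def split_beta')
      qed
      then show ?thesis
        by (simp add: I_def split_beta')
    qed
    have I_bd: "\<bar>I y u\<bar> \<le> 1" if y: "y \<in> space \<Omega>" for y u
      unfolding I_def by (intro integral_K_abs_le sub y W'_bd r_in p(3) s_in)
    have J_meas: "J y \<in> borel_measurable \<Omega>" if y: "y \<in> space \<Omega>" for y
      unfolding J_def[abs_def]
    proof (rule measurable_integral_kernel[where N=\<Omega>])
      have "(\<lambda>p. m (fst p)) \<in> borel_measurable (\<Omega> \<Otimes>\<^sub>M \<Omega>)" "(\<lambda>p. m (s (snd p) y)) \<in> borel_measurable (\<Omega> \<Otimes>\<^sub>M \<Omega>)"
        by (rule measurable_compose[OF measurable_fst m_meas],
            rule measurable_compose[OF measurable_snd measurable_compose[OF s_meas[OF y] m_meas]])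
      then show "(\<lambda>(z, w). max 0 (m z - m (s w y))) \<in> borel_measurable (\<Omega> \<Otimes>\<^sub>M \<Omega>)"
        unfolding split_beta' by measurable
      show "(\<lambda>z. K xs y) \<in> \<Omega> \<rightarrow>\<^sub>M prob_algebra \<Omega>"
        using measurable_space[OF measurable_K[OF sub] y] by (rule measurable_const)
    qed
    have J_bd: "\<bar>J y z\<bar> \<le> 2" if y: "y \<in> space \<Omega>" and z: "z \<in> space \<Omega>" for y z
      unfolding J_def
    proof (intro integral_K_abs_le sub y)
      show "\<bar>max 0 (m z - m (s w y))\<bar> \<le> 2" for w
        by (rule abs_max_diff_le[OF m_bd[OF z] m_bd[OF s_in[OF y]]])
    qed
    have W'_int: "integrable unit_law (\<lambda>u. W' (r u c) (r u y))" if y: "y \<in> space \<Omega>" for y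
      using joint_mean_compose_measurable[OF xsx r_meas'[OF p(3)] r_meas'[OF y]] W'_bd[OF r_in[OF p(3)] r_in[OF y]]
      unfolding W'_def by (intro unit.integrable_bounded)
    have I_int: "integrable unit_law (I y)" if y: "y \<in> space \<Omega>" for y
      using measurable_Pair2[OF I_meas y] I_bd[OF y] by (intro unit.integrable_bounded) auto
    have J_int: "integrable unit_law (\<lambda>u. J y (r u y))" if y: "y \<in> space \<Omega>" for y
      using measurable_compose[OF r_meas'[OF y] J_meas[OF y]] J_bd[OF y r_in[OF y]] by (intro unit.integrable_bounded)
    have J_gap: "(\<integral>u. J y (r u y) \<partial>unit_law) = step_gap F xs x y" if y: "y \<in> space \<Omega>" for y
      unfolding r_def integral_resample_eq[OF sub x(1) y J_meas[OF y]]
      by (simp only: J_def step_gap_def m_def s_def)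
    have W_eq: "joint_mean (Suc k) xs c y = (\<integral>u. W' (r u c) (r u y) \<partial>unit_law)" for y
      using False by (simp add: joint_mean_simps x_def[symmetric] r_def W'_def)
    have step_y: "joint_mean (Suc k) xs c y \<le> (\<integral>u. I y u \<partial>unit_law) + step_gap F xs x y" if y: "y \<in> space \<Omega>" for y
    proof -
      have "joint_mean (Suc k) xs c y \<le> (\<integral>u. I y u + J y (r u y) \<partial>unit_law)"
        unfolding W_eq using W'_int[OF y] I_int[OF y] J_int[OF y] IJ[OF _ y] by (intro integral_mono) auto
      also have "\<dots> = (\<integral>u. I y u \<partial>unit_law) + step_gap F xs x y"
        unfolding J_gap[OF y, symmetric] by (rule Bochner_Integration.integral_add[OF I_int[OF y] J_int[OF y]])
      finally show ?thesis .
    qed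
    interpret prod: pair_prob_space \<mu> unit_law ..
    have I_prod: "integrable (\<mu> \<Otimes>\<^sub>M unit_law) (case_prod I)"
    proof (rule prod.P.integrable_bounded)
      show "case_prod I \<in> borel_measurable (\<mu> \<Otimes>\<^sub>M unit_law)"
        using I_meas by (simp add: measurable_cong_sets[OF sets_pair_measure_cong[OF \<mu>(2) refl] refl])
      show "\<bar>case_prod I z\<bar> \<le> 1" if "z \<in> space (\<mu> \<Otimes>\<^sub>M unit_law)" for z
        using that I_bd[of "fst z" "snd z"] by (simp add: split_beta' space_pair_measure mem_Times_iff)
    qed
    have int_I: "integrable \<mu> (\<lambda>y. \<integral>u. I y u \<partial>unit_law)"
      using prod.integrable_fst'[OF I_prod] by simp
    have int_gap: "integrable \<mu> (step_gap F xs x)"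
      using measurable_step_gap[OF sub x(1) f_bdd(1)] step_gap_bound[OF sub x(1)] by (intro \<mu>.integrable_bounded) auto
    have int_W: "integrable \<mu> (joint_mean (Suc k) xs c)"
    proof (rule \<mu>.integrable_bounded)
      have "joint_mean (Suc k) xs c \<in> borel_measurable \<Omega>"
        using p by (intro joint_mean_compose_measurable[OF sub dist p(2)]) auto
      then show "joint_mean (Suc k) xs c \<in> borel_measurable \<mu>" by simp
      show "\<bar>joint_mean (Suc k) xs c y\<bar> \<le> 1" if "y \<in> space \<mu>" for y
        using that by (intro joint_mean_bd[OF sub dist p(2,3)]) simp
    qed
    (* A fresh draw extends the independent past of Y by one element. *)
    have avg: "(\<integral>y. I y u \<partial>\<mu>) = (\<integral>y. W' (r u c) y \<partial>\<mu>)" for u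
      unfolding I_def s_def
    proof (rule integral_resample[OF sub x(1), symmetric])
      show "W' (r u c) \<in> borel_measurable \<Omega>"
        using W'_meas1[OF r_in[OF p(3)] measurable_ident] by simp
      show "depends_on (xs @ [x]) (W' (r u c))"
        unfolding W'_def by (intro depends_onI joint_mean_cong[OF xsx r_in[OF p(3)] r_in[OF p(3)]]) (simp_all only:)
    qed (rule W'_bd[OF r_in[OF p(3)]])
    have coupled_int: "integrable unit_law (\<lambda>u. cost_bound B k (xs @ [x]) (r u c) (r u c))"
    proof (rule unit.integrable_bounded)
      from measurable_compose[OF measurable_Pair[OF r_meas'[OF p(3)] r_meas'[OF p(3)]] coupled_measurable[OF f_mean_measurable xsx, of B]]
      show "(\<lambda>u. cost_bound B k (xs @ [x]) (r u c) (r u c)) \<in> borel_measurable unit_law"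
        by simp
      show "\<bar>cost_bound B k (xs @ [x]) (r u c) (r u c)\<bar> \<le> 1 + real k * (\<Sum>x\<in>\<X>. \<bar>B x\<bar>)" for u
        by (intro coupled_bound f_mean_bound abs_le_sum_elems sum_nonneg xsx r_in p(3)) simp_all
    qed
    have "(\<integral>y. joint_mean (Suc k) xs c y \<partial>\<mu>) \<le> (\<integral>y. (\<integral>u. I y u \<partial>unit_law) + step_gap F xs x y \<partial>\<mu>)"
      using step_y by (intro integral_mono Bochner_Integration.integrable_add int_W int_I int_gap) simp
    also have "\<dots> = (\<integral>y. (\<integral>u. I y u \<partial>unit_law) \<partial>\<mu>) + (\<integral>y. step_gap F xs x y \<partial>\<mu>)"
      by (rule Bochner_Integration.integral_add[OF int_I int_gap])
    also have "(\<integral>y. (\<integral>u. I y u \<partial>unit_law) \<partial>\<mu>) = (\<integral>u. (\<integral>y. I y u \<partial>\<mu>) \<partial>unit_law)"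
      by (rule prod.Fubini_integral[OF I_prod, symmetric])
    also have "\<dots> \<le> (\<integral>u. cost_bound B k (xs @ [x]) (r u c) (r u c) \<partial>unit_law)"
    proof (rule integral_mono[OF _ coupled_int])
      show "integrable unit_law (\<lambda>u. \<integral>y. I y u \<partial>\<mu>)"
        using prod.integrable_snd[OF I_prod] by simp
      show "(\<integral>y. I y u \<partial>\<mu>) \<le> cost_bound B k (xs @ [x]) (r u c) (r u c)" for u
        unfolding avg unfolding W'_def by (rule Suc.IH[OF rev xsx(3) r_in[OF p(3)]])
    qed
    also have "(\<integral>y. step_gap F xs x y \<partial>\<mu>) \<le> B x"
      by (rule B[OF adm_xsx])
    finally show ?thesis
      using False by (simp add: x_def[symmetric] r_def[symmetric] add.commute)
  qed
qed

section \<open>Revelation events\<close>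

definition \<tau> :: "'a cfg \<Rightarrow> nat" where
  "\<tau> c = stopping_time E \<Lambda> f T c"

lemma \<tau>_Least: "\<tau> c = (LEAST t. 1 \<le> t \<and> determined (revealed T c t) c)"
  by (simp only: \<tau>_def stopping_time_def determined_def)

lemma n_pos: "1 \<le> n"
proof -
  have "fst T \<in> \<X>"
    using tree by (auto simp: decision_tree_def split: prod.splits)
  then show ?thesis
    using finite_\<X> by (auto simp: Suc_le_eq card_gt_0_iff)
qed

lemma revealed_props:
  assumes "c \<in> space \<Omega>" "t \<le> n"
  shows "set (revealed T c t) \<subseteq> \<X>" "distinct (revealed T c t)"
  using admissible_order_props[OF revealed_admissible[OF assms]] by auto

lemma determined_n: "c \<in> space \<Omega> \<Longrightarrow> determined (revealed T c n) c"
  using revealed_props[of c n] by (intro determined_full) auto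

lemma \<tau>_props:
  assumes "c \<in> space \<Omega>"
  shows "1 \<le> \<tau> c" "determined (revealed T c (\<tau> c)) c" "\<tau> c \<le> n"
  using LeastI[of "\<lambda>t. 1 \<le> t \<and> determined (revealed T c t) c" n]
    Least_le[of "\<lambda>t. 1 \<le> t \<and> determined (revealed T c t) c" n] determined_n[OF assms] n_pos
  unfolding \<tau>_Least by blast+

lemma before_\<tau>: "1 \<le> t \<Longrightarrow> t < \<tau> c \<Longrightarrow> \<not> determined (revealed T c t) c"
  unfolding \<tau>_Least using not_less_Least by blast

lemma set_revealed: "set (revealed T c t) = (\<lambda>s. last (revealed T c s)) ` {1..t}"
proof (induction t)
  case (Suc t)
  then show ?case
    by (simp add: revealed_Suc atLeastAtMostSuc_conv)
qed simp

lemma sum_revealed: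
  assumes "c \<in> space \<Omega>"
  shows "t \<le> n \<Longrightarrow> (\<Sum>s\<in>{1..t}. B (last (revealed T c s))) = (\<Sum>x\<in>set (revealed T c t). B x :: real)"
proof (induction t)
  case (Suc t)
  then show ?case
    using revealed_props(2)[OF assms, of "Suc t"] by (simp add: revealed_Suc)
qed simp

lemma reveal_event_eq: "reveal_event E \<Lambda> f T x = {c \<in> space \<Omega>. x \<in> set (revealed T c (\<tau> c))}"
  unfolding reveal_event_def set_revealed \<tau>_def by (intro Collect_cong conj_cong refl) auto

lemma measurable_revealed:
  "t \<le> n \<Longrightarrow> (\<lambda>c. revealed T c t) \<in> \<Omega> \<rightarrow>\<^sub>M count_space {xs. set xs \<subseteq> \<X> \<and> distinct xs \<and> length xs = t}"
proof (induction t)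
  case (Suc t)
  let ?L = "\<lambda>t. {xs. set xs \<subseteq> \<X> \<and> distinct xs \<and> length xs = t}"
  have fin: "finite (?L t)"
    by (rule finite_subset[OF _ finite_lists_length_eq[OF finite_\<X>, of t]]) auto
  have "(\<lambda>c. xs @ [next_elem xs c]) \<in> \<Omega> \<rightarrow>\<^sub>M count_space (?L (Suc t))" if "xs \<in> ?L t" for xs
    using that Suc.prems by (intro measurable_compose[OF measurable_next_elem]) (auto simp: measurable_count_space_eq1)
  from measurable_compose_countable'[OF this Suc.IH countable_finite[OF fin]] Suc.prems show ?case
    by (simp add: revealed_Suc)
qed simp

lemma measurable_determined_revealed: "t \<le> n \<Longrightarrow> Measurable.pred \<Omega> (\<lambda>c. determined (revealed T c t) c)"
  by (rule measurable_compose_countable'[OF measurable_determined measurable_revealed])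
     (auto intro!: countable_finite finite_subset[OF _ finite_lists_length_eq[OF finite_\<X>, of t]])

lemma measurable_mem_revealed: "t \<le> n \<Longrightarrow> Measurable.pred \<Omega> (\<lambda>c. x \<in> set (revealed T c t))"
  by (rule measurable_compose[OF measurable_revealed]) auto

lemma reveal_event_sets: "reveal_event E \<Lambda> f T x \<in> sets \<Omega>"
proof -
  have "x \<in> set (revealed T c (\<tau> c)) \<longleftrightarrow> (\<exists>t\<in>{1..n}. determined (revealed T c t) c \<and>
      (\<forall>s\<in>{1..<t}. \<not> determined (revealed T c s) c) \<and> x \<in> set (revealed T c t))" if c: "c \<in> space \<Omega>" for c
  proof
    assume "x \<in> set (revealed T c (\<tau> c))"
    then show "\<exists>t\<in>{1..n}. determined (revealed T c t) c \<and>
      (\<forall>s\<in>{1..<t}. \<not> determined (revealed T c s) c) \<and> x \<in> set (revealed T c t)"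
      using \<tau>_props[OF c] before_\<tau>[of _ c] by (intro bexI[of _ "\<tau> c"]) auto
  next
    assume "\<exists>t\<in>{1..n}. determined (revealed T c t) c \<and>
      (\<forall>s\<in>{1..<t}. \<not> determined (revealed T c s) c) \<and> x \<in> set (revealed T c t)"
    then obtain t where t: "1 \<le> t" "determined (revealed T c t) c" "\<forall>s\<in>{1..<t}. \<not> determined (revealed T c s) c"
      "x \<in> set (revealed T c t)" by auto
    have "t = \<tau> c"
      using t \<tau>_props[OF c] before_\<tau>[of t c] by (cases t "\<tau> c" rule: linorder_cases) auto
    then show "x \<in> set (revealed T c (\<tau> c))"
      using t by simp
  qed
  then have "reveal_event E \<Lambda> f T x = {c \<in> space \<Omega>. \<exists>t\<in>{1..n}. determined (revealed T c t) c \<and>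
      (\<forall>s\<in>{1..<t}. \<not> determined (revealed T c s) c) \<and> x \<in> set (revealed T c t)}"
    unfolding reveal_event_eq by (intro Collect_cong conj_cong refl)
  also have "\<dots> \<in> sets \<Omega>"
    by (intro predE pred_intros_finite pred_intros_logic measurable_determined_revealed measurable_mem_revealed) auto
  finally show ?thesis .
qed

text \<open>Only an inequality, because the stopping time is at least 1 whereas the recursion stops
  immediately when \<open>f\<close> is constant.\<close>

lemma pathwise_le:
  assumes B: "\<And>x. 0 \<le> B x" and c: "c \<in> space \<Omega>"
  shows "t + k = n \<Longrightarrow> (\<And>s. 1 \<le> s \<Longrightarrow> s < t \<Longrightarrow> \<not> determined (revealed T c s) c) \<Longrightarrow>
    pathwise B (\<lambda>xs. h) k (revealed T c t) c \<le> h c + (\<Sum>s\<in>{t<..\<tau> c}. B (last (revealed T c s)))"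
proof (induction k arbitrary: t)
  case 0
  then show ?case
    using B by (simp add: sum_nonneg)
next
  case (Suc k)
  show ?case
  proof (cases "determined (revealed T c t) c")
    case True
    then show ?thesis
      using B by (simp add: sum_nonneg)
  next
    case False
    then have *: "\<not> determined (revealed T c s) c" if "1 \<le> s" "s < Suc t" for s
      using Suc.prems(2)[of s] that by (cases "s = t") auto
    then have "t < \<tau> c"
      using \<tau>_props(1,2)[OF c] by (meson not_less_eq)
    then have "{t<..\<tau> c} = insert (Suc t) {Suc t<..\<tau> c}"
      by auto
    then have "(\<Sum>s\<in>{t<..\<tau> c}. B (last (revealed T c s))) =
        B (next_elem (revealed T c t) c) + (\<Sum>s\<in>{Suc t<..\<tau> c}. B (last (revealed T c s)))"
      by (simp add: revealed_Suc)
    moreover have "pathwise B (\<lambda>xs. h) k (revealed T c (Suc t)) c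
        \<le> h c + (\<Sum>s\<in>{Suc t<..\<tau> c}. B (last (revealed T c s)))"
      using Suc.prems(1) * by (intro Suc.IH) auto
    ultimately show ?thesis
      using False by (simp add: revealed_Suc)
  qed
qed

lemma pathwise_const: "pathwise (\<lambda>_. 0) (\<lambda>xs. h) k xs c = h c"
  by (induction k arbitrary: xs) auto

text \<open>The mean of \<open>f\<close> squared is the joint mean with nothing revealed. By \<open>joint_mean_average\<close> it is at
  most the square of the mean plus the expected costs of the elements that the tree reveals.\<close>

lemma variance_le_sum:
  assumes B: "\<And>x. 0 \<le> B x"
    and gap: "\<And>xs x. admissible_order E \<Lambda> (xs @ [x]) \<Longrightarrow> (\<integral>y. step_gap F xs x y \<partial>\<mu>) \<le> B x"
  shows "\<mu>.variance F \<le> (\<Sum>x\<in>\<X>. measure \<mu> (reveal_event E \<Lambda> f T x) * B x)"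
proof -
  obtain c\<^sub>0 where "c\<^sub>0 \<in> space \<mu>"
    using \<mu>.not_empty by auto
  then have c\<^sub>0: "c\<^sub>0 \<in> space \<Omega>" by simp
  have proj_Nil: "proj [] c = proj [] c'" for c c' :: "'a cfg"
    by (simp add: proj_eq_iff)
  have const1: "depends_on [] (\<lambda>_. 1 :: real)"
    by (rule depends_on_const)
  let ?R = "reveal_event E \<Lambda> f T"
  have f2_meas: "(\<lambda>c. F c * F c) \<in> borel_measurable \<Omega>"
    using f_bdd(1) f_bdd(1) by (rule borel_measurable_times)
  have f2_bd: "\<bar>F c * F c\<bar> \<le> 1" if "c \<in> space \<Omega>" for c
    using mult_mono'[OF f_bdd(2)[OF that] f_bdd(2)[OF that]] by (simp add: abs_mult)
  have fm_meas: "(\<lambda>c. F c * mean) \<in> borel_measurable \<Omega>"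
    using f_bdd(1) by (intro borel_measurable_times borel_measurable_const)
  (* The coupling started on the diagonal stays there, so the joint mean is that of f squared. *)
  have "(\<integral>c. 1 * coupled (\<lambda>_. 0) (\<lambda>xs c y. F c * cexp F xs y) n [] c c \<partial>\<mu>)
      = (\<integral>c. 1 * pathwise (\<lambda>_. 0) (\<lambda>xs c. F c * F c) n [] c \<partial>\<mu>)"
  proof (rule integral_coupled_diagonal[OF f_cexp_measurable f_cexp_bound f_cexp_cong f2_meas f2_bd _ order.refl])
    fix xs :: "'a elem list" and \<phi> :: "'a cfg \<Rightarrow> real"
    assume xs: "set xs \<subseteq> \<X>" and \<phi>: "\<phi> \<in> borel_measurable \<Omega>" "depends_on xs \<phi>"
      "\<And>c. c \<in> space \<Omega> \<Longrightarrow> \<bar>\<phi> c\<bar> \<le> 1" "\<And>c. c \<in> space \<Omega> \<Longrightarrow> \<not> determined xs c \<Longrightarrow> \<phi> c = 0"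
    have "depends_on xs (\<lambda>c. \<phi> c * F c)"
    proof (rule depends_onI)
      fix c c' assume cc: "c \<in> space \<Omega>" "c' \<in> space \<Omega>" "proj xs c = proj xs c'"
      show "\<phi> c * F c = \<phi> c' * F c'"
      proof (cases "determined xs c")
        case True
        show ?thesis
          by (simp only: depends_onD[OF \<phi>(2) cc(3,1,2)] determined_f_cong[OF True cc(3,2)])
      next
        case False
        then show ?thesis
          using \<phi>(4)[OF cc(1)] \<phi>(4)[OF cc(2)] determined_cong[OF cc] by simp
      qed
    qed
    moreover have "\<bar>\<phi> c * F c\<bar> \<le> 1" if "c \<in> space \<Omega>" for c
      using mult_mono'[OF \<phi>(3)[OF that] f_bdd(2)[OF that]] by (simp add: abs_mult)
    ultimately have "(\<integral>c. (\<phi> c * F c) * cexp F xs c \<partial>\<mu>) = (\<integral>c. (\<phi> c * F c) * F c \<partial>\<mu>)"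
      using f_bdd(1) \<phi>(1) by (intro integral_cexp[OF xs _ _ _ f_bdd(1,2)] borel_measurable_times)
    then show "(\<integral>c. \<phi> c * (F c * cexp F xs c) \<partial>\<mu>) = (\<integral>c. \<phi> c * (F c * F c) \<partial>\<mu>)"
      by (simp only: mult.assoc)
  qed (simp_all add: const1)
  then have diag: "(\<integral>c. joint_mean n [] c c \<partial>\<mu>) = (\<integral>c. F c * F c \<partial>\<mu>)"
    by (simp add: joint_mean_def[symmetric] pathwise_const)
  have "(\<integral>c. joint_mean n [] c c \<partial>\<mu>) = (\<integral>c. joint_mean n [] c\<^sub>0 c \<partial>\<mu>)"
    using c\<^sub>0 by (intro Bochner_Integration.integral_cong refl joint_mean_cong proj_Nil) auto
  also have "\<dots> \<le> cost_bound B n [] c\<^sub>0 c\<^sub>0"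
    using c\<^sub>0 by (intro joint_mean_average gap) auto
  also have "\<dots> = (\<integral>c. cost_bound B n [] c\<^sub>0 c\<^sub>0 \<partial>\<mu>)"
    by simp
  also have "\<dots> = (\<integral>c. 1 * cost_bound B n [] c c \<partial>\<mu>)"
    unfolding mult_1
    by (intro Bochner_Integration.integral_cong refl coupled_cong proj_Nil f_mean_cong) (use c\<^sub>0 in simp_all)
  also have "\<dots> = (\<integral>c. 1 * pathwise B (\<lambda>xs c. F c * mean) n [] c \<partial>\<mu>)"
    by (rule integral_coupled_diagonal[OF f_mean_measurable f_mean_bound f_mean_cong fm_meas f_mean_bound abs_le_sum_elems sum_nonneg])
       (simp_all add: const1)
  also have "\<dots> \<le> (\<integral>c. F c * mean + (\<Sum>x\<in>\<X>. indicator (?R x) c * B x) \<partial>\<mu>)"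
  proof (rule integral_mono)
    have "integrable \<mu> (pathwise B (\<lambda>xs c. F c * mean) n [])"
    proof (rule \<mu>.integrable_bounded)
      have "pathwise B (\<lambda>xs c. F c * mean) n [] \<in> borel_measurable \<Omega>"
        by (rule pathwise_measurable[OF fm_meas]) auto
      then show "pathwise B (\<lambda>xs c. F c * mean) n [] \<in> borel_measurable \<mu>"
        by simp
      show "\<bar>pathwise B (\<lambda>xs c. F c * mean) n [] c\<bar> \<le> 1 + real n * (\<Sum>x\<in>\<X>. \<bar>B x\<bar>)" if "c \<in> space \<mu>" for c
        using that by (intro pathwise_bound f_mean_bound abs_le_sum_elems sum_nonneg) auto
    qed
    then show "integrable \<mu> (\<lambda>c. 1 * pathwise B (\<lambda>xs c. F c * mean) n [] c)"
      by simp
    show "integrable \<mu> (\<lambda>c. F c * mean + (\<Sum>x\<in>\<X>. indicator (?R x) c * B x))"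
      using reveal_event_sets f_bdd
      by (intro Bochner_Integration.integrable_add Bochner_Integration.integrable_sum integrable_mult_left
            \<mu>.integrable_bounded[of F 1] integrable_real_indicator) (auto simp: \<mu>(2) less_top[symmetric])
    fix c assume "c \<in> space \<mu>"
    then have c: "c \<in> space \<Omega>" by simp
    have "pathwise B (\<lambda>xs c. F c * mean) n (revealed T c 0) c
        \<le> F c * mean + (\<Sum>s\<in>{0<..\<tau> c}. B (last (revealed T c s)))"
      by (rule pathwise_le[OF B c]) auto
    also have "{0<..\<tau> c} = {1..\<tau> c}" by auto
    also have "(\<Sum>s\<in>{1..\<tau> c}. B (last (revealed T c s))) = (\<Sum>x\<in>set (revealed T c (\<tau> c)). B x)"
      by (rule sum_revealed[OF c \<tau>_props(3)[OF c]])
    also have "\<dots> = (\<Sum>x\<in>\<X>. indicator (?R x) c * B x)"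
      using revealed_props(1)[OF c \<tau>_props(3)[OF c]] finite_\<X> c
      by (intro sum.mono_neutral_cong_left) (simp_all add: reveal_event_eq indicator_def)
    finally show "1 * pathwise B (\<lambda>xs c. F c * mean) n [] c \<le> F c * mean + (\<Sum>x\<in>\<X>. indicator (?R x) c * B x)"
      by simp
  qed
  also have "\<dots> = mean * mean + (\<Sum>x\<in>\<X>. measure \<mu> (?R x) * B x)"
  proof -
    have int: "integrable \<mu> F"
      using f_bdd by (intro \<mu>.integrable_bounded[of F 1]) auto
    have intR: "integrable \<mu> (indicator (?R x) :: 'a cfg \<Rightarrow> real)" for x
      using reveal_event_sets[of x] by (intro integrable_real_indicator) (auto simp: \<mu>(2) less_top[symmetric])
    have "?R x \<inter> space \<mu> = ?R x" for x
      by (auto simp: reveal_event_eq)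
    then show ?thesis
      using int intR by (simp add: Bochner_Integration.integral_sum)
  qed
  finally have "(\<integral>c. F c * F c \<partial>\<mu>) - mean * mean \<le> (\<Sum>x\<in>\<X>. measure \<mu> (?R x) * B x)"
    by (simp add: diag)
  moreover have "\<mu>.variance F = (\<integral>c. F c * F c \<partial>\<mu>) - mean * mean"
  proof -
    have "\<mu>.variance F = covariance \<mu> F F"
      by (simp add: covariance_def power2_eq_square)
    also have "\<dots> = (\<integral>c. F c * F c \<partial>\<mu>) - mean * mean"
      using f_bdd by (intro \<mu>.covariance_eq[of _ _ 1 1]) auto
    finally show ?thesis .
  qed
  ultimately show ?thesis by simp
qed

end

context monotonic_model
begin

section \<open>Closing a vertex\<close>

lemma bdd_incr_edge: "e \<in> \<E> \<Longrightarrow> bdd_incr 1 (\<lambda>c. of_bool (snd c e))"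
  unfolding bdd_incr_def
  by (intro conjI ballI mono_onI measurable_edge_fun[OF finite_\<E>]) (auto simp: less_eq_prod_def le_fun_def)

lemma covariance_edge_nonneg:
  assumes "bdd_incr C g" "e \<in> \<E>"
  shows "0 \<le> covariance \<mu> g (\<lambda>c. of_bool (snd c e))"
  using positive_association[OF assms(1) bdd_incr_edge[OF assms(2)]]
    \<mu>.covariance_eq[of g "\<lambda>c. of_bool (snd c e)" C 1] bdd_incrD[OF assms(1)] bdd_incrD[OF bdd_incr_edge[OF assms(2)]]
  by auto

lemma integral_uniform_measure:
  fixes g :: "'v cfg \<Rightarrow> real"
  assumes A: "A \<in> sets \<mu>" "measure \<mu> A > 0" and g: "g \<in> borel_measurable \<mu>"
  shows "(\<integral>c. g c \<partial>uniform_measure \<mu> A) = (\<integral>c. g c * indicator A c \<partial>\<mu>) / measure \<mu> A"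
proof -
  have "uniform_measure \<mu> A = density \<mu> (\<lambda>c. ennreal (indicator A c / measure \<mu> A))"
    unfolding uniform_measure_def using A(2)
    by (intro arg_cong[where f="density \<mu>"] ext)
       (simp add: \<mu>.emeasure_eq_measure divide_ennreal[symmetric] ennreal_indicator)
  then have "(\<integral>c. g c \<partial>uniform_measure \<mu> A) = (\<integral>c. (indicator A c / measure \<mu> A) * g c \<partial>\<mu>)"
    using A g by (simp add: integral_real_density)
  also have "\<dots> = (\<integral>c. (g c * indicator A c) / measure \<mu> A \<partial>\<mu>)"
    by (simp add: mult.commute)
  finally show ?thesis by simp
qed

lemma closed_at_eq: "closed_at E \<Lambda> z = {c \<in> space \<Omega>. \<forall>e\<in>{e \<in> E. z \<in> e}. \<not> snd c e}"
proof -
  have "(\<forall>x. {z, x} \<in> E \<longrightarrow> \<not> \<omega> {z, x}) \<longleftrightarrow> (\<forall>e\<in>{e \<in> E. z \<in> e}. \<not> \<omega> e)" for \<omega>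
  proof
    assume *: "\<forall>x. {z, x} \<in> E \<longrightarrow> \<not> \<omega> {z, x}"
    show "\<forall>e\<in>{e \<in> E. z \<in> e}. \<not> \<omega> e"
    proof
      fix e assume e: "e \<in> {e \<in> E. z \<in> e}"
      then obtain x where "e = {z, x}"
        using edge_doubleton[of e thesis] by auto
      with e * show "\<not> \<omega> e" by auto
    qed
  qed auto
  then show ?thesis
    by (auto simp: closed_at_def)
qed

lemma closed_at_sets: "closed_at E \<Lambda> z \<in> sets \<mu>"
proof -
  have "Measurable.pred \<Omega> (\<lambda>c. (of_bool (\<forall>e\<in>{e \<in> E. z \<in> e}. \<not> snd c e) :: real) = 1)"
    using measurable_edge_fun[OF finite_\<E>, of "\<lambda>\<omega>. of_bool (\<forall>e\<in>{e \<in> E. z \<in> e}. \<not> \<omega> e)" \<Lambda>] by measurable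
  then show ?thesis
    by (simp add: closed_at_eq \<mu>(2) pred_def)
qed

text \<open>The left-hand side is the covariance of \<open>g\<close> with the event that some edge at \<open>z\<close> is open. With \<open>N\<close>
  open edges at \<open>z\<close>, \<open>N\<close> minus the indicator of that event is the truncated difference \<open>N - 1\<close>, which is
  increasing.\<close>

lemma closed_vertex_covariance:
  assumes z: "z \<in> \<Lambda>" and g: "bdd_incr C g"
  shows "(\<integral>c. g c \<partial>\<mu>) * measure \<mu> (closed_at E \<Lambda> z) - (\<integral>c. g c * indicator (closed_at E \<Lambda> z) c \<partial>\<mu>)
    \<le> (\<Sum>e\<in>{e \<in> \<E>. z \<in> e}. covariance \<mu> g (\<lambda>c. of_bool (snd c e)))"
proof -
  let ?C = "closed_at E \<Lambda> z"
  define S where "S = {e \<in> \<E>. z \<in> e}"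
  have "finite S"
    using finite_\<E> by (simp add: S_def)
  moreover have "S = {e \<in> E. z \<in> e}"
    using z by (auto simp: S_def incident_edges_def)
  ultimately have S: "finite S" "S = {e \<in> E. z \<in> e}" .
  define N where "N c = card {e \<in> S. snd c e}" for c :: "'v cfg"
  define h where "h c = real (N c - 1)" for c
  note g' = bdd_incrD[OF g]
  have N_mono: "N c \<le> N c'" if "c \<le> c'" for c c'
    unfolding N_def using that S(1) by (intro card_mono) (auto simp: less_eq_prod_def le_fun_def)
  have h_meas: "h \<in> borel_measurable \<Omega>"
    unfolding h_def N_def by (rule measurable_edge_fun[OF finite_\<E>])
  have h_bd: "\<bar>h c\<bar> \<le> real (card S)" for c
  proof -
    have "N c \<le> card S"
      unfolding N_def using S(1) by (intro card_mono) auto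
    then show ?thesis by (simp add: h_def)
  qed
  have h: "bdd_incr (real (card S)) h"
    unfolding bdd_incr_def
  proof (intro conjI h_meas mono_onI ballI h_bd)
    show "h c \<le> h c'" if "c \<le> c'" for c c'
      using N_mono[OF that] by (simp add: h_def)
  qed
  have h_eq: "h c = (\<Sum>e\<in>S. of_bool (snd c e)) - 1 + indicator ?C c" if "c \<in> space \<Omega>" for c
  proof -
    have "(\<Sum>e\<in>S. of_bool (snd c e)) = real (N c)"
      using S(1) by (simp add: N_def of_bool_def sum.If_cases Int_def)
    moreover have "indicator ?C c = (of_bool (N c = 0) :: real)"
    proof -
      have "N c = 0 \<longleftrightarrow> (\<forall>e\<in>S. \<not> snd c e)"
        unfolding N_def using S(1) by (subst card_0_eq) auto
      then show ?thesis
        using that by (simp only: closed_at_eq S(2)[symmetric] indicator_def mem_Collect_eq simp_thms)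
    qed
    ultimately show ?thesis
      by (cases "N c") (auto simp: h_def)
  qed
  have gb: "integrable \<mu> (\<lambda>c. g c * k c)" if "k \<in> borel_measurable \<Omega>" "\<And>c. c \<in> space \<Omega> \<Longrightarrow> \<bar>k c\<bar> \<le> 1" for k
  proof (rule \<mu>.integrable_bounded)
    show "(\<lambda>c. g c * k c) \<in> borel_measurable \<mu>"
      using g'(1) that(1) by simp
    show "\<bar>g c * k c\<bar> \<le> C * 1" if "c \<in> space \<mu>" for c
      using mult_mono'[OF g'(2) \<open>\<And>c. c \<in> space \<Omega> \<Longrightarrow> \<bar>k c\<bar> \<le> 1\<close>, of c c] that by (simp add: abs_mult)
  qed
  have ind: "(indicator ?C :: _ \<Rightarrow> real) \<in> borel_measurable \<Omega>"
    using closed_at_sets[of z] \<mu>(2) by simp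
  have S_sub: "e \<in> S \<Longrightarrow> e \<in> \<E>" for e by (simp add: S_def)
  have int_edge: "integrable \<mu> (\<lambda>c. of_bool (snd c e) :: real)" if "e \<in> S" for e
    using bdd_incrD(1,2)[OF bdd_incr_edge[OF S_sub[OF that]]] by (intro \<mu>.integrable_bounded[of _ 1]) simp_all
  have int_ind: "integrable \<mu> (indicator ?C :: _ \<Rightarrow> real)"
    by (rule integrable_real_indicator[OF closed_at_sets]) (simp add: less_top[symmetric])
  have C_sub: "?C \<inter> space \<mu> = ?C"
    by (auto simp: closed_at_eq)
  have int_g: "integrable \<mu> g"
    using g'(1,2) by (intro \<mu>.integrable_bounded[of _ C]) simp_all
  have int_ge: "integrable \<mu> (\<lambda>c. g c * of_bool (snd c e))" if "e \<in> S" for e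
    by (rule gb[OF bdd_incrD(1,2)[OF bdd_incr_edge[OF S_sub[OF that]]]])
  have int_gi: "integrable \<mu> (\<lambda>c. g c * indicator ?C c)"
    by (rule gb[OF ind]) (simp add: indicator_def)
  have "(\<integral>c. h c \<partial>\<mu>) = (\<integral>c. (\<Sum>e\<in>S. of_bool (snd c e)) - 1 + indicator ?C c \<partial>\<mu>)"
    by (intro Bochner_Integration.integral_cong) (simp_all add: h_eq)
  also have "\<dots> = (\<Sum>e\<in>S. \<integral>c. of_bool (snd c e) \<partial>\<mu>) - 1 + measure \<mu> ?C"
    using int_edge int_ind C_sub by (simp add: Bochner_Integration.integral_sum)
  finally have h1: "(\<integral>c. h c \<partial>\<mu>) = \<dots>" .
  have "(\<integral>c. g c * h c \<partial>\<mu>) = (\<integral>c. (\<Sum>e\<in>S. g c * of_bool (snd c e)) - g c + g c * indicator ?C c \<partial>\<mu>)"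
    by (intro Bochner_Integration.integral_cong) (simp_all add: h_eq algebra_simps sum_distrib_left)
  also have "\<dots> = (\<Sum>e\<in>S. \<integral>c. g c * of_bool (snd c e) \<partial>\<mu>) - (\<integral>c. g c \<partial>\<mu>) + (\<integral>c. g c * indicator ?C c \<partial>\<mu>)"
    using int_ge int_gi int_g by (simp add: Bochner_Integration.integral_sum)
  finally have h2: "(\<integral>c. g c * h c \<partial>\<mu>) = \<dots>" .
  have cov: "covariance \<mu> g (\<lambda>c. of_bool (snd c e)) =
      (\<integral>c. g c * of_bool (snd c e) \<partial>\<mu>) - (\<integral>c. g c \<partial>\<mu>) * (\<integral>c. of_bool (snd c e) \<partial>\<mu>)" if "e \<in> S" for e
    using bdd_incrD(1,2)[OF bdd_incr_edge[OF S_sub[OF that]]] g'(1,2)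
    by (intro \<mu>.covariance_eq[of _ _ C 1]) simp_all
  show ?thesis
    using positive_association[OF g h] unfolding h1 h2 S_def[symmetric]
    by (simp add: cov sum_subtractf sum_distrib_left algebra_simps)
qed

end

theorem theorem1p2:
  fixes V :: "'v set" and E :: "'v set set" and \<Lambda> :: "'v set"
    and \<mu> :: "'v cfg measure"
    and \<kappa> :: "'v set \<Rightarrow> 'v set set \<Rightarrow> 'v cfg \<Rightarrow> 'v cfg measure"
  assumes graph: "infinite_transitive_graph V E"
    and \<Lambda>: "finite \<Lambda>" "\<Lambda> \<subseteq> V"
    and \<mu>: "prob_space \<mu>" "sets \<mu> = sets (cfg_space \<Lambda> (incident_edges E \<Lambda>))"
    and \<kappa>: "consistent_cond_family \<Lambda> (incident_edges E \<Lambda>) \<mu> \<kappa>"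
    and weak_mono: "weakly_monotonic V E \<Lambda> \<kappa>"
    and closed_pos: "\<And>x. x \<in> \<Lambda> \<Longrightarrow> measure \<mu> (closed_at E \<Lambda> x) > 0"
    and closed_le: "\<And>z g. z \<in> \<Lambda> \<Longrightarrow> increasing_edge_fun (incident_edges E \<Lambda>) g \<Longrightarrow>
      (\<integral>c. g (snd c) \<partial>uniform_measure \<mu> (closed_at E \<Lambda> z))
        \<le> (\<integral>c. g (snd c) \<partial>\<kappa> {z} {} (\<lambda>x\<in>{z}. 0, \<lambda>e\<in>{}. undefined))"
  shows "\<And>f T. increasing_edge_fun (incident_edges E \<Lambda>) f \<Longrightarrow>
      decision_tree E \<Lambda> T \<Longrightarrow> admissible E \<Lambda> T \<Longrightarrow>
      prob_space.variance \<mu> (\<lambda>c. f (snd c))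
        \<le> (\<Sum>e\<in>incident_edges E \<Lambda>.
              \<delta> E \<Lambda> \<mu> f T e * covariance \<mu> (\<lambda>c. f (snd c)) (\<lambda>c. of_bool (snd c e)))"
proof -
  fix f :: "('v set \<Rightarrow> bool) \<Rightarrow> real" and T :: "'v dtree"
  assume f: "increasing_edge_fun (incident_edges E \<Lambda>) f"
    and tree: "decision_tree E \<Lambda> T" and adm: "admissible E \<Lambda> T"
  interpret tree_model V E \<Lambda> \<mu> \<kappa> f T
    by (intro tree_model.intro monotonic_model.intro tree_model_axioms.intro) fact+
  define cov where "cov e = covariance \<mu> (\<lambda>c. f (snd c)) (\<lambda>c. of_bool (snd c e))" for e
  define q where "q z = measure \<mu> (closed_at E \<Lambda> z)" for z
  define R where "R x = measure \<mu> (reveal_event E \<Lambda> f T x)" for x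
  have cov_nonneg: "0 \<le> cov e" if "e \<in> \<E>" for e
    unfolding cov_def by (rule covariance_edge_nonneg[OF bdd_incr_f that])
  define B where "B x = (case x of Inl z \<Rightarrow> (\<Sum>e\<in>{e \<in> \<E>. z \<in> e}. cov e) / q z
      | Inr e \<Rightarrow> if e \<in> \<E> then cov e else 0)" for x
  have B_nonneg: "0 \<le> B x" for x
    using cov_nonneg by (cases x) (auto simp: B_def q_def intro!: divide_nonneg_nonneg sum_nonneg)
  have gap: "(\<integral>y. step_gap F xs x y \<partial>\<mu>) \<le> B x" if xs: "admissible_order E \<Lambda> (xs @ [x])" for xs x
  proof (cases x)
    case (Inr e)
    then have "e \<in> \<E>"
      using admissible_order_snocD(2)[OF xs] by (auto simp: \<X>_def)
    then show ?thesis
      using step_gap_edge[of xs e, OF _ bdd_incr_f] xs by (simp add: Inr B_def cov_def)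
  next
    case (Inl z)
    then have z: "z \<in> \<Lambda>"
      using admissible_order_snocD(2)[OF xs] by (auto simp: \<X>_def)
    have q: "0 < q z"
      unfolding q_def by (rule closed_pos[OF z])
    obtain c\<^sub>0 where "c\<^sub>0 \<in> space \<mu>"
      using \<mu>.not_empty by auto
    then have c\<^sub>0: "c\<^sub>0 \<in> space \<Omega>" by simp
    have "(\<integral>y. step_gap F xs x y \<partial>\<mu>) \<le> mean - cexp F [Inl z] (set_coord (Inl z) 0 c\<^sub>0)"
      using step_gap_vertex[OF _ bdd_incr_f c\<^sub>0] xs by (simp add: Inl)
    also have "cexp F [Inl z] (set_coord (Inl z) 0 c\<^sub>0) = (\<integral>c. f (snd c) \<partial>\<kappa> {z} {} (\<lambda>x\<in>{z}. 0, \<lambda>e\<in>{}. undefined))"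
    proof -
      have "proj [Inl z] (set_coord (Inl z) 0 c\<^sub>0) = (\<lambda>x\<in>{z}. 0, \<lambda>e\<in>{}. undefined)"
        by (auto simp: proj_def restrict_cfg_def verts_of_def edges_of_def fun_eq_iff)
      then show ?thesis
        by (simp add: cexp_def K_def verts_of_def edges_of_def)
    qed
    also have "mean - \<dots> \<le> mean - (\<integral>c. f (snd c) \<partial>uniform_measure \<mu> (closed_at E \<Lambda> z))"
      using closed_le[OF z f] by simp
    also have "\<dots> = mean - (\<integral>c. F c * indicator (closed_at E \<Lambda> z) c \<partial>\<mu>) / q z"
      using f_bdd(1) closed_pos[OF z] unfolding q_def
      by (subst integral_uniform_measure[OF closed_at_sets]) auto
    also have "\<dots> = (mean * q z - (\<integral>c. F c * indicator (closed_at E \<Lambda> z) c \<partial>\<mu>)) / q z"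
      using q by (simp add: field_simps)
    also have "\<dots> \<le> B x"
      unfolding Inl B_def q_def cov_def sum.case
      by (rule divide_right_mono[OF closed_vertex_covariance[OF z bdd_incr_f]]) simp
    finally show ?thesis .
  qed
  have "\<mu>.variance F \<le> (\<Sum>x\<in>\<X>. R x * B x)"
    unfolding R_def by (rule variance_le_sum[OF B_nonneg gap])
  also have "\<dots> = (\<Sum>z\<in>\<Lambda>. R (Inl z) * B (Inl z)) + (\<Sum>e\<in>\<E>. R (Inr e) * B (Inr e))"
    using \<Lambda> finite_\<E> by (simp add: \<X>_def sum.Plus)
  also have "(\<Sum>z\<in>\<Lambda>. R (Inl z) * B (Inl z)) = (\<Sum>z\<in>\<Lambda>. \<Sum>e\<in>{e \<in> \<E>. z \<in> e}. R (Inl z) / q z * cov e)"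
    by (simp add: B_def sum_distrib_left sum_divide_distrib)
  also have "\<dots> = (\<Sum>e\<in>\<E>. \<Sum>z\<in>{z \<in> \<Lambda>. z \<in> e}. R (Inl z) / q z * cov e)"
    by (rule sum.swap_restrict[OF \<Lambda>(1) finite_\<E>])
  also have "\<dots> + (\<Sum>e\<in>\<E>. R (Inr e) * B (Inr e)) = (\<Sum>e\<in>\<E>. \<delta> E \<Lambda> \<mu> f T e * cov e)"
  proof -
    have "{z \<in> \<Lambda>. z \<in> e} = e \<inter> \<Lambda>" for e by auto
    then show ?thesis
      unfolding sum.distrib[symmetric]
      by (intro sum.cong) (simp_all add: \<delta>_def R_def q_def B_def sum_distrib_right distrib_right)
  qed
  finally show "\<mu>.variance (\<lambda>c. f (snd c))
        \<le> (\<Sum>e\<in>incident_edges E \<Lambda>.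
              \<delta> E \<Lambda> \<mu> f T e * covariance \<mu> (\<lambda>c. f (snd c)) (\<lambda>c. of_bool (snd c e)))"
    by (simp only: cov_def)
qed

end
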